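(* Let $k$ be an algebraically closed field, $R=k[x,y,z]$, and let $I\subset R$ be the base ideal of a Cremona map of $\mathbb P^2$ of degree $d\geq 2$ (without fixed part) with weighted cluster of base points $\mathcal K=(K,\boldsymbol\mu)$. Then $$I\subset I^{\rm sat}\subset\bar{I}\subset\tilde{I}\subset I_{\mathcal K}\subset\mathfrak F_{\mathcal K}.$$ Supplement: $I_d=I^{\rm sat}_d=\bar I_d=\tilde I_d=(I_{\mathcal K})_d$.
   Context: $R$ is standard graded. A rational map $F:\mathbb P^2\dashrightarrow\mathbb P^2$ of degree $d$ without fixed part is given by three forms of degree $d$ with no nontrivial common factor; its base ideal $I$ is generated by these forms; $F$ is Cremona if birational. $I^{\rm sat}=I:(x,y,z)^\infty$; $\bar I$ is the integral closure of $I$. Weighted cluster: $e_p(D)$ is the order of vanishing at $p$ of a local equation of the curve $D$ (on a smooth surface). The proper base points of $F$ are the points of $V(I)\subset\mathbb P^2$; for such $p$ put $\mu_p=\min\{e_p(f): f\in I_d\}$ and $U_p=\{f\in I_d: e_p(f)=\mu_p\}$. A point $q$ on the exceptional curve of the blowup of $p$ is a base point infinitely near to $p$ if it lies on the proper transform of every $V(f)$, $f\in U_p$; $\mu_q$ is the minimum of the multiplicities at $q$ of these proper transforms; one repeats successively. $K$ is the set of all base points (proper and infinitely near), $\boldsymbol\mu=(\mu_p)_{p\in K}$, $\mathcal K=(K,\boldsymbol\mu)$. Fat ideal: $\mathfrak F_{\mathcal K}=\bigcap_j I(p_j)^{\mu_{p_j}}$, over the proper points $p_j\in K$, with $I(p_j)\subset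 R$ the homogeneous prime ideal of $p_j$. Full ideal of curves: let $\mathcal B_K$ be the surface obtained by successively blowing up the points of $K$. A plane curve $C$ passes virtually through $\mathcal K$ if the divisor $\bar C^K-\sum_{p\in K}\mu_p\bar E_p^K$ on $\mathcal B_K$ is effective, where $\bar C^K$ is the total transform of $C$ and $\bar E_p^K$ is the total transform on $\mathcal B_K$ of the exceptional curve of the blowup of $p$. $I_{\mathcal K}=\bigoplus_{m\ge0}\ell_{\mathcal K}(m)$, where $\ell_{\mathcal K}(m)\subset R_m$ is the space of forms $f$ of degree $m$ such that $V(f)$ passes virtually through $\mathcal K$ (including $f=0$). Divisorial cover ideal: a valuation ring $(V,\mathfrak m_V)$ of the fraction field of $R$ containing $R$ is divisorial on $R$ if the transcendence degree of $V/\mathfrak m_V$ over the residue field of $R$ at $\mathfrak m_V\cap R$ is $\operatorname{ht}(\mathfrak m_V\cap R)-1$. $\mathrm D(R)$ is the set of the corresponding (divisorial) valuations; for $v\in\mathrm D(R)$, $v(I)=\min\{v(f): f\in I\}$. $\tilde I=\bigoplus_{m\ge0}\tilde I(m)$ with $\tilde I(m)=\bigcap_{v\in\mathrm D(R)}\{f\in R_m: v(f)\ge v(I)\}$. *)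

theory Defs
  imports
    "HOL-Computational_Algebra.Computational_Algebra"
    "HOL-Library.Extended_Nat"
begin

section \<open>Ideals in a commutative ring\<close>

text \<open>Ideals are the submodules of the ring regarded as a module over itself.\<close>

definition is_ideal :: "'a::comm_ring_1 set \<Rightarrow> bool" where
  "is_ideal J \<longleftrightarrow> module.subspace (*) J"

definition ideal_gen :: "'a::comm_ring_1 set \<Rightarrow> 'a set" where
  "ideal_gen S = module.span (*) S"

definition ideal_pow :: "'a::comm_ring_1 set \<Rightarrow> nat \<Rightarrow> 'a set" where
  "ideal_pow J n = ideal_gen {prod_list gs | gs. length gs = n \<and> set gs \<subseteq> J}"

definition prime_ideal :: "'a::comm_ring_1 set \<Rightarrow> bool" where
  "prime_ideal P \<longleftrightarrow>
     is_ideal P \<and> P \<noteq> UNIV \<and> (\<forall>a b. a * b \<in> P \<longrightarrow> a \<in> P \<or> b \<in> P)"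

text \<open>Supremum of the lengths of the strict chains of prime ideals ending in \<open>P\<close>.\<close>

definition height :: "'a::comm_ring_1 set \<Rightarrow> enat" where
  "height P = Sup {enat n | n. \<exists>C. (\<forall>i\<le>n. prime_ideal (C i)) \<and>
                                   (\<forall>i<n. C i \<subset> C (Suc i)) \<and> C n = P}"

definition integral_closure :: "'a::comm_ring_1 set \<Rightarrow> 'a set" where
  "integral_closure J = {f. \<exists>n\<ge>1. \<exists>a. (\<forall>i\<in>{1..n}. a i \<in> ideal_pow J i) \<and>
                                   f ^ n + (\<Sum>i=1..n. a i * f ^ (n - i)) = 0}"


section \<open>Valuation rings of the fraction field\<close>

definition valuation_ring :: "'f::field set \<Rightarrow> bool" where
  "valuation_ring V \<longleftrightarrow>
     0 \<in> V \<and> 1 \<in> V \<and>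
     (\<forall>a\<in>V. \<forall>b\<in>V. a + b \<in> V \<and> a * b \<in> V \<and> - a \<in> V) \<and>
     (\<forall>a. a \<in> V \<or> inverse a \<in> V)"

definition max_ideal :: "'f::field set \<Rightarrow> 'f set" where
  "max_ideal V = {a \<in> V. a = 0 \<or> inverse a \<notin> V}"

text \<open>
  The valuation of \<open>V\<close> takes its values in the group of nonzero elements modulo units of \<open>V\<close>,
  together with the value infinity at \<open>0\<close>;
  \<open>val_le V a b\<close> says \<open>v(a) \<le> v(b)\<close>, that is, \<open>b \<in> a V\<close>.
\<close>

definition val_le :: "'f::field set \<Rightarrow> 'f \<Rightarrow> 'f \<Rightarrow> bool" where
  "val_le V a b \<longleftrightarrow> (\<exists>t\<in>V. b = a * t)"

text \<open>\<open>v(J) \<le> v(f)\<close>, where \<open>v(J)\<close> is the minimum of \<open>v\<close> on \<open>J\<close>.\<close>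

definition val_ideal_le :: "'a::idom fract set \<Rightarrow> 'a set \<Rightarrow> 'a \<Rightarrow> bool" where
  "val_ideal_le V J f \<longleftrightarrow>
     (\<exists>g\<in>J. (\<forall>h\<in>J. val_le V (to_fract g) (to_fract h)) \<and> val_le V (to_fract g) (to_fract f))"

definition center :: "'a::idom fract set \<Rightarrow> 'a set" where
  "center V = {a. to_fract a \<in> max_ideal V}"

definition localization :: "'a::idom set \<Rightarrow> 'a fract set" where
  "localization P = {to_fract a / to_fract s | a s. s \<notin> P}"

text \<open>
  The residues of \<open>t 0, \<dots>, t (n - 1)\<close> in \<open>V / max_ideal V\<close> are algebraically independent over the
  residue field \<open>A / max_ideal A\<close> of a local ring \<open>A \<subseteq> V\<close> dominated by \<open>V\<close>: a polynomial with
  coefficients \<open>c \<alpha>\<close> in \<open>A\<close> (\<open>\<alpha>\<close> ranging over exponent vectors) whose value at \<open>t\<close> has residue \<open>0\<close>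
  has all its coefficients of residue \<open>0\<close>.
\<close>

definition residually_alg_indep :: "'f::field set \<Rightarrow> 'f set \<Rightarrow> nat \<Rightarrow> (nat \<Rightarrow> 'f) \<Rightarrow> bool" where
  "residually_alg_indep A V n t \<longleftrightarrow>
     (\<forall>i<n. t i \<in> V) \<and>
     (\<forall>E c. finite E \<and> (\<forall>\<alpha>\<in>E. length \<alpha> = n \<and> c \<alpha> \<in> A) \<and>
            (\<Sum>\<alpha>\<in>E. c \<alpha> * (\<Prod>i<n. t i ^ (\<alpha> ! i))) \<in> max_ideal V
            \<longrightarrow> (\<forall>\<alpha>\<in>E. c \<alpha> \<in> max_ideal V))"

definition residue_trdeg :: "'f::field set \<Rightarrow> 'f set \<Rightarrow> enat" where
  "residue_trdeg A V = Sup {enat n | n. \<exists>t. residually_alg_indep A V n t}"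

text \<open>
  The condition \<open>trdeg = height - 1\<close> is written without subtraction, so that \<open>V\<close> equal to the
  whole field (center of height \<open>0\<close>) is excluded.
\<close>

definition divisorial :: "'a::idom fract set \<Rightarrow> bool" where
  "divisorial V \<longleftrightarrow>
     valuation_ring V \<and> range to_fract \<subseteq> V \<and>
     eSuc (residue_trdeg (localization (center V)) V) = height (center V)"


section \<open>Forms in three variables\<close>

text \<open>
  \<open>k[x,y,z]\<close> is the iterated polynomial ring \<open>k[x][y][z]\<close>, so that the coefficient of
  \<open>x\<^sup>i y\<^sup>j z\<^sup>l\<close> in \<open>f\<close> is \<open>coeff (coeff (coeff f l) j) i\<close>; likewise \<open>k[u,v]\<close> is \<open>k[u][v]\<close>.
\<close>

type_synonym 'k poly2 = "'k poly poly"
type_synonym 'k poly3 = "'k poly poly poly"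

definition X :: "'k::field poly3" where "X = [:[:[:0, 1:]:]:]"
definition Y :: "'k::field poly3" where "Y = [:[:0, 1:]:]"
definition Z :: "'k::field poly3" where "Z = [:0, 1:]"

definition U :: "'k::field poly2" where "U = [:[:0, 1:]:]"
definition V :: "'k::field poly2" where "V = [:0, 1:]"

abbreviation const2 :: "'k::field \<Rightarrow> 'k poly2" where "const2 c \<equiv> [:[:c:]:]"
abbreviation const3 :: "'k::field \<Rightarrow> 'k poly3" where "const3 c \<equiv> [:[:[:c:]:]:]"

text \<open>Substitution of elements of a \<open>k\<close>-algebra with structure map \<open>\<iota>\<close>.\<close>

definition eval2 :: "('k::field \<Rightarrow> 'b::comm_ring_1) \<Rightarrow> 'b \<Rightarrow> 'b \<Rightarrow> 'k poly2 \<Rightarrow> 'b" where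
  "eval2 \<iota> a b g = poly (map_poly (\<lambda>h. poly (map_poly \<iota> h) a) g) b"

definition eval3 :: "('k::field \<Rightarrow> 'b::comm_ring_1) \<Rightarrow> 'b \<Rightarrow> 'b \<Rightarrow> 'b \<Rightarrow> 'k poly3 \<Rightarrow> 'b" where
  "eval3 \<iota> a b c f = poly (map_poly (eval2 \<iota> a b) f) c"

definition form :: "nat \<Rightarrow> 'k::field poly3 \<Rightarrow> bool" where
  "form m f \<longleftrightarrow> (\<forall>i j l. coeff (coeff (coeff f l) j) i \<noteq> 0 \<longrightarrow> i + j + l = m)"

definition graded_part :: "'k::field poly3 set \<Rightarrow> nat \<Rightarrow> 'k poly3 set" where
  "graded_part J m = {f \<in> J. form m f}"

definition direct_sum :: "(nat \<Rightarrow> 'k::field poly3 set) \<Rightarrow> 'k poly3 set" where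
  "direct_sum L = {\<Sum>m\<le>N. g m | N g. \<forall>m\<le>N. g m \<in> L m}"

definition saturation :: "'k::field poly3 set \<Rightarrow> 'k poly3 set" where
  "saturation J = {f. \<exists>n. \<forall>g\<in>ideal_pow (ideal_gen {X, Y, Z}) n. g * f \<in> J}"

definition divisorial_cover :: "'k::field poly3 set \<Rightarrow> 'k poly3 set" where
  "divisorial_cover J =
     direct_sum (\<lambda>m. {f. form m f \<and> (\<forall>W. divisorial W \<longrightarrow> val_ideal_le W J f)})"


section \<open>Rational maps of the projective plane\<close>

type_synonym 'k triple = "'k poly3 \<times> 'k poly3 \<times> 'k poly3"

text \<open>Rational maps without fixed part, given by coprime forms of degree \<open>d\<close>.\<close>

fun rational_map :: "nat \<Rightarrow> 'k::field triple \<Rightarrow> bool" where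
  "rational_map d (f0, f1, f2) \<longleftrightarrow>
     form d f0 \<and> form d f1 \<and> form d f2 \<and>
     (\<forall>h. h dvd f0 \<and> h dvd f1 \<and> h dvd f2 \<longrightarrow> is_unit h)"

fun compose :: "'k::field triple \<Rightarrow> 'k triple \<Rightarrow> 'k triple" where
  "compose (g0, g1, g2) (f0, f1, f2) =
     (eval3 const3 f0 f1 f2 g0, eval3 const3 f0 f1 f2 g1, eval3 const3 f0 f1 f2 g2)"

definition represents_identity :: "'k::field triple \<Rightarrow> bool" where
  "represents_identity F \<longleftrightarrow> (\<exists>h. h \<noteq> 0 \<and> F = (h * X, h * Y, h * Z))"

definition cremona :: "nat \<Rightarrow> 'k::field triple \<Rightarrow> bool" where
  "cremona d F \<longleftrightarrow> rational_map d F \<and>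
     (\<exists>e G. rational_map e G \<and>
            represents_identity (compose G F) \<and> represents_identity (compose F G))"

fun base_ideal :: "'k::field triple \<Rightarrow> 'k poly3 set" where
  "base_ideal (f0, f1, f2) = ideal_gen {f0, f1, f2}"


section \<open>Proper and infinitely near points of the plane\<close>

text \<open>Points of the projective plane, each given by its coordinate vector with leading entry \<open>1\<close>.\<close>

type_synonym 'k pt = "'k \<times> 'k \<times> 'k"

definition P2 :: "'k::field pt set" where
  "P2 = {(1, b, c) | b c. True} \<union> {(0, 1, c) | c. True} \<union> {(0, 0, 1)}"

fun value_at :: "'k::field pt \<Rightarrow> 'k poly3 \<Rightarrow> 'k" where
  "value_at (a, b, c) f = eval3 id a b c f"

text \<open>
  Local equation at \<open>p\<close> of the curve of a form, in affine coordinates \<open>u, v\<close> centered at \<open>p\<close>.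
\<close>

fun local_eq :: "'k::field pt \<Rightarrow> 'k poly3 \<Rightarrow> 'k poly2" where
  "local_eq (a, b, c) f =
     (if a \<noteq> 0 then eval3 const2 1 (const2 b + U) (const2 c + V) f
      else if b \<noteq> 0 then eval3 const2 U 1 (const2 c + V) f
      else eval3 const2 U V 1 f)"

text \<open>
  Blowing up the origin of a \<open>(u,v)\<close>-chart, the exceptional curve is the projective line of
  directions \<open>v = a u\<close> (\<open>Slope a\<close>) and \<open>u = 0\<close> (\<open>Vertical\<close>). At the point with direction \<open>Slope a\<close>
  there are new coordinates \<open>u' = u, v' = v/u - a\<close> centered at that point, and at \<open>Vertical\<close> new
  coordinates \<open>u' = u/v, v' = v\<close>. The map \<open>chart\<close> expresses a function of the old coordinates in
  the new ones, and \<open>exc_eq\<close> is the equation of the exceptional curve in the new coordinates.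
\<close>

datatype 'k direction = Slope 'k | Vertical

fun chart :: "'k::field direction \<Rightarrow> 'k poly2 \<Rightarrow> 'k poly2" where
  "chart (Slope a) g = eval2 const2 U (U * (V + const2 a)) g"
| "chart Vertical g = eval2 const2 (U * V) V g"

fun exc_eq :: "'k::field direction \<Rightarrow> 'k poly2" where
  "exc_eq (Slope a) = U"
| "exc_eq Vertical = V"

text \<open>
  A point equal or infinitely near to the proper point \<open>p\<close> is \<open>(p, ds)\<close>, where \<open>ds\<close> lists the
  directions of the successive points, the latest one first: \<open>(p, a # ds)\<close> is the point
  \<open>a\<close> on the exceptional curve of the blowup of \<open>(p, ds)\<close>. Polynomials in \<open>u, v\<close> are understood in
  the coordinates at the point under consideration.
\<close>

type_synonym 'k npt = "'k pt \<times> 'k direction list"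

text \<open>Order of vanishing at the origin of a nonzero \<open>g\<close>.\<close>

definition order0 :: "'k::field poly2 \<Rightarrow> nat" where
  "order0 g = (LEAST n. \<exists>i j. i + j = n \<and> coeff (coeff g j) i \<noteq> 0)"

text \<open>Local equation at \<open>(p, ds)\<close> of the proper transform of the curve of \<open>f\<close>.\<close>

fun proper_transform :: "'k::field poly3 \<Rightarrow> 'k npt \<Rightarrow> 'k poly2" where
  "proper_transform f (p, []) = local_eq p f"
| "proper_transform f (p, a # ds) =
     chart a (proper_transform f (p, ds)) div exc_eq a ^ order0 (proper_transform f (p, ds))"

definition mult :: "'k::field poly3 \<Rightarrow> 'k npt \<Rightarrow> nat" where
  "mult f q = order0 (proper_transform f q)"

text \<open>
  For \<open>L = I\<^sub>d\<close>, \<open>min_mult_forms L q\<close> is the set \<open>U\<^sub>q\<close> of the members of minimal multiplicity at \<open>q\<close>,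
  the minimum being over all nonzero members of \<open>L\<close> if \<open>q\<close> is proper and over \<open>U\<^sub>p\<close> if \<open>q\<close> is in the
  first neighbourhood of \<open>p\<close>. That minimum is \<open>base_mult L q\<close>.
\<close>

fun min_mult_forms :: "'k::field poly3 set \<Rightarrow> 'k npt \<Rightarrow> 'k poly3 set" where
  "min_mult_forms L (p, []) =
     {f \<in> L - {0}. \<forall>g\<in>L - {0}. mult f (p, []) \<le> mult g (p, [])}"
| "min_mult_forms L (p, a # ds) =
     {f \<in> min_mult_forms L (p, ds).
        \<forall>g\<in>min_mult_forms L (p, ds). mult f (p, a # ds) \<le> mult g (p, a # ds)}"

fun base_mult :: "'k::field poly3 set \<Rightarrow> 'k npt \<Rightarrow> nat" where
  "base_mult L (p, []) = (INF f\<in>L - {0}. mult f (p, []))"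
| "base_mult L (p, a # ds) = (INF f\<in>min_mult_forms L (p, ds). mult f (p, a # ds))"

inductive_set base_points :: "'k::field poly3 set \<Rightarrow> nat \<Rightarrow> 'k npt set" for J d where
  proper: "p \<in> P2 \<Longrightarrow> \<forall>f\<in>J. value_at p f = 0 \<Longrightarrow> (p, []) \<in> base_points J d"
| inf_near: "(p, ds) \<in> base_points J d \<Longrightarrow>
     \<forall>f\<in>min_mult_forms (graded_part J d) (p, ds).
        eval2 id 0 0 (proper_transform f (p, a # ds)) = 0 \<Longrightarrow>
     (p, a # ds) \<in> base_points J d"

type_synonym 'k cluster = "'k npt set \<times> ('k npt \<Rightarrow> nat)"

definition base_cluster :: "'k::field triple \<Rightarrow> nat \<Rightarrow> 'k cluster" where
  "base_cluster F d =
     (base_points (base_ideal F) d, base_mult (graded_part (base_ideal F) d))"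


section \<open>The ideals of a weighted cluster\<close>

definition point_ideal :: "'k::field pt \<Rightarrow> 'k poly3 set" where
  "point_ideal p = ideal_gen {f. (\<exists>m. form m f) \<and> value_at p f = 0}"

fun fat_ideal :: "'k::field cluster \<Rightarrow> 'k poly3 set" where
  "fat_ideal (K, \<mu>) = (\<Inter>p\<in>{p. (p, []) \<in> K}. ideal_pow (point_ideal p) (\<mu> (p, [])))"

text \<open>Local equation of a total transform after blowing up in the directions \<open>ds\<close>.\<close>

primrec pullback :: "'k::field direction list \<Rightarrow> 'k poly2 \<Rightarrow> 'k poly2" where
  "pullback [] g = g"
| "pullback (a # ds) g = chart a (pullback ds g)"

text \<open>
  The (closed) points of the surface obtained by blowing up all points of \<open>K\<close>: those points that
  are not blown up themselves but all of whose predecessors are.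
\<close>

definition blowup_surface :: "'k::field npt set \<Rightarrow> 'k npt set" where
  "blowup_surface K =
     {(p, ds). p \<in> P2 \<and> (p, ds) \<notin> K \<and> (\<forall>i<length ds. (p, drop (Suc i) ds) \<in> K)}"

fun total_transform :: "'k::field poly3 \<Rightarrow> 'k npt \<Rightarrow> 'k poly2" where
  "total_transform f (p, ds) = pullback ds (local_eq p f)"

text \<open>
  Local equation at a point \<open>(p, ds)\<close> of the blown up surface of the divisor
  \<open>\<Sum>r\<in>K. \<mu> r * E r\<close>, where \<open>E r\<close> is the total transform of the exceptional curve of the
  blowup of \<open>r\<close>. Only the predecessors \<open>r = (p, drop (Suc i) ds)\<close> of \<open>(p, ds)\<close> contribute, and the
  exceptional curve of such an \<open>r\<close> has equation \<open>exc_eq (ds ! i)\<close> in the coordinates at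
  \<open>(p, drop i ds)\<close>.
\<close>

fun exc_divisor_eq :: "('k::field npt \<Rightarrow> nat) \<Rightarrow> 'k npt \<Rightarrow> 'k poly2" where
  "exc_divisor_eq \<mu> (p, ds) =
     (\<Prod>i<length ds. pullback (take i ds) (exc_eq (ds ! i)) ^ \<mu> (p, drop (Suc i) ds))"

text \<open>Divisibility in the local ring of \<open>k[u,v]\<close> at the origin.\<close>

definition dvd_local :: "'k::field poly2 \<Rightarrow> 'k poly2 \<Rightarrow> bool" where
  "dvd_local h g \<longleftrightarrow> (\<exists>s t. eval2 id 0 0 s \<noteq> 0 \<and> s * g = t * h)"

text \<open>
  The difference of the two divisors is effective iff the quotient of their local equations is
  regular at every point of the surface.
\<close>

fun passes_virtually :: "'k::field cluster \<Rightarrow> 'k poly3 \<Rightarrow> bool" where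
  "passes_virtually (K, \<mu>) f \<longleftrightarrow>
     (\<forall>q\<in>blowup_surface K. dvd_local (exc_divisor_eq \<mu> q) (total_transform f q))"

definition full_ideal :: "'k::field cluster \<Rightarrow> 'k poly3 set" where
  "full_ideal \<K> = direct_sum (\<lambda>m. {f. form m f \<and> (f = 0 \<or> passes_virtually \<K> f)})"

end

theory Submission
  imports Defs
begin

text \<open>
  Let \<open>f\<^sub>0, f\<^sub>1, f\<^sub>2\<close> be the forms of the Cremona map, \<open>L = I\<^sub>d\<close> the net that they span and \<open>\<K> = (K, \<mu>)\<close> the
  cluster of base points.

  The heart of the matter is that a form \<open>f\<close> of degree \<open>d\<close> that passes virtually through \<open>\<K>\<close> lies in
  \<open>L\<close> (\<open>virtual_forms_of_degree_d\<close>). Let \<open>G\<close> be the inverse map, so that \<open>f\<^sub>i(G) = h x\<^sub>i\<close> for a form \<open>h\<close>.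
  If \<open>h\<close> divides \<open>f(G)\<close>, the quotient is a linear form \<open>\<Sum> c\<^sub>i x\<^sub>i\<close>, hence \<open>f - \<Sum> c\<^sub>i f\<^sub>i\<close> vanishes on \<open>G\<close>,
  and composing with \<open>F\<close> shows that it is \<open>0\<close>. The divisibility is tested on lines
  (\<open>form_dvd_if_on_lines\<close>), and there at one point at a time, that is, on the germ of arc which \<open>G\<close>
  traces along the line. The centre of an arc is followed through the successive blowups
  (\<open>arc_at_point\<close>): where it leaves \<open>K\<close>, the equation of the exceptional divisor generates the ideal of
  \<open>L\<close> and divides \<open>f\<close>, so the order of \<open>f\<close> along the arc is at least that of some member of \<open>L\<close>. The
  centre does leave \<open>K\<close>, since the order of the exceptional divisor along the arc increases with each
  blowup and is bounded by the order of a member of \<open>L\<close>.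

  All members of \<open>L\<close> pass virtually through \<open>\<K>\<close>, because the total transform of a general member is
  exactly the exceptional divisor plus the proper transform, and every member is a combination of two
  general ones (\<open>candidates_properties\<close>). For the chain of inclusions:

  \<^item> Saturation. If a part of degree less than \<open>d\<close> of an element of the saturation were nonzero, its
    multiples of degree \<open>d\<close> would lie in the net \<open>L\<close>; this is impossible because \<open>L\<close> has dimension at
    most \<open>3\<close> and no fixed part, and \<open>d \<ge> 2\<close>. An element without such parts maps the \<open>n\<close>-th power of
    the irrelevant ideal into \<open>I\<close> times this power for some \<open>n\<close>, so it is integral over \<open>I\<close> by the
    determinant trick (\<open>integral_if_stabilizes\<close>).

  \<^item> Integral closure. Valuations of integral elements are at least those of \<open>I\<close>, and the homogeneous
    parts of an integral element are combinations of its translates under the torus.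

  \<^item> Divisorial cover. The order of vanishing along an exceptional curve extends to the fraction field
    of \<open>k[x,y,z]\<close> and is divisorial: its center is the ideal of a proper point, of height \<open>2\<close>, and the
    residue field has transcendence degree \<open>1\<close> over that of the center (\<open>divisorial_W\<close>). Both upper
    bounds come from the fact that four rational functions in three variables are algebraically
    dependent.

  \<^item> Full ideal. On the exceptional curve of a proper base point only finitely many points are blown
    up again; at the other ones virtual passage means that the multiplicity at the point is attained.

  The equalities in degree \<open>d\<close> follow since all the ideals lie between \<open>I\<close> and the full ideal.
\<close>

section \<open>Substitution homomorphisms\<close>

definition is_hom :: "('a::comm_ring_1 \<Rightarrow> 'b::comm_ring_1) \<Rightarrow> bool" where
  "is_hom h \<longleftrightarrow> h 1 = 1 \<and> (\<forall>a b. h (a + b) = h a + h b) \<and> (\<forall>a b. h (a * b) = h a * h b)"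

lemma is_homI:
  assumes "h 1 = 1" "\<And>a b. h (a + b) = h a + h b" "\<And>a b. h (a * b) = h a * h b"
  shows "is_hom h"
  using assms by (auto simp: is_hom_def)

lemma
  assumes "is_hom h"
  shows hom_1: "h 1 = 1" and hom_add: "h (a + b) = h a + h b" and hom_mult: "h (a * b) = h a * h b"
    and hom_0: "h 0 = 0" and hom_diff: "h (a - b) = h a - h b" and hom_minus: "h (- a) = - h a"
proof -
  show "h 1 = 1" and add: "h (a + b) = h a + h b" and "h (a * b) = h a * h b" for a b
    using assms by (auto simp: is_hom_def)
  show zero: "h 0 = 0" using add[of 0 0] by simp
  show "h (- a) = - h a" for a using add[of a "- a"] zero by (simp add: eq_neg_iff_add_eq_0 add.commute)
  show "h (a - b) = h a - h b" using add[of "a - b" b] by simp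
qed

lemmas hom_simps = hom_1 hom_add hom_mult hom_0 hom_diff hom_minus

lemma hom_power: "is_hom h \<Longrightarrow> h (a ^ n) = h a ^ n"
  by (induction n) (auto simp: hom_simps)

lemma hom_sum: "is_hom h \<Longrightarrow> h (sum f A) = (\<Sum>x\<in>A. h (f x))"
  by (induction A rule: infinite_finite_induct) (auto simp: hom_simps)

lemma hom_prod: "is_hom h \<Longrightarrow> h (prod f A) = (\<Prod>x\<in>A. h (f x))"
  by (induction A rule: infinite_finite_induct) (auto simp: hom_simps)

lemma hom_dvd: "is_hom h \<Longrightarrow> a dvd b \<Longrightarrow> h a dvd h b"
  by (auto simp: hom_simps elim!: dvdE)

lemma is_hom_comp: "is_hom g \<Longrightarrow> is_hom h \<Longrightarrow> is_hom (\<lambda>x. g (h x))"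
  by (auto simp: is_hom_def)

lemma is_hom_id [simp]: "is_hom (\<lambda>x. x)" "is_hom id"
  by (auto simp: is_hom_def)

lemma is_hom_pCons [simp]: "is_hom (\<lambda>c. [:c:])"
  by (auto simp: is_hom_def one_pCons)

lemma is_hom_const2 [simp]: "is_hom const2" and is_hom_const3 [simp]: "is_hom const3"
  by (auto simp: is_hom_def one_pCons)

lemma is_hom_poly [simp]: "is_hom (\<lambda>p. poly p x)"
  by (auto simp: is_hom_def)

lemma is_hom_to_fract [simp]: "is_hom to_fract"
  by (auto simp: is_hom_def)

lemma is_hom_fps_const [simp]: "is_hom fps_const"
  by (auto simp: is_hom_def)

lemma is_hom_fps_nth_0 [simp]: "is_hom (\<lambda>f. fps_nth f 0)"
  by (auto simp: is_hom_def)

lemma is_hom_map_poly: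
  assumes "is_hom h"
  shows "is_hom (map_poly h)"
proof (rule is_homI)
  show "map_poly h 1 = 1" using assms by (simp add: hom_simps)
  show "map_poly h (a + b) = map_poly h a + map_poly h b" for a b
    using assms by (intro poly_eqI) (simp add: hom_simps coeff_map_poly)
  show "map_poly h (a * b) = map_poly h a * map_poly h b" for a b
    using assms by (intro poly_eqI) (simp add: hom_simps coeff_map_poly coeff_mult hom_sum)
qed

lemma is_hom_eval2 [simp]: "is_hom h \<Longrightarrow> is_hom (eval2 h a b)"
  unfolding eval2_def [abs_def]
  by (intro is_hom_comp[OF is_hom_poly] is_hom_map_poly)

lemma is_hom_eval3 [simp]: "is_hom h \<Longrightarrow> is_hom (eval3 h a b c)"
  unfolding eval3_def [abs_def]
  by (intro is_hom_comp[OF is_hom_poly] is_hom_map_poly is_hom_eval2)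

lemma eval2_simps [simp]:
  assumes "is_hom h"
  shows "eval2 h a b U = a" "eval2 h a b V = b" "eval2 h a b (const2 c) = h c"
  using assms by (auto simp: eval2_def U_def V_def map_poly_pCons hom_simps)

lemma eval3_simps [simp]:
  assumes "is_hom h"
  shows "eval3 h a b c X = a" "eval3 h a b c Y = b" "eval3 h a b c Z = c" "eval3 h a b c (const3 e) = h e"
  using assms by (auto simp: eval3_def eval2_def X_def Y_def Z_def map_poly_pCons hom_simps)

lemma hom_poly:
  assumes "is_hom h"
  shows "h p = poly (map_poly (\<lambda>c. h [:c:]) p) (h [:0, 1:])"
proof (induction p)
  case 0
  then show ?case using assms by (simp add: hom_simps)
next
  case (pCons a p)
  have "pCons a p = [:a:] + [:0, 1:] * p" by simp
  then have "h (pCons a p) = h [:a:] + h [:0, 1:] * h p"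
    using assms by (metis hom_add hom_mult)
  then show ?case using pCons.IH assms by (simp add: map_poly_pCons hom_simps)
qed

lemma hom_eq_eval2:
  assumes "is_hom h"
  shows "h f = eval2 (\<lambda>c. h (const2 c)) (h U) (h V) f"
proof -
  have "is_hom (\<lambda>c. h [:c:])" by (rule is_hom_comp[OF assms is_hom_pCons])
  then have "(\<lambda>c. h [:c:]) = (\<lambda>g. poly (map_poly (\<lambda>c. h (const2 c)) g) (h U))"
    unfolding U_def by (intro ext hom_poly)
  with hom_poly[OF assms, of f] show ?thesis
    by (simp add: eval2_def V_def U_def)
qed

lemma hom_eq_eval3:
  assumes "is_hom h"
  shows "h f = eval3 (\<lambda>c. h (const3 c)) (h X) (h Y) (h Z) f"
proof -
  have "is_hom (\<lambda>c. h [:c:])" by (rule is_hom_comp[OF assms is_hom_pCons])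
  then have "(\<lambda>c. h [:c:]) = eval2 (\<lambda>c. h (const3 c)) (h X) (h Y)"
    unfolding X_def Y_def U_def[symmetric] V_def[symmetric] by (intro ext hom_eq_eval2)
  with hom_poly[OF assms, of f] show ?thesis
    by (simp add: eval3_def Z_def)
qed

text \<open>
  Homomorphisms on polynomials are determined by the constants and the variables; all identities
  between substitutions are derived from this.
\<close>

lemma hom_ext2:
  assumes "is_hom g" "is_hom h" "\<And>c. g (const2 c) = h (const2 c)" "g U = h U" "g V = h V"
  shows "g f = h f"
  using assms hom_eq_eval2[OF assms(1), of f] hom_eq_eval2[OF assms(2), of f] by simp

lemma hom_ext3:
  assumes "is_hom g" "is_hom h" "\<And>c. g (const3 c) = h (const3 c)" "g X = h X" "g Y = h Y" "g Z = h Z"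
  shows "g f = h f"
  using assms hom_eq_eval3[OF assms(1), of f] hom_eq_eval3[OF assms(2), of f] by simp

lemma hom_eval3:
  assumes "is_hom g" "is_hom h"
  shows "g (eval3 h a b c f) = eval3 (\<lambda>x. g (h x)) (g a) (g b) (g c) f"
proof (rule hom_ext3[of "\<lambda>f. g (eval3 h a b c f)" "eval3 (\<lambda>c. g (h c)) (g a) (g b) (g c)"])
  note [simp] = is_hom_comp[OF assms] assms(2)
  show "is_hom (\<lambda>f. g (eval3 h a b c f))" by (rule is_hom_comp[OF assms(1)]) simp
qed (simp_all add: is_hom_comp[OF assms] assms(2))


section \<open>Monomials and the grading\<close>

abbreviation coeff3 :: "'k::field poly3 \<Rightarrow> nat \<Rightarrow> nat \<Rightarrow> nat \<Rightarrow> 'k" where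
  "coeff3 f i j l \<equiv> coeff (coeff (coeff f l) j) i"

abbreviation monom3 :: "'k::field \<Rightarrow> nat \<Rightarrow> nat \<Rightarrow> nat \<Rightarrow> 'k poly3" where
  "monom3 c i j l \<equiv> monom (monom (monom c i) j) l"

abbreviation coeff2 :: "'k::field poly2 \<Rightarrow> nat \<Rightarrow> nat \<Rightarrow> 'k" where
  "coeff2 g i j \<equiv> coeff (coeff g j) i"

abbreviation monom2 :: "'k::field \<Rightarrow> nat \<Rightarrow> nat \<Rightarrow> 'k poly2" where
  "monom2 c i j \<equiv> monom (monom c i) j"

lemma poly3_eqI: "(\<And>i j l. coeff3 f i j l = coeff3 g i j l) \<Longrightarrow> f = g"
  by (auto simp: poly_eq_iff)

lemma poly2_eqI: "(\<And>i j. coeff2 f i j = coeff2 g i j) \<Longrightarrow> f = g"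
  by (auto simp: poly_eq_iff)

lemma pCons_power: "[:0, 1:] ^ n = monom 1 n"
  by (induction n) (auto simp: monom_Suc one_pCons monom_0)

lemma const_power: "[:c:] ^ n = [:c ^ n:]"
  by (induction n) (auto simp: one_pCons mult.commute)

lemma monom2_eq: "monom2 c i j = const2 c * U ^ i * V ^ j"
  unfolding U_def V_def const_power pCons_power
  by (simp add: smult_monom)

lemma monom3_eq: "monom3 c i j l = const3 c * X ^ i * Y ^ j * Z ^ l"
  unfolding X_def Y_def Z_def const_power pCons_power
  by (simp add: smult_monom)

lemma monom_sum: "monom (sum f A) n = (\<Sum>x\<in>A. monom (f x) n)"
  by (induction A rule: infinite_finite_induct) (auto simp: add_monom[symmetric])

lemma poly2_expand: "f = (\<Sum>j\<le>degree f. \<Sum>i\<le>degree (coeff f j). monom2 (coeff2 f i j) i j)"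
  using poly_as_sum_of_monoms[of f]
  by (simp only: monom_sum[symmetric] poly_as_sum_of_monoms)

lemma poly3_expand: "f = (\<Sum>l\<le>degree f. \<Sum>j\<le>degree (coeff f l). \<Sum>i\<le>degree (coeff (coeff f l) j).
    monom3 (coeff3 f i j l) i j l)"
  using poly_as_sum_of_monoms[of f]
  by (simp only: monom_sum[symmetric] poly2_expand[symmetric] poly_as_sum_of_monoms)

lemma sum_closed:
  assumes "P 0" "\<And>f g. P f \<Longrightarrow> P g \<Longrightarrow> P (f + g)" "\<And>x. x \<in> A \<Longrightarrow> P (h x)"
  shows "P (sum h A)"
  using assms(3) by (induction A rule: infinite_finite_induct) (auto intro: assms(1,2))

lemma poly2_induct [case_names zero add monom]:
  assumes "P 0" "\<And>f g. P f \<Longrightarrow> P g \<Longrightarrow> P (f + g)" "\<And>c i j. P (monom2 c i j)"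
  shows "P f"
  by (subst poly2_expand) (intro sum_closed[where P = P] assms)

lemma poly3_induct [case_names zero add monom]:
  assumes "P 0" "\<And>f g. P f \<Longrightarrow> P g \<Longrightarrow> P (f + g)" "\<And>c i j l. P (monom3 c i j l)"
  shows "P f"
  by (subst poly3_expand) (intro sum_closed[where P = P] assms)

lemma eval3_monom:
  assumes "is_hom h"
  shows "eval3 h a b c (monom3 e i j l) = h e * a ^ i * b ^ j * c ^ l"
  using assms by (simp add: monom3_eq hom_mult[OF is_hom_eval3] hom_power[OF is_hom_eval3] del: mult_pCons_left)

lemma eval2_monom:
  assumes "is_hom h"
  shows "eval2 h a b (monom2 e i j) = h e * a ^ i * b ^ j"
  using assms by (simp add: monom2_eq hom_mult[OF is_hom_eval2] hom_power[OF is_hom_eval2] del: mult_pCons_left)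

text \<open>
  The whole grading is carried by one homomorphism: the coefficient of \<open>f(tX, tY, tZ)\<close> at \<open>t ^ m\<close> is the
  homogeneous part of degree \<open>m\<close>. Products of forms, degrees of products and homogeneous parts of
  products are read off from it.
\<close>

definition grading :: "'k::field poly3 \<Rightarrow> 'k poly3 poly" where
  "grading = eval3 (\<lambda>c. [:const3 c:]) (monom X 1) (monom Y 1) (monom Z 1)"

definition hpart :: "nat \<Rightarrow> 'k::field poly3 \<Rightarrow> 'k poly3" where
  "hpart m f = coeff (grading f) m"

lemma is_hom_const4 [simp]: "is_hom (\<lambda>c. [:const3 c:])"
  by (auto simp: is_hom_def one_pCons)

lemma is_hom_grading [simp]: "is_hom grading"
  unfolding grading_def by simp

lemma grading_monom: "grading (monom3 c i j l) = monom (monom3 c i j l) (i + j + l)"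
  unfolding grading_def
  by (subst eval3_monom[OF is_hom_const4], subst monom3_eq)
     (simp only: monom_power mult_monom monom_0[symmetric] mult_1_left add_0_left)

lemma coeff3_hpart: "coeff3 (hpart m f) i j l = (if i + j + l = m then coeff3 f i j l else 0)"
proof (induction f rule: poly3_induct)
  case (monom c i j l)
  then show ?case by (auto simp: hpart_def grading_monom)
qed (auto simp: hpart_def hom_simps[OF is_hom_grading])

lemma form_hpart [simp]: "form m (hpart m f)"
  by (simp add: form_def coeff3_hpart)

lemma hpart_form: "form m f \<Longrightarrow> hpart n f = (if n = m then f else 0)"
  by (rule poly3_eqI) (auto simp: form_def coeff3_hpart)

lemma hpart_add: "hpart m (f + g) = hpart m f + hpart m g"
  by (simp add: hpart_def hom_add[OF is_hom_grading])

lemma hpart_0 [simp]: "hpart m 0 = 0"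
  by (simp add: hpart_def hom_0[OF is_hom_grading])

lemma hpart_sum: "hpart m (sum f A) = (\<Sum>x\<in>A. hpart m (f x))"
  by (induction A rule: infinite_finite_induct) (auto simp: hpart_add)

lemma grading_form_iff: "form m f \<longleftrightarrow> grading f = monom f m"
proof
  assume "form m f"
  then show "grading f = monom f m"
    by (intro poly_eqI) (use hpart_form[of m f] in \<open>auto simp: hpart_def\<close>)
next
  assume "grading f = monom f m"
  then have "f = hpart m f" by (simp add: hpart_def)
  then show "form m f" using form_hpart[of m f] by simp
qed

lemma poly_grading_1: "poly (grading f) 1 = f"
proof (rule hom_ext3[of "\<lambda>f. poly (grading f) 1" "\<lambda>f. f"])
  show "is_hom (\<lambda>f. poly (grading f) (1::'a poly3))"
    by (rule is_hom_comp[OF is_hom_poly is_hom_grading])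
qed (simp_all add: grading_def poly_monom)

lemma sum_hpart: "f = (\<Sum>m\<le>degree (grading f). hpart m f)"
  using poly_grading_1[of f] by (simp add: poly_altdef hpart_def)

lemma grading_eq_0_iff [simp]: "grading f = 0 \<longleftrightarrow> f = 0"
  using poly_grading_1[of f] by (auto simp: hom_0[OF is_hom_grading])

lemma form_0 [simp]: "form m 0"
  by (simp add: form_def)

lemma form_add: "form m f \<Longrightarrow> form m g \<Longrightarrow> form m (f + g)"
  by (simp add: grading_form_iff hom_add[OF is_hom_grading] add_monom)

lemma form_diff: "form m f \<Longrightarrow> form m g \<Longrightarrow> form m (f - g)"
  by (simp add: grading_form_iff hom_diff[OF is_hom_grading] diff_monom)

lemma form_mult: "form m f \<Longrightarrow> form n g \<Longrightarrow> form (m + n) (f * g)"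
  by (simp add: grading_form_iff hom_mult[OF is_hom_grading] mult_monom)

lemma form_power: "form m f \<Longrightarrow> form (m * n) (f ^ n)"
  by (simp add: grading_form_iff hom_power[OF is_hom_grading] monom_power)

lemma form_const3 [simp]: "form 0 (const3 c)"
  by (auto simp: form_def coeff_pCons split: nat.splits)

lemma form_monom3: "form (i + j + l) (monom3 c i j l)"
  by (auto simp: form_def split: if_splits)

lemma form_X [simp]: "form (Suc 0) (X :: 'k::field poly3)"
  and form_Y [simp]: "form (Suc 0) (Y :: 'k poly3)"
  and form_Z [simp]: "form (Suc 0) (Z :: 'k poly3)"
  using form_monom3[of 1 0 0 "1::'k"] form_monom3[of 0 1 0 "1::'k"] form_monom3[of 0 0 1 "1::'k"]
  unfolding monom3_eq by (auto simp: one_pCons[symmetric])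

lemma form_cmult: "form m f \<Longrightarrow> form m (const3 c * f)"
  using form_mult[of 0 "const3 c" m f] by simp

lemma form_induct [consumes 1, case_names zero add monom]:
  assumes "form m f" "P 0" "\<And>f g. P f \<Longrightarrow> P g \<Longrightarrow> P (f + g)"
    "\<And>c i j l. i + j + l = m \<Longrightarrow> P (monom3 c i j l)"
  shows "P f"
proof (subst poly3_expand, intro sum_closed[where P = P] assms(2,3))
  fix l j i
  show "P (monom3 (coeff3 f i j l) i j l)"
    using assms(1) assms(2) assms(4)[of i j l] by (cases "coeff3 f i j l = 0") (auto simp: form_def)
qed

lemma eval3_grading:
  assumes "is_hom h"
  shows "eval3 h (s * a) (s * b) (s * c) f = poly (map_poly (eval3 h a b c) (grading f)) s"
proof (rule hom_ext3[of "eval3 h (s * a) (s * b) (s * c)"])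
  show "is_hom (\<lambda>f. poly (map_poly (eval3 h a b c) (grading f)) s)"
    using assms by (intro is_hom_comp[OF is_hom_poly] is_hom_comp[OF is_hom_map_poly] is_hom_eval3 is_hom_grading)
qed (use assms in \<open>auto simp: grading_def map_poly_monom poly_monom map_poly_pCons hom_0\<close>)

lemma eval3_form_scale:
  assumes "is_hom h" "form m f"
  shows "eval3 h (s * a) (s * b) (s * c) f = s ^ m * eval3 h a b c f"
  using assms by (simp add: eval3_grading grading_form_iff map_poly_monom poly_monom hom_0)

lemma form_eval3:
  assumes "form m f" "form e a" "form e b" "form e c"
  shows "form (m * e) (eval3 const3 a b c f)"
  using assms(1)
proof (induction f rule: form_induct)
  case (monom x i j l)
  have "form (0 + e * i + e * j + e * l) (const3 x * a ^ i * b ^ j * c ^ l)"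
    by (intro form_mult form_power assms form_const3)
  moreover have "0 + e * i + e * j + e * l = m * e"
    using monom by (auto simp: algebra_simps)
  ultimately show ?case by (simp add: eval3_monom del: mult_pCons_left)
qed (auto simp: hom_simps[OF is_hom_eval3] form_add)

section \<open>Ideals\<close>

lemma module_mult: "module ((*) :: 'a::comm_ring_1 \<Rightarrow> 'a \<Rightarrow> 'a)"
  by unfold_locales (auto simp: algebra_simps)

lemma is_ideal_iff:
  "is_ideal J \<longleftrightarrow> 0 \<in> J \<and> (\<forall>a\<in>J. \<forall>b\<in>J. a + b \<in> J) \<and> (\<forall>c. \<forall>a\<in>J. c * a \<in> J)"
  by (simp add: is_ideal_def module.subspace_def[OF module_mult])

lemma
  assumes "is_ideal J"
  shows ideal_0: "0 \<in> J" and ideal_add: "a \<in> J \<Longrightarrow> b \<in> J \<Longrightarrow> a + b \<in> J"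
    and ideal_mult: "a \<in> J \<Longrightarrow> c * a \<in> J"
  using assms by (auto simp: is_ideal_iff)

lemma ideal_mult_right: "is_ideal J \<Longrightarrow> a \<in> J \<Longrightarrow> a * c \<in> J"
  using ideal_mult[of J a c] by (simp add: mult.commute)

lemma ideal_minus: "is_ideal J \<Longrightarrow> a \<in> J \<Longrightarrow> - a \<in> J"
  using ideal_mult[of J a "- 1"] by simp

lemma ideal_diff: "is_ideal J \<Longrightarrow> a \<in> J \<Longrightarrow> b \<in> J \<Longrightarrow> a - b \<in> J"
  using ideal_add[of J a "- b"] ideal_minus[of J b] by simp

lemma ideal_sum: "is_ideal J \<Longrightarrow> (\<And>x. x \<in> A \<Longrightarrow> f x \<in> J) \<Longrightarrow> sum f A \<in> J"
  by (rule sum_closed[where P = "\<lambda>x. x \<in> J"]) (auto simp: ideal_0 ideal_add)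

lemma is_ideal_gen [simp]: "is_ideal (ideal_gen S)"
  by (simp add: is_ideal_def ideal_gen_def module.subspace_span[OF module_mult])

lemma ideal_gen_base: "a \<in> S \<Longrightarrow> a \<in> ideal_gen S"
  by (simp add: ideal_gen_def module.span_base[OF module_mult])

lemma ideal_gen_minimal: "S \<subseteq> J \<Longrightarrow> is_ideal J \<Longrightarrow> ideal_gen S \<subseteq> J"
  by (simp add: ideal_gen_def is_ideal_def module.span_minimal[OF module_mult])

lemma is_ideal_UNIV [simp]: "is_ideal UNIV"
  by (simp add: is_ideal_iff)

lemma is_ideal_vimage:
  assumes "is_hom h" "is_ideal J"
  shows "is_ideal {a. h a \<in> J}"
  using assms by (auto simp: is_ideal_iff hom_simps)

lemma is_ideal_colon: "is_ideal J \<Longrightarrow> is_ideal {a. a * c \<in> J}"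
  unfolding is_ideal_iff by (auto simp: distrib_right mult.assoc)

lemma is_ideal_dvd: "is_ideal {a. t dvd a}"
  by (auto simp: is_ideal_iff)

lemma is_ideal_pow [simp]: "is_ideal (ideal_pow J n)"
  by (simp add: ideal_pow_def)

lemma ideal_pow_0 [simp]: "ideal_pow J 0 = UNIV"
proof -
  have "1 \<in> ideal_pow J 0"
    unfolding ideal_pow_def by (rule ideal_gen_base) auto
  then show ?thesis using ideal_mult[OF is_ideal_pow, of 1 J 0] by auto
qed

lemma prod_list_in_ideal_pow: "set gs \<subseteq> J \<Longrightarrow> prod_list gs \<in> ideal_pow J (length gs)"
  unfolding ideal_pow_def by (rule ideal_gen_base) auto

lemma power_in_ideal_pow: "a \<in> J \<Longrightarrow> a ^ n \<in> ideal_pow J n"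
  using prod_list_in_ideal_pow[of "replicate n a" J] by (simp add: set_replicate_conv_if)

lemma ideal_pow_1I: "a \<in> J \<Longrightarrow> a \<in> ideal_pow J 1"
  using power_in_ideal_pow[of a J 1] by simp

lemma ideal_pow_minimal:
  assumes "is_ideal Q" "\<And>gs. set gs \<subseteq> J \<Longrightarrow> length gs = n \<Longrightarrow> prod_list gs \<in> Q"
  shows "ideal_pow J n \<subseteq> Q"
  unfolding ideal_pow_def by (rule ideal_gen_minimal) (use assms in auto)

lemma ideal_pow_mult:
  assumes "a \<in> ideal_pow J m" "b \<in> ideal_pow J n"
  shows "a * b \<in> ideal_pow J (m + n)"
proof -
  have gen: "b * prod_list gs \<in> ideal_pow J (m + n)"
    if "set gs \<subseteq> J" "length gs = m" "b \<in> ideal_pow J n" for gs b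
  proof -
    have "ideal_pow J n \<subseteq> {b. b * prod_list gs \<in> ideal_pow J (m + n)}"
    proof (rule ideal_pow_minimal)
      show "is_ideal {b. b * prod_list gs \<in> ideal_pow J (m + n)}"
        by (simp add: is_ideal_colon)
      show "prod_list hs \<in> {b. b * prod_list gs \<in> ideal_pow J (m + n)}"
        if "set hs \<subseteq> J" "length hs = n" for hs
        using prod_list_in_ideal_pow[of "hs @ gs" J] that \<open>set gs \<subseteq> J\<close> \<open>length gs = m\<close>
        by (simp add: add.commute)
    qed
    then show ?thesis using that by auto
  qed
  have "ideal_pow J m \<subseteq> {a. a * b \<in> ideal_pow J (m + n)}"
  proof (rule ideal_pow_minimal)
    show "is_ideal {a. a * b \<in> ideal_pow J (m + n)}"
      by (simp add: is_ideal_colon)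
  qed (use gen[OF _ _ assms(2)] in \<open>auto simp: mult.commute\<close>)
  then show ?thesis using assms by auto
qed

lemma ideal_pow_mono: "m \<le> n \<Longrightarrow> ideal_pow J n \<subseteq> ideal_pow J m"
proof (rule ideal_pow_minimal)
  fix gs assume "m \<le> n" "set gs \<subseteq> J" "length gs = n"
  then have "prod_list (take m gs) \<in> ideal_pow J m"
    using prod_list_in_ideal_pow[of "take m gs" J] set_take_subset[of m gs] by auto
  then show "prod_list gs \<in> ideal_pow J m"
    using ideal_mult_right[OF is_ideal_pow, of "prod_list (take m gs)" J m "prod_list (drop m gs)"]
    by (simp add: prod_list.append[symmetric] del: prod_list.append)
qed simp

lemma ideal_gen_three: "ideal_gen {f0, f1, f2} = {a * f0 + b * f1 + c * f2 | a b c. True}" (is "_ = ?R")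
proof
  show "ideal_gen {f0, f1, f2} \<subseteq> ?R"
  proof (rule ideal_gen_minimal)
    have "f0 = 1 * f0 + 0 * f1 + 0 * f2" "f1 = 0 * f0 + 1 * f1 + 0 * f2" "f2 = 0 * f0 + 0 * f1 + 1 * f2"
      by simp_all
    then show "{f0, f1, f2} \<subseteq> ?R" by blast
    show "is_ideal ?R" unfolding is_ideal_iff
    proof (intro conjI ballI allI)
      have "0 = 0 * f0 + 0 * f1 + 0 * f2" by simp
      then show "0 \<in> ?R" by blast
    next
      fix x y assume "x \<in> ?R" "y \<in> ?R"
      then obtain a b c a' b' c' where "x = a * f0 + b * f1 + c * f2" "y = a' * f0 + b' * f1 + c' * f2" by blast
      then have "x + y = (a + a') * f0 + (b + b') * f1 + (c + c') * f2" by (simp add: algebra_simps)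
      then show "x + y \<in> ?R" by blast
    next
      fix e x assume "x \<in> ?R"
      then obtain a b c where "x = a * f0 + b * f1 + c * f2" by blast
      then have "e * x = (e * a) * f0 + (e * b) * f1 + (e * c) * f2" by (simp add: algebra_simps)
      then show "e * x \<in> ?R" by blast
    qed
  qed
  show "?R \<subseteq> ideal_gen {f0, f1, f2}"
  proof clarify
    fix a b c
    have "f0 \<in> ideal_gen {f0, f1, f2}" "f1 \<in> ideal_gen {f0, f1, f2}" "f2 \<in> ideal_gen {f0, f1, f2}"
      by (auto intro: ideal_gen_base)
    then show "a * f0 + b * f1 + c * f2 \<in> ideal_gen {f0, f1, f2}"
      by (intro ideal_add[OF is_ideal_gen] ideal_mult[OF is_ideal_gen])
  qed
qed

lemma hpart_mult_form: "form e g \<Longrightarrow> hpart m (a * g) = (if m < e then 0 else hpart (m - e) a * g)"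
  by (simp add: hpart_def hom_mult[OF is_hom_grading] grading_form_iff mult.commute[of "grading a"]
      coeff_monom_mult mult.commute[of g])

lemma form_0_const:
  assumes "form 0 f"
  obtains c where "f = const3 c"
proof
  show "f = const3 (coeff3 f 0 0 0)"
    using assms by (intro poly3_eqI) (force simp: form_def coeff_pCons split: nat.splits)
qed

lemma homogeneous_part_of_ideal:
  assumes "form d f0" "form d f1" "form d f2" "form m f" "f \<in> ideal_gen {f0, f1, f2}" "f \<noteq> 0"
  shows "d \<le> m \<and> (\<exists>a b c. form (m - d) a \<and> form (m - d) b \<and> form (m - d) c \<and> f = a * f0 + b * f1 + c * f2)"
proof -
  obtain a b c where f: "f = a * f0 + b * f1 + c * f2"
    using assms(5) by (auto simp: ideal_gen_three)
  have "f = hpart m f" using assms(4) by (simp add: hpart_form)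
  also have "\<dots> = (if m < d then 0 else hpart (m - d) a * f0 + hpart (m - d) b * f1 + hpart (m - d) c * f2)"
    using assms(1-3) by (simp add: f hpart_add hpart_mult_form)
  finally show ?thesis using \<open>f \<noteq> 0\<close> form_hpart by (metis not_less)
qed

section \<open>Linear algebra over the ground field\<close>

text \<open>
  Induction on the number of equations: solve one equation for an unknown with nonzero coefficient
  and substitute.
\<close>

lemma homogeneous_system_solvable:
  fixes M :: "'e \<Rightarrow> 'j \<Rightarrow> 'k::field"
  assumes "finite J" "finite E" "card J < card E"
  shows "\<exists>c. (\<exists>e\<in>E. c e \<noteq> 0) \<and> (\<forall>j\<in>J. (\<Sum>e\<in>E. c e * M e j) = 0)"
  using assms
proof (induction J arbitrary: E M rule: finite_induct)
  case empty
  then have "E \<noteq> {}" by auto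
  then show ?case by (intro exI[of _ "\<lambda>_. 1"]) auto
next
  case (insert j J)
  show ?case
  proof (cases "\<forall>e\<in>E. M e j = 0")
    case True
    obtain c where "\<exists>e\<in>E. c e \<noteq> 0" "\<forall>j\<in>J. (\<Sum>e\<in>E. c e * M e j) = 0"
      using insert.IH[of E M] insert.prems insert.hyps by auto
    with True show ?thesis by (intro exI[of _ c]) auto
  next
    case False
    then obtain e0 where e0: "e0 \<in> E" "M e0 j \<noteq> 0" by auto
    \<comment> \<open>the system after elimination of the unknown \<open>e0\<close> by means of the equation \<open>j\<close>\<close>
    define M' where "M' e j' = M e j' - M e j / M e0 j * M e0 j'" for e j'
    have "card J < card (E - {e0})"
      using insert.prems insert.hyps e0 by simp
    then obtain c where c: "\<exists>e\<in>E - {e0}. c e \<noteq> 0"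
        "\<And>j. j \<in> J \<Longrightarrow> (\<Sum>e\<in>E - {e0}. c e * M' e j) = 0"
      using insert.IH[of "E - {e0}" M'] insert.prems(1) by auto
    define s where "s = (\<Sum>e\<in>E - {e0}. c e * M e j)"
    define c' where "c' = c(e0 := - s / M e0 j)"
    have sum: "(\<Sum>e\<in>E. c' e * M e j') = (\<Sum>e\<in>E - {e0}. c e * M' e j')" for j'
    proof -
      have "(\<Sum>e\<in>E. c' e * M e j') = c' e0 * M e0 j' + (\<Sum>e\<in>E - {e0}. c' e * M e j')"
        using e0 insert.prems(1) by (simp add: sum.remove)
      also have "(\<Sum>e\<in>E - {e0}. c' e * M e j') = (\<Sum>e\<in>E - {e0}. c e * M e j')"
        by (intro sum.cong) (auto simp: c'_def)
      also have "c' e0 * M e0 j' = - (\<Sum>e\<in>E - {e0}. c e * (M e j / M e0 j * M e0 j'))"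
        by (simp add: c'_def s_def sum_distrib_right sum_divide_distrib sum_negf mult.assoc)
      finally show ?thesis
        by (simp add: M'_def right_diff_distrib sum_subtractf)
    qed
    have "M' e j = 0" for e using e0 by (simp add: M'_def)
    then have "\<forall>j'\<in>insert j J. (\<Sum>e\<in>E. c' e * M e j') = 0"
      using c(2) by (auto simp: sum)
    moreover have "\<exists>e\<in>E. c' e \<noteq> 0" using c(1) by (auto simp: c'_def)
    ultimately show ?thesis by blast
  qed
qed

lemma infinite_alg_closed: "infinite (UNIV :: 'k::alg_closed_field set)"
proof
  assume fin: "finite (UNIV :: 'k set)"
  define p :: "'k poly" where "p = (\<Prod>a\<in>UNIV. [:- a, 1:])"
  have "degree p = card (UNIV :: 'k set)"
    unfolding p_def by (subst degree_prod_eq_sum_degree) auto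
  then have "degree p > 0" using fin by (simp add: card_gt_0_iff)
  moreover have "degree (p + 1) = degree p"
    using \<open>degree p > 0\<close> by (intro degree_add_eq_left) auto
  ultimately obtain x where "poly (p + 1) x = 0"
    using alg_closed_imp_poly_has_root[of "p + 1"] by auto
  moreover have "poly p x = 0"
    using fin by (auto simp: p_def poly_prod)
  ultimately show False by simp
qed

lemma exists_avoiding_finite:
  assumes "finite (B :: 'k::alg_closed_field set)"
  obtains c where "c \<notin> B"
  using assms infinite_alg_closed ex_new_if_finite by blast

section \<open>Local equations, charts and orders of vanishing\<close>

lemma is_hom_local_eq [simp]: "is_hom (local_eq p)"
proof (cases p)
  case (fields a b c)
  then have "local_eq p = (if a \<noteq> 0 then eval3 const2 1 (const2 b + U) (const2 c + V)
      else if b \<noteq> 0 then eval3 const2 U 1 (const2 c + V) else eval3 const2 U V 1)"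
    by (auto simp: fun_eq_iff)
  then show ?thesis by simp
qed

lemma is_hom_chart [simp]: "is_hom (chart a)"
proof (cases a)
  case (Slope s)
  then have "chart a = eval2 const2 U (U * (V + const2 s))" by (auto simp: fun_eq_iff)
  then show ?thesis by simp
next
  case Vertical
  then have "chart a = eval2 const2 (U * V) V" by (auto simp: fun_eq_iff)
  then show ?thesis by simp
qed

lemma is_hom_pullback [simp]: "is_hom (pullback ds)"
proof (induction ds)
  case Nil
  then show ?case by (simp add: is_hom_def)
next
  case (Cons a ds)
  have "pullback (a # ds) = (\<lambda>g. chart a (pullback ds g))" by (simp add: fun_eq_iff)
  then show ?case using is_hom_comp[OF is_hom_chart Cons] by simp
qed

lemma is_hom_total_transform: "is_hom (\<lambda>f. total_transform f q)"
proof (cases q)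
  case (Pair p ds)
  then show ?thesis using is_hom_comp[OF is_hom_pullback is_hom_local_eq] by simp
qed

lemmas total_simps = hom_simps[OF is_hom_total_transform]

lemma total_transform_Cons: "total_transform f (p, a # ds) = chart a (total_transform f (p, ds))"
  by simp

lemma chart_simps [simp]:
  "chart (Slope s) U = U" "chart (Slope s) V = U * (V + const2 s)"
  "chart Vertical U = U * V" "chart Vertical V = V"
  by simp_all

declare chart.simps [simp del]

lemma chart_const2 [simp]: "chart a (const2 c) = const2 c"
  by (cases a) (simp_all add: chart.simps)

lemma pullback_const2 [simp]: "pullback ds (const2 c) = const2 c"
  by (induction ds) auto

lemma local_eq_const3 [simp]: "local_eq p (const3 c) = const2 c"
  by (cases p) simp

lemma total_transform_const3 [simp]: "total_transform (const3 c) q = const2 c"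
  by (cases q) simp

lemma U_nonzero [simp]: "U \<noteq> 0" and V_nonzero [simp]: "V \<noteq> 0"
  by (auto simp: U_def V_def)

lemma exc_eq_nonzero [simp]: "exc_eq a \<noteq> 0"
  by (cases a) auto

text \<open>
  Blowing up is birational: the inverse substitution exists in the field of rational functions.
\<close>

lemma chart_eq_0_iff [simp]: "chart a g = 0 \<longleftrightarrow> g = 0"
proof
  define h :: "'a poly2 \<Rightarrow> 'a poly2 fract" where
    "h = (case a of Slope s \<Rightarrow> eval2 (\<lambda>c. to_fract (const2 c)) (to_fract U) (to_fract V / to_fract U - to_fract (const2 s))
          | Vertical \<Rightarrow> eval2 (\<lambda>c. to_fract (const2 c)) (to_fract U / to_fract V) (to_fract V))"
  have c: "is_hom (\<lambda>c :: 'a. to_fract (const2 c))" by (rule is_hom_comp[OF is_hom_to_fract is_hom_const2])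
  then have h: "is_hom h" by (auto simp: h_def split: direction.split)
  have "h (chart a g) = to_fract g" for g
  proof (rule hom_ext2[of "\<lambda>g. h (chart a g)" to_fract])
    show "is_hom (\<lambda>g. h (chart a g))" by (rule is_hom_comp[OF h is_hom_chart])
    have const: "h (const2 e) = to_fract (const2 e)" for e
      using c by (simp add: h_def split: direction.split)
    show "h (chart a (const2 e)) = to_fract (const2 e)" for e using const by simp
    show "h (chart a U) = to_fract U"
      by (cases a) (use c in \<open>simp_all add: hom_mult[OF h], simp_all add: h_def\<close>)
    show "h (chart a V) = to_fract V"
      by (cases a) (use c const in \<open>simp_all add: hom_mult[OF h] hom_add[OF h], simp_all add: h_def\<close>)
  qed simp
  moreover assume "chart a g = 0"
  ultimately show "g = 0" using hom_0[OF h] by (metis to_fract_eq_0_iff)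
next
  assume "g = 0"
  then show "chart a g = 0" by (simp add: hom_0[OF is_hom_chart])
qed

lemma pullback_eq_0_iff [simp]: "pullback ds g = 0 \<longleftrightarrow> g = 0"
  by (induction ds) auto

text \<open>
  Linear coordinates in which the point is \<open>(1, 0, 0)\<close>. They replace the three cases in the choice of
  the affine chart at \<open>p\<close>: the local equation of a form is always the dehomogenization of the
  transformed form, and the linear forms \<open>l1, l2\<close> have the local coordinates as local equations.
\<close>

lemma adapted_coordinates:
  fixes p :: "'k::field pt"
  assumes "p \<in> P2"
  obtains A B C l0 l1 l2 :: "'k poly3" where
    "form 1 l0" "form 1 l1" "form 1 l2"
    "\<And>m f. form m f \<Longrightarrow> form m (eval3 const3 A B C f)"
    "\<And>f. eval3 const3 l0 l1 l2 (eval3 const3 A B C f) = f"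
    "eval3 const3 A B C l0 = X" "eval3 const3 A B C l1 = Y" "eval3 const3 A B C l2 = Z"
    "\<And>f. local_eq p f = eval3 const2 1 U V (eval3 const3 A B C f)"
proof -
  note adapted = that
  have *: thesis if l: "form (Suc 0) l0" "form (Suc 0) l1" "form (Suc 0) l2"
    and A: "form (Suc 0) A" "form (Suc 0) B" "form (Suc 0) C"
    and lA: "eval3 const3 l0 l1 l2 A = X" "eval3 const3 l0 l1 l2 B = Y" "eval3 const3 l0 l1 l2 C = Z"
    and Al: "eval3 const3 A B C l0 = X" "eval3 const3 A B C l1 = Y" "eval3 const3 A B C l2 = Z"
    and U: "eval3 const2 1 U V A = local_eq p X" "eval3 const2 1 U V B = local_eq p Y"
      "eval3 const2 1 U V C = local_eq p Z" for A B C l0 l1 l2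
  proof (rule adapted[OF _ _ _ _ _ Al])
    show "form 1 l0" "form 1 l1" "form 1 l2" using l by simp_all
    show "form m (eval3 const3 A B C f)" if "form m f" for m f
      using form_eval3[OF that A] by simp
    show "eval3 const3 l0 l1 l2 (eval3 const3 A B C f) = f" for f
      by (rule hom_ext3[of "\<lambda>f. eval3 const3 l0 l1 l2 (eval3 const3 A B C f)" "\<lambda>f. f"])
         (simp_all add: lA is_hom_comp[OF is_hom_eval3 is_hom_eval3])
    show "local_eq p f = eval3 const2 1 U V (eval3 const3 A B C f)" for f
      by (rule hom_ext3[of "local_eq p" "\<lambda>f. eval3 const2 1 U V (eval3 const3 A B C f)"])
         (simp_all add: U is_hom_comp[OF is_hom_eval3 is_hom_eval3] del: local_eq.simps)
  qed
  consider b c where "p = (1, b, c)" | c where "p = (0, 1, c)" | "p = (0, 0, 1)"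
    using assms by (auto simp: P2_def)
  then show thesis
  proof cases
    case (1 b c)
    show thesis
      by (rule *[of X "Y - const3 b * X" "Z - const3 c * X" X "const3 b * X + Y" "const3 c * X + Z"])
         (simp_all add: 1 form_add form_diff form_cmult hom_simps[OF is_hom_eval3] del: mult_pCons_left)
  next
    case (2 c)
    show thesis
      by (rule *[of Y X "Z - const3 c * Y" Y X "const3 c * X + Z"])
         (simp_all add: 2 form_add form_diff form_cmult hom_simps[OF is_hom_eval3] del: mult_pCons_left)
  next
    case 3
    show thesis by (rule *[of Z X Y Y Z X]) (simp_all add: 3)
  qed
qed

lemma coeff2_dehomogenize:
  assumes "form m f"
  shows "coeff2 (eval3 const2 1 U V f) j l = (if j + l \<le> m then coeff3 f (m - j - l) j l else 0)"
  using assms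
proof (induction f rule: form_induct)
  case (monom c i j' l')
  have "eval3 const2 1 U V (monom3 c i j' l') = monom2 c j' l'"
    by (subst eval3_monom, simp) (simp only: monom2_eq power_one mult_1_right)
  then show ?case using monom by auto
qed (auto simp: hom_simps[OF is_hom_eval3])

lemma local_eq_eq_0:
  assumes f: "form m f" "local_eq p f = 0" and p: "p \<in> P2"
  shows "f = 0"
proof -
  obtain A B C l0 l1 l2 where \<sigma>: "\<And>m f. form m f \<Longrightarrow> form m (eval3 const3 A B C f)"
    "\<And>f. eval3 const3 l0 l1 l2 (eval3 const3 A B C f) = f"
    "\<And>f. local_eq p f = eval3 const2 1 U V (eval3 const3 A B C f)"
    using adapted_coordinates[OF p] by metis
  let ?g = "eval3 const3 A B C f"
  have "coeff3 ?g i j l = 0" for i j l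
  proof (rule ccontr)
    assume nz: "coeff3 ?g i j l \<noteq> 0"
    then have "i + j + l = m" using \<sigma>(1)[OF f(1)] by (auto simp: form_def)
    then have "coeff2 (local_eq p f) j l \<noteq> 0"
      unfolding \<sigma>(3) using coeff2_dehomogenize[OF \<sigma>(1)[OF f(1)], of l j] nz by auto
    then show False using f(2) by simp
  qed
  then have "?g = 0" by (intro poly3_eqI) simp
  then show ?thesis using \<sigma>(2)[of f] hom_0[OF is_hom_eval3[OF is_hom_const3]] by metis
qed

declare local_eq.simps [simp del]

lemma total_transform_eq_0_iff: "form m f \<Longrightarrow> p \<in> P2 \<Longrightarrow> total_transform f (p, ds) = 0 \<longleftrightarrow> f = 0"
  using local_eq_eq_0[of m f p] hom_0[OF is_hom_local_eq, of p] by (metis pullback_eq_0_iff total_transform.simps)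

lemma eval2_origin: "eval2 id 0 0 g = coeff2 g 0 0"
proof (rule hom_ext2[of "eval2 id 0 0" "\<lambda>g. coeff2 g 0 0"])
  show "is_hom (\<lambda>g :: 'a poly2. coeff2 g 0 0)"
    by (auto simp: is_hom_def coeff_mult_0)
qed (simp_all, simp_all add: U_def V_def)

lemma is_hom_origin: "is_hom (eval2 id 0 (0 :: 'k::field))"
  by simp

lemma is_hom_value_at: "is_hom (value_at p)"
proof (cases p)
  case (fields a b c)
  then have "value_at p = eval3 id a b c" by (simp add: fun_eq_iff)
  then show ?thesis by simp
qed

lemma value_at_local_eq:
  assumes "p \<in> P2"
  shows "value_at p f = eval2 id 0 0 (local_eq p f)"
proof -
  have "eval2 id 0 0 (local_eq p f) = eval3 id (eval2 id 0 0 (local_eq p X)) (eval2 id 0 0 (local_eq p Y))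
      (eval2 id 0 0 (local_eq p Z)) f"
    using hom_eq_eval3[OF is_hom_comp[OF is_hom_origin is_hom_local_eq[of p]], of f] by (simp add: id_def)
  with assms show ?thesis
    by (auto simp: P2_def hom_simps[OF is_hom_origin] local_eq.simps)
qed

definition vanishes_to :: "nat \<Rightarrow> 'k::field poly2 \<Rightarrow> bool" where
  "vanishes_to n g \<longleftrightarrow> (\<forall>i j. coeff2 g i j \<noteq> 0 \<longrightarrow> n \<le> i + j)"

lemma order0_le: "coeff2 g i j \<noteq> 0 \<Longrightarrow> order0 g \<le> i + j"
  unfolding order0_def by (rule Least_le) auto

lemma order0_attained:
  assumes "g \<noteq> 0"
  obtains i j where "i + j = order0 g" "coeff2 g i j \<noteq> 0"
proof -
  obtain i j where "coeff2 g i j \<noteq> 0" using assms by (metis coeff_0 poly2_eqI)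
  then have "\<exists>n i j. i + j = n \<and> coeff2 g i j \<noteq> 0" by auto
  then have "\<exists>i j. i + j = order0 g \<and> coeff2 g i j \<noteq> 0"
    unfolding order0_def by (rule LeastI_ex)
  then show ?thesis using that by blast
qed

lemma vanishes_to_order0: "vanishes_to (order0 g) g"
  by (auto simp: vanishes_to_def order0_le)

lemma vanishes_to_iff: "g \<noteq> 0 \<Longrightarrow> vanishes_to n g \<longleftrightarrow> n \<le> order0 g"
  by (metis order0_attained order0_le order_trans vanishes_to_def)

lemma order0_eqI: "vanishes_to n g \<Longrightarrow> coeff2 g i j \<noteq> 0 \<Longrightarrow> i + j = n \<Longrightarrow> order0 g = n"
  by (metis coeff_0 order0_le order_antisym vanishes_to_iff)

text \<open>
  Both coordinate functions become divisible by the equation of the exceptional curve.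
\<close>

lemma exc_eq_power_dvd_chart:
  assumes "vanishes_to n g"
  shows "exc_eq a ^ n dvd chart a g"
proof -
  have "exc_eq a ^ n dvd chart a (monom2 (coeff2 g i j) i j)" for i j
  proof (cases "coeff2 g i j = 0")
    case True
    then show ?thesis by (simp add: hom_0[OF is_hom_chart])
  next
    case False
    then have "exc_eq a ^ n dvd exc_eq a ^ (i + j)"
      using assms by (intro le_imp_power_dvd) (auto simp: vanishes_to_def)
    also have "exc_eq a ^ (i + j) = exc_eq a ^ i * exc_eq a ^ j" by (simp add: power_add)
    also have "\<dots> dvd chart a U ^ i * chart a V ^ j"
      by (intro mult_dvd_mono dvd_power_same) (cases a; simp)+
    also have "\<dots> dvd chart a (monom2 (coeff2 g i j) i j)"
      by (simp add: monom2_eq hom_simps[OF is_hom_chart] hom_power[OF is_hom_chart] del: mult_pCons_left)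
    finally show ?thesis .
  qed
  then have "exc_eq a ^ n dvd (\<Sum>j\<le>degree g. \<Sum>i\<le>degree (coeff g j). chart a (monom2 (coeff2 g i j) i j))"
    by (intro dvd_sum) auto
  also have "\<dots> = chart a g"
    by (subst (5) poly2_expand) (simp only: hom_sum[OF is_hom_chart])
  finally show ?thesis .
qed

text \<open>
  The division in the definition of the proper transform is exact.
\<close>

lemma proper_transform_mult:
  "proper_transform f (p, a # ds) * exc_eq a ^ mult f (p, ds) = chart a (proper_transform f (p, ds))"
  unfolding mult_def proper_transform.simps
  by (rule dvd_div_mult_self[OF exc_eq_power_dvd_chart[OF vanishes_to_order0]])

declare proper_transform.simps(2) [simp del]

lemma proper_transform_nonzero:
  assumes "form m f" "f \<noteq> 0" "p \<in> P2"
  shows "proper_transform f (p, ds) \<noteq> 0"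
proof (induction ds)
  case Nil
  then show ?case using local_eq_eq_0[of m f p] assms by auto
next
  case (Cons a ds)
  then show ?case using proper_transform_mult[of f p a ds] by (metis chart_eq_0_iff mult_zero_left)
qed

lemma exc_divisor_eq_Cons:
  "exc_divisor_eq \<mu> (p, a # ds) = exc_eq a ^ \<mu> (p, ds) * chart a (exc_divisor_eq \<mu> (p, ds))"
  by (simp add: prod.lessThan_Suc_shift hom_prod[OF is_hom_chart] hom_power[OF is_hom_chart] del: prod.lessThan_Suc)

lemma exc_divisor_eq_Nil: "exc_divisor_eq \<mu> (p, []) = 1"
  by simp

declare exc_divisor_eq.simps [simp del]

lemma exc_divisor_eq_nonzero: "exc_divisor_eq \<mu> (p, ds) \<noteq> 0"
  by (induction ds) (auto simp: exc_divisor_eq_Nil exc_divisor_eq_Cons)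


section \<open>Members of a linear system pass virtually through its base points\<close>

locale linear_system =
  fixes L :: "'k::alg_closed_field poly3 set" and d :: nat
  assumes form_L: "f \<in> L \<Longrightarrow> form d f"
    and add_L: "f \<in> L \<Longrightarrow> g \<in> L \<Longrightarrow> f + g \<in> L"
    and cmult_L: "f \<in> L \<Longrightarrow> const3 c * f \<in> L"
    and nonzero_L: "\<exists>f\<in>L. f \<noteq> 0"
begin

text \<open>
  The forms that compete for the minimal multiplicity at a point. With this set the two cases in the
  definitions of \<open>min_mult_forms\<close> and \<open>base_mult\<close> become one.
\<close>

fun candidates :: "'k npt \<Rightarrow> 'k poly3 set" where
  "candidates (p, []) = L - {0}"
| "candidates (p, a # ds) = min_mult_forms L (p, ds)"

lemma min_mult_forms_eq:
  "min_mult_forms L q = {f \<in> candidates q. \<forall>g\<in>candidates q. mult f q \<le> mult g q}"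
  by (cases q rule: candidates.cases) auto

lemma base_mult_eq: "base_mult L q = (INF f\<in>candidates q. mult f q)"
  by (cases q rule: candidates.cases) auto

lemma base_mult_le: "f \<in> candidates q \<Longrightarrow> base_mult L q \<le> mult f q"
  unfolding base_mult_eq by (rule cINF_lower) auto

lemma min_mult_forms_iff: "f \<in> min_mult_forms L q \<longleftrightarrow> f \<in> candidates q \<and> mult f q = base_mult L q"
proof
  assume "f \<in> min_mult_forms L q"
  then have f: "f \<in> candidates q" "\<forall>g\<in>candidates q. mult f q \<le> mult g q"
    unfolding min_mult_forms_eq by auto
  have "base_mult L q \<in> (\<lambda>f. mult f q) ` candidates q"
    unfolding base_mult_eq using f(1) by (intro Inf_nat_def1) auto
  then obtain g where "g \<in> candidates q" "base_mult L q = mult g q" by blast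
  with f base_mult_le[OF f(1)] show "f \<in> candidates q \<and> mult f q = base_mult L q"
    by (metis order_antisym)
next
  assume "f \<in> candidates q \<and> mult f q = base_mult L q"
  then show "f \<in> min_mult_forms L q"
    unfolding min_mult_forms_eq using base_mult_le by auto
qed

lemma min_mult_forms_nonempty: "candidates q \<noteq> {} \<Longrightarrow> min_mult_forms L q \<noteq> {}"
proof -
  assume "candidates q \<noteq> {}"
  then have "base_mult L q \<in> (\<lambda>f. mult f q) ` candidates q"
    unfolding base_mult_eq by (intro Inf_nat_def1) auto
  then obtain f where "f \<in> candidates q" "base_mult L q = mult f q" by blast
  then have "f \<in> min_mult_forms L q" by (simp add: min_mult_forms_iff)
  then show ?thesis by blast
qed

lemma candidates_subset: "candidates q \<subseteq> L - {0}"
proof -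
  obtain p ds where q: "q = (p, ds)" by (cases q)
  show ?thesis unfolding q
    by (induction ds) (auto simp: min_mult_forms_iff)
qed

lemma linear_combination: "f \<in> L \<Longrightarrow> g \<in> L \<Longrightarrow> f + const3 c * g \<in> L"
  by (intro add_L cmult_L)

text \<open>
  The candidates at a point are the general members of the system. Passing to the next point keeps
  those members for which one coefficient of lowest order is nonzero; as the coefficient depends
  linearly on the form, this excludes only one more member of a pencil. The linear dependence
  holds because the proper transform of a candidate is the total transform divided by the equation
  of the exceptional divisor, which is the same for all candidates.
\<close>

lemma candidates_properties:
  assumes p: "p \<in> P2"
  shows "candidates (p, ds) \<noteq> {} \<and>
    (\<forall>f\<in>L. \<forall>g\<in>candidates (p, ds). finite {c. f + const3 c * g \<notin> candidates (p, ds)}) \<and>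
    (\<forall>f\<in>candidates (p, ds). total_transform f (p, ds) =
       exc_divisor_eq (base_mult L) (p, ds) * proper_transform f (p, ds))"
proof (induction ds)
  case Nil
  have "finite {c. f + const3 c * g = 0}" if "g \<noteq> 0" for f g :: "'k poly3"
  proof (cases "\<exists>c. f + const3 c * g = 0")
    case True
    then obtain c where c: "f + const3 c * g = 0" by blast
    have "c' = c" if "f + const3 c' * g = 0" for c'
    proof -
      have "const3 c' * g = const3 c * g" using c that by (metis add_left_cancel)
      with \<open>g \<noteq> 0\<close> have "const3 c' = const3 c" using mult_right_cancel by blast
      then show ?thesis by simp
    qed
    then have "{c. f + const3 c * g = 0} \<subseteq> {c}" by blast
    then show ?thesis by (rule finite_subset) simp
  next
    case False
    then have "{c. f + const3 c * g = 0} = {}" by blast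
    then show ?thesis by (simp only: finite.emptyI)
  qed
  then have "finite {c. f + const3 c * g \<notin> L - {0}}" if "f \<in> L" "g \<in> L - {0}" for f g
    using that linear_combination[of f g] by simp
  with nonzero_L show ?case by (auto simp: exc_divisor_eq_Nil simp del: mult_pCons_left)
next
  case (Cons a ds)
  let ?q = "(p, ds)" and ?q' = "(p, a # ds)"
  let ?E = "exc_divisor_eq (base_mult L) ?q" and ?\<mu> = "base_mult L ?q"
  note C = min_mult_forms_iff[of _ ?q]
  have t: "total_transform f ?q = ?E * proper_transform f ?q" if "f \<in> candidates ?q" for f
    using Cons.IH that by blast
  have nonempty: "candidates ?q' \<noteq> {}" using Cons.IH min_mult_forms_nonempty[of ?q] by simp
  have fin: "finite {c. f + const3 c * g \<notin> candidates ?q'}" if f: "f \<in> L" and g: "g \<in> candidates ?q'" for f g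
  proof -
    have gc: "g \<in> candidates ?q" and gm: "mult g ?q = ?\<mu>" using g by (auto simp: C)
    let ?B = "{c. f + const3 c * g \<notin> candidates ?q}"
    have finB: "finite ?B" using Cons.IH f gc by blast
    then obtain c1 where "c1 \<notin> ?B" using exists_avoiding_finite by blast
    then have f1: "f + const3 c1 * g \<in> candidates ?q" (is "?f1 \<in> _") by blast
    have gnz: "proper_transform g ?q \<noteq> 0"
      using gc candidates_subset form_L proper_transform_nonzero[OF _ _ p] by blast
    then obtain i j where ij: "i + j = ?\<mu>" "coeff2 (proper_transform g ?q) i j \<noteq> 0"
      using order0_attained gm by (metis mult_def)
    \<comment> \<open>at this parameter the coefficient at \<open>(i, j)\<close> cancels\<close>
    define e0 where "e0 = - coeff2 (proper_transform ?f1 ?q) i j / coeff2 (proper_transform g ?q) i j"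
    have "f + const3 c * g \<in> candidates ?q'" if c: "c \<notin> ?B" "c \<noteq> c1 + e0" for c
    proof -
      let ?h = "f + const3 c * g"
      have h: "?h \<in> candidates ?q" using c by blast
      have split: "?h = ?f1 + const3 (c - c1) * g"
      proof -
        have "const3 c = const3 c1 + const3 (c - c1)" by simp
        then show ?thesis by (metis add.assoc distrib_right)
      qed
      have "?E * proper_transform ?h ?q = total_transform ?h ?q" using t[OF h] by simp
      also have "\<dots> = total_transform ?f1 ?q + const2 (c - c1) * total_transform g ?q"
        by (subst split) (simp only: total_simps total_transform_const3)
      also have "\<dots> = ?E * (proper_transform ?f1 ?q + const2 (c - c1) * proper_transform g ?q)"
        unfolding t[OF f1] t[OF gc] by (simp only: distrib_left mult.left_commute)
      finally have pt: "proper_transform ?h ?q = proper_transform ?f1 ?q + const2 (c - c1) * proper_transform g ?q"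
        using exc_divisor_eq_nonzero[of "base_mult L" p ds] mult_left_cancel by blast
      have coeff: "coeff2 (proper_transform ?h ?q) i' j' =
          coeff2 (proper_transform ?f1 ?q) i' j' + (c - c1) * coeff2 (proper_transform g ?q) i' j'" for i' j'
        unfolding pt by simp
      have "vanishes_to ?\<mu> (proper_transform ?h ?q)"
        using base_mult_le[OF h] vanishes_to_order0[of "proper_transform ?h ?q"]
        unfolding vanishes_to_def mult_def by (meson order_trans)
      moreover have "coeff2 (proper_transform ?h ?q) i j \<noteq> 0"
      proof
        assume "coeff2 (proper_transform ?h ?q) i j = 0"
        then have "(c - c1) * coeff2 (proper_transform g ?q) i j = - coeff2 (proper_transform ?f1 ?q) i j"
          unfolding coeff by (simp only: eq_neg_iff_add_eq_0 add.commute)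
        then have "c - c1 = e0" using ij(2) by (metis e0_def nonzero_eq_divide_eq)
        with c(2) show False by (simp add: algebra_simps)
      qed
      ultimately have "mult ?h ?q = ?\<mu>"
        unfolding mult_def using ij(1) order0_eqI by blast
      then show ?thesis using h by (simp add: C del: mult_pCons_left)
    qed
    then have "{c. f + const3 c * g \<notin> candidates ?q'} \<subseteq> insert (c1 + e0) ?B" by blast
    then show ?thesis using finB finite_subset by blast
  qed
  have "total_transform f ?q' = exc_divisor_eq (base_mult L) ?q' * proper_transform f ?q'"
    if "f \<in> candidates ?q'" for f
  proof -
    have fc: "f \<in> candidates ?q" and fm: "mult f ?q = ?\<mu>" using that by (auto simp: C)
    have "total_transform f ?q' = chart a (?E * proper_transform f ?q)"
      using t[OF fc] by (simp only: total_transform_Cons)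
    also have "\<dots> = chart a ?E * (proper_transform f ?q' * exc_eq a ^ ?\<mu>)"
      using proper_transform_mult[of f p a ds] fm by (simp add: hom_mult[OF is_hom_chart])
    finally show ?thesis by (simp add: exc_divisor_eq_Cons mult_ac)
  qed
  with nonempty fin show ?case by blast
qed

lemma total_transform_candidate:
  "p \<in> P2 \<Longrightarrow> f \<in> candidates (p, ds) \<Longrightarrow>
   total_transform f (p, ds) = exc_divisor_eq (base_mult L) (p, ds) * proper_transform f (p, ds)"
  using candidates_properties by blast

text \<open>
  Every form of the system is a combination of two candidates: \<open>f = (f + c g) - c g\<close>.
\<close>

lemma exc_divisor_eq_dvd_total_transform:
  assumes "p \<in> P2" "f \<in> L"
  shows "exc_divisor_eq (base_mult L) (p, ds) dvd total_transform f (p, ds)"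
proof -
  note C = candidates_properties[OF assms(1), of ds]
  obtain g where g: "g \<in> candidates (p, ds)" using C by blast
  then have "finite {c. f + const3 c * g \<notin> candidates (p, ds)}" using C assms(2) by blast
  then obtain c where c: "f + const3 c * g \<in> candidates (p, ds)" using exists_avoiding_finite by blast
  have "f = (f + const3 c * g) - const3 c * g" by simp
  then have "total_transform f (p, ds) = total_transform (f + const3 c * g) (p, ds) - const2 c * total_transform g (p, ds)"
    by (metis total_simps(3,5) total_transform_const3)
  moreover have "exc_divisor_eq (base_mult L) (p, ds) dvd total_transform (f + const3 c * g) (p, ds)"
    "exc_divisor_eq (base_mult L) (p, ds) dvd total_transform g (p, ds)"
    using total_transform_candidate[OF assms(1)] c g by simp_all
  ultimately show ?thesis by (simp del: mult_pCons_left)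
qed

end

locale base_ideal_system =
  fixes I :: "'k::alg_closed_field poly3 set" and d :: nat
  assumes generated: "I = ideal_gen (graded_part I d)"
    and nonzero: "\<exists>f\<in>I. f \<noteq> 0"
begin

abbreviation L :: "'k poly3 set" where "L \<equiv> graded_part I d"
abbreviation K :: "'k npt set" where "K \<equiv> base_points I d"
abbreviation \<mu> :: "'k npt \<Rightarrow> nat" where "\<mu> \<equiv> base_mult L"

lemma ideal_I: "is_ideal I"
  by (subst generated) simp

sublocale linear_system L d
proof
  show "\<exists>f\<in>L. f \<noteq> 0"
  proof (rule ccontr)
    assume "\<not> ?thesis"
    then have "L \<subseteq> {0}" by auto
    then have "I \<subseteq> {0}" by (subst generated) (rule ideal_gen_minimal, auto simp: is_ideal_iff)
    with nonzero show False by auto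
  qed
  show "f \<in> L \<Longrightarrow> g \<in> L \<Longrightarrow> f + g \<in> L" for f g
    using ideal_I by (auto simp: graded_part_def ideal_add form_add)
  show "const3 c * f \<in> L" if "f \<in> L" for c f
    using that ideal_mult[OF ideal_I] form_cmult by (auto simp: graded_part_def simp del: mult_pCons_left)
qed (auto simp: graded_part_def)

lemma base_point_P2: "(p, ds) \<in> K \<Longrightarrow> p \<in> P2"
  by (induction rule: base_points.induct) auto

lemma base_points_Nil_iff: "(p, []) \<in> K \<longleftrightarrow> p \<in> P2 \<and> (\<forall>f\<in>I. value_at p f = 0)"
  by (subst base_points.simps) auto

lemma base_points_Cons_iff: "(p, a # ds) \<in> K \<longleftrightarrow>
    (p, ds) \<in> K \<and> (\<forall>f\<in>min_mult_forms L (p, ds). eval2 id 0 0 (proper_transform f (p, a # ds)) = 0)"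
  by (subst base_points.simps) auto

lemma not_base_pointD:
  assumes "p \<in> P2" "(p, []) \<notin> K"
  obtains g where "g \<in> L" "value_at p g \<noteq> 0"
proof -
  have "\<exists>g\<in>L. value_at p g \<noteq> 0"
  proof (rule ccontr)
    assume "\<not> ?thesis"
    then have "L \<subseteq> {f. value_at p f \<in> {0}}" by auto
    then have "I \<subseteq> {f. value_at p f \<in> {0}}"
      by (subst generated) (intro ideal_gen_minimal is_ideal_vimage is_hom_value_at, auto simp: is_ideal_iff)
    with assms show False by (auto simp: base_points_Nil_iff)
  qed
  then show ?thesis using that by blast
qed

lemma base_mult_attained:
  assumes "p \<in> P2"
  obtains f where "f \<in> min_mult_forms L (p, ds)"
  using candidates_properties[OF assms, of ds] min_mult_forms_nonempty[of "(p, ds)"] by auto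

text \<open>
  The proper transforms of all candidates pass through a base point, by definition.
\<close>

lemma base_mult_pos:
  assumes "(p, ds) \<in> K"
  shows "0 < \<mu> (p, ds)"
proof -
  have p: "p \<in> P2" using assms by (rule base_point_P2)
  obtain f where f: "f \<in> min_mult_forms L (p, ds)" using base_mult_attained[OF p] .
  then have fc: "f \<in> candidates (p, ds)" and m: "mult f (p, ds) = \<mu> (p, ds)"
    by (auto simp: min_mult_forms_iff)
  have fL: "f \<in> L" "f \<noteq> 0" using fc candidates_subset[of "(p, ds)"] by auto
  have "eval2 id 0 0 (proper_transform f (p, ds)) = 0"
  proof (cases ds)
    case Nil
    then show ?thesis using assms fL value_at_local_eq[OF p, of f]
      by (auto simp: base_points_Nil_iff graded_part_def)
  next
    case (Cons a ds')
    then show ?thesis using assms fc by (auto simp: base_points_Cons_iff)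
  qed
  then have "coeff2 (proper_transform f (p, ds)) 0 0 = 0" by (simp add: eval2_origin)
  moreover have "proper_transform f (p, ds) \<noteq> 0"
    using fL form_L proper_transform_nonzero[OF _ _ p] by blast
  ultimately have "order0 (proper_transform f (p, ds)) \<noteq> 0"
    using order0_attained[of "proper_transform f (p, ds)"] by (metis add_is_0)
  then show ?thesis using m by (simp add: mult_def)
qed

end

section \<open>Virtual passage implies the multiplicities at the proper base points\<close>

text \<open>
  Restrictions to the line \<open>v = a u\<close>, and to the axis \<open>v = 0\<close> after blowing up the origin. The axis is
  the proper transform of the line if the new coordinates are centered at its direction.
\<close>

definition on_line :: "'k::field \<Rightarrow> 'k poly2 \<Rightarrow> 'k poly" where
  "on_line a = eval2 (\<lambda>c. [:c:]) [:0, 1:] [:0, a:]"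

definition on_exceptional :: "'k::field poly2 \<Rightarrow> 'k poly" where
  "on_exceptional = eval2 (\<lambda>c. [:c:]) [:0, 1:] 0"

lemma is_hom_on_line [simp]: "is_hom (on_line a)" and is_hom_on_exceptional [simp]: "is_hom on_exceptional"
  by (simp_all add: on_line_def on_exceptional_def)

lemma on_exceptional_chart: "on_exceptional (chart (Slope a) g) = on_line a g"
  by (rule hom_ext2[of "\<lambda>g. on_exceptional (chart (Slope a) g)"])
     (simp_all add: is_hom_comp[OF is_hom_on_exceptional is_hom_chart] hom_simps[OF is_hom_on_exceptional],
      simp_all add: on_line_def on_exceptional_def)

lemma coeff_0_on_exceptional: "coeff (on_exceptional g) 0 = eval2 id 0 0 g"
proof (rule hom_ext2[of "\<lambda>g. coeff (on_exceptional g) 0"])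
  have "is_hom (\<lambda>p :: 'a poly. coeff p 0)" by (auto simp: is_hom_def coeff_mult_0)
  then show "is_hom (\<lambda>g :: 'a poly2. coeff (on_exceptional g) 0)" by (rule is_hom_comp) simp
qed (simp_all add: on_exceptional_def)

text \<open>
  The homogeneous part of degree \<open>n\<close> evaluated at \<open>(1, a)\<close>, as a polynomial in the slope \<open>a\<close>.
\<close>

definition slope_poly :: "nat \<Rightarrow> 'k::field poly2 \<Rightarrow> 'k poly" where
  "slope_poly n g = (\<Sum>j\<le>n. monom (coeff2 g (n - j) j) j)"

lemma coeff_slope_poly: "coeff (slope_poly n g) j = (if j \<le> n then coeff2 g (n - j) j else 0)"
  by (simp add: slope_poly_def coeff_sum)

lemma coeff_on_line: "coeff (on_line a g) n = poly (slope_poly n g) a"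
proof (induction g rule: poly2_induct)
  case zero
  then show ?case by (simp add: slope_poly_def hom_0[OF is_hom_on_line])
next
  case (add f g)
  then show ?case
    by (simp add: slope_poly_def hom_add[OF is_hom_on_line] add_monom[symmetric] sum.distrib)
next
  case (monom c i j)
  have "on_line a (monom2 c i j) = monom (c * a ^ j) (i + j)"
  proof -
    have "[:0, a:] = monom a (Suc 0)" by (simp add: monom_Suc monom_0)
    then have "[:0, a:] ^ j = monom (a ^ j) j" by (simp add: monom_power)
    then show ?thesis
      by (simp add: on_line_def eval2_monom pCons_power mult_monom smult_monom)
  qed
  moreover have "slope_poly n (monom2 c i j) = (if i + j = n then monom c j else 0)"
    by (rule poly_eqI) (auto simp: coeff_slope_poly)
  ultimately show ?case by (auto simp: poly_monom)
qed

lemma monom_dvd_cancel: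
  fixes s g :: "'k::field poly"
  assumes "coeff s 0 \<noteq> 0" "monom 1 n dvd s * g"
  shows "monom 1 n dvd g"
proof -
  have "coeff g k = 0" if "k < n" for k
    using that
  proof (induction k rule: less_induct)
    case (less k)
    have "coeff (s * g) k = 0" using assms(2) less.prems by (simp add: monom_1_dvd_iff')
    also have "coeff (s * g) k = (\<Sum>i\<in>{..k}. coeff s i * coeff g (k - i))" by (simp add: coeff_mult)
    also have "\<dots> = coeff s 0 * coeff g k"
      using less by (subst sum.remove[of _ 0]) (auto intro!: sum.neutral)
    finally show ?case using assms(1) by simp
  qed
  then show ?thesis by (simp add: monom_1_dvd_iff')
qed

context base_ideal_system
begin

text \<open>
  The slopes of infinitely near base points are roots of the leading form at \<open>p\<close> of one general member
  of the system.
\<close>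

lemma finite_slopes:
  assumes "(p, []) \<in> K"
  shows "finite {a. (p, [Slope a]) \<in> K}"
proof -
  have p: "p \<in> P2" using assms by (rule base_point_P2)
  obtain f where f: "f \<in> min_mult_forms L (p, [])" using base_mult_attained[OF p] .
  define m where "m = mult f (p, [])"
  have "f \<in> L" "f \<noteq> 0" using f by (auto simp: min_mult_forms_iff)
  then have "local_eq p f \<noteq> 0" using local_eq_eq_0 form_L p by blast
  then obtain i j where ij: "i + j = m" "coeff2 (local_eq p f) i j \<noteq> 0"
    unfolding m_def mult_def using order0_attained by (metis proper_transform.simps(1))
  then have "coeff (slope_poly m (local_eq p f)) j \<noteq> 0" by (auto simp: coeff_slope_poly)
  then have nz: "slope_poly m (local_eq p f) \<noteq> 0" by auto
  have "poly (slope_poly m (local_eq p f)) a = 0" if "(p, [Slope a]) \<in> K" for a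
  proof -
    have "eval2 id 0 0 (proper_transform f (p, [Slope a])) = 0"
      using that f by (auto simp: base_points_Cons_iff)
    then have "coeff (on_exceptional (proper_transform f (p, [Slope a]))) 0 = 0"
      by (simp add: coeff_0_on_exceptional)
    moreover have "on_line a (local_eq p f) = on_exceptional (proper_transform f (p, [Slope a])) * monom 1 m"
      using arg_cong[OF proper_transform_mult[of f p "Slope a" "[]"], of on_exceptional]
      by (simp add: on_exceptional_chart m_def hom_simps[OF is_hom_on_exceptional] hom_power[OF is_hom_on_exceptional])
         (simp add: on_exceptional_def pCons_power)
    ultimately show ?thesis
      using coeff_on_line[of a "local_eq p f" m]
      by (simp add: mult.commute[of _ "monom 1 m"] coeff_monom_mult)
  qed
  then have "{a. (p, [Slope a]) \<in> K} \<subseteq> {a. poly (slope_poly m (local_eq p f)) a = 0}" by auto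
  then show ?thesis using poly_roots_finite[OF nz] finite_subset by blast
qed

text \<open>
  At the infinitely many points of the exceptional curve that are not blown up the exceptional divisor
  is \<open>\<mu> E\<close>. If the total transform contains it there, all homogeneous parts of degree less than \<open>\<mu>\<close>
  vanish in the corresponding directions, hence identically.
\<close>

lemma passes_virtually_vanishes_to:
  assumes "(p, []) \<in> K" "passes_virtually (K, \<mu>) f"
  shows "vanishes_to (\<mu> (p, [])) (local_eq p f)"
proof -
  have p: "p \<in> P2" using assms(1) by (rule base_point_P2)
  define m where "m = \<mu> (p, [])"
  have roots: "poly (slope_poly n (local_eq p f)) a = 0" if a: "(p, [Slope a]) \<notin> K" and n: "n < m" for a n
  proof -
    have "(p, [Slope a]) \<in> blowup_surface K" using p a assms(1) by (auto simp: blowup_surface_def)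
    then have "dvd_local (exc_divisor_eq \<mu> (p, [Slope a])) (total_transform f (p, [Slope a]))"
      using assms(2) by auto
    then obtain s t where s: "eval2 id 0 0 s \<noteq> 0"
      and eq: "s * chart (Slope a) (local_eq p f) = t * U ^ m"
      by (auto simp: dvd_local_def exc_divisor_eq_Cons exc_divisor_eq_Nil m_def hom_1[OF is_hom_chart])
    from arg_cong[OF eq, of on_exceptional]
    have "on_exceptional s * on_line a (local_eq p f) = on_exceptional t * monom 1 m"
      by (simp add: on_exceptional_chart hom_simps[OF is_hom_on_exceptional] hom_power[OF is_hom_on_exceptional])
         (simp add: on_exceptional_def pCons_power)
    moreover have "coeff (on_exceptional s) 0 \<noteq> 0" using s by (simp add: coeff_0_on_exceptional)
    ultimately have "monom 1 m dvd on_line a (local_eq p f)"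
      using monom_dvd_cancel dvd_triv_right by metis
    then show ?thesis using n by (simp add: monom_1_dvd_iff' coeff_on_line)
  qed
  have "slope_poly n (local_eq p f) = 0" if n: "n < m" for n
  proof (rule ccontr)
    assume "slope_poly n (local_eq p f) \<noteq> 0"
    then have "finite {a. poly (slope_poly n (local_eq p f)) a = 0}" by (rule poly_roots_finite)
    then have "finite ({a. poly (slope_poly n (local_eq p f)) a = 0} \<union> {a. (p, [Slope a]) \<in> K})"
      using finite_slopes[OF assms(1)] by simp
    then obtain a where "a \<notin> {a. poly (slope_poly n (local_eq p f)) a = 0} \<union> {a. (p, [Slope a]) \<in> K}"
      by (rule exists_avoiding_finite)
    with roots n show False by blast
  qed
  then have "coeff2 (local_eq p f) i j = 0" if "i + j < m" for i j
    using coeff_slope_poly[of "i + j" "local_eq p f" j] that by simp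
  then show ?thesis unfolding vanishes_to_def m_def[symmetric] by (meson not_less)
qed

end

text \<open>
  In adapted coordinates the monomial \<open>l0 ^ i * l1 ^ j * l2 ^ l\<close> contributes the monomial \<open>U ^ j * V ^ l\<close>
  to the local equation, and \<open>l1, l2\<close> belong to the ideal of the point.
\<close>

lemma form_in_power_of_point_ideal:
  assumes "p \<in> P2" "form m f" "vanishes_to n (local_eq p f)"
  shows "f \<in> ideal_pow (point_ideal p) n"
proof -
  obtain A B C l0 l1 l2 where l: "form 1 l1" "form 1 l2" and A: "\<And>m f. form m f \<Longrightarrow> form m (eval3 const3 A B C f)"
    "\<And>f. eval3 const3 l0 l1 l2 (eval3 const3 A B C f) = f"
    "eval3 const3 A B C l1 = Y" "eval3 const3 A B C l2 = Z"
    "\<And>f. local_eq p f = eval3 const2 1 U V (eval3 const3 A B C f)"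
    using adapted_coordinates[OF assms(1)] by metis
  have "value_at p l1 = 0" "value_at p l2 = 0"
    by (simp_all add: value_at_local_eq[OF assms(1)] A(3-5))
  then have l12: "l1 \<in> point_ideal p" "l2 \<in> point_ideal p"
    unfolding point_ideal_def using l by (auto intro!: ideal_gen_base)
  define g where "g = eval3 const3 A B C f"
  have g: "form m g" using A(1) assms(2) by (simp add: g_def)
  have "eval3 const3 l0 l1 l2 (monom3 (coeff3 g i j l) i j l) \<in> ideal_pow (point_ideal p) n" for i j l
  proof (cases "coeff3 g i j l = 0")
    case True
    then show ?thesis by (simp add: hom_0[OF is_hom_eval3] ideal_0)
  next
    case False
    then have m: "i + j + l = m" using g by (auto simp: form_def)
    then have "coeff2 (local_eq p f) j l \<noteq> 0"
      using coeff2_dehomogenize[OF g, of l j] A(5)[of f] False by (auto simp: g_def)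
    then have n: "n \<le> j + l" using assms(3) by (auto simp: vanishes_to_def)
    have "l1 ^ j * l2 ^ l \<in> ideal_pow (point_ideal p) (j + l)"
      using l12 by (intro ideal_pow_mult power_in_ideal_pow)
    then have "l1 ^ j * l2 ^ l \<in> ideal_pow (point_ideal p) n" using ideal_pow_mono[OF n] by blast
    from ideal_mult[OF is_ideal_pow this, of "const3 (coeff3 g i j l) * l0 ^ i"]
    show ?thesis by (simp add: eval3_monom mult.assoc del: mult_pCons_left)
  qed
  then have "eval3 const3 l0 l1 l2 g \<in> ideal_pow (point_ideal p) n"
    by (subst poly3_expand) (auto simp: hom_sum[OF is_hom_eval3] intro!: ideal_sum)
  then show ?thesis by (simp add: g_def A(2))
qed

lemma (in base_ideal_system) full_ideal_subset_fat_ideal: "full_ideal (K, \<mu>) \<subseteq> fat_ideal (K, \<mu>)"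
proof -
  have *: "g \<in> ideal_pow (point_ideal p) (\<mu> (p, []))"
    if "(p, []) \<in> K" "form m g \<and> (g = 0 \<or> passes_virtually (K, \<mu>) g)" for p m g
  proof (cases "g = 0")
    case True
    then show ?thesis by (simp only: ideal_0[OF is_ideal_pow])
  next
    case False
    then have "passes_virtually (K, \<mu>) g" using that(2) by blast
    then show ?thesis
      using that by (intro form_in_power_of_point_ideal[OF base_point_P2] passes_virtually_vanishes_to) blast+
  qed
  show ?thesis
  proof
    fix f assume "f \<in> full_ideal (K, \<mu>)"
    then obtain N g where f: "f = (\<Sum>m\<le>N. g m)"
      and g: "\<And>m. m \<le> N \<Longrightarrow> form m (g m) \<and> (g m = 0 \<or> passes_virtually (K, \<mu>) (g m))"
      unfolding full_ideal_def direct_sum_def by blast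
    have "f \<in> ideal_pow (point_ideal p) (\<mu> (p, []))" if "(p, []) \<in> K" for p
      unfolding f by (rule ideal_sum[OF is_ideal_pow]) (rule *[OF that g], simp)
    then show "f \<in> fat_ideal (K, \<mu>)" by (simp del: base_mult.simps)
  qed
qed

section \<open>Following an arc through the base points\<close>

abbreviation along :: "'k::field fps \<Rightarrow> 'k fps \<Rightarrow> 'k poly2 \<Rightarrow> 'k fps" where
  "along u v \<equiv> eval2 fps_const u v"

lemma along_nth_0:
  assumes "fps_nth u 0 = 0" "fps_nth v 0 = 0"
  shows "fps_nth (along u v g) 0 = eval2 id 0 0 g"
  by (rule hom_ext2[of "\<lambda>g. fps_nth (along u v g) 0"])
     (use assms in \<open>simp_all add: is_hom_comp[OF is_hom_fps_nth_0 is_hom_eval2[OF is_hom_fps_const]]\<close>)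

lemma along_chart:
  assumes "along u' v' (chart a U) = u" "along u' v' (chart a V) = v"
  shows "along u' v' (chart a g) = along u v g"
  by (rule hom_ext2[of "\<lambda>g. along u' v' (chart a g)"])
     (use assms in \<open>simp_all add: is_hom_comp[OF is_hom_eval2[OF is_hom_fps_const] is_hom_chart]\<close>)

text \<open>
  The direction of the arc is the value at \<open>0\<close> of \<open>v/u\<close>, or \<open>Vertical\<close> if \<open>u\<close> has the greater order.
\<close>

lemma arc_lifts_to_blowup:
  fixes u v :: "'k::field fps"
  assumes "fps_nth u 0 = 0" "fps_nth v 0 = 0" "u \<noteq> 0 \<or> v \<noteq> 0"
  obtains a u' v' where "fps_nth u' 0 = 0" "fps_nth v' 0 = 0" "u' \<noteq> 0 \<or> v' \<noteq> 0"
    "\<And>g. along u' v' (chart a g) = along u v g"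
    "fps_nth (along u' v' (exc_eq a)) 0 = 0" "along u' v' (exc_eq a) \<noteq> 0"
proof (cases "u \<noteq> 0 \<and> u dvd v")
  case True
  then obtain w where w: "v = u * w" by (auto elim: dvdE)
  show ?thesis
    by (rule that[of u "w - fps_const (fps_nth w 0)" "Slope (fps_nth w 0)"])
       (use True assms w in \<open>simp_all add: along_chart hom_simps[OF is_hom_eval2[OF is_hom_fps_const]]\<close>)
next
  case False
  then have v: "v \<noteq> 0" using assms(3) by auto
  have "v dvd u"
  proof (cases "u = 0")
    case False
    then show ?thesis using v \<open>\<not> (u \<noteq> 0 \<and> u dvd v)\<close> by (simp add: fps_dvd_iff)
  qed simp
  then obtain w where w: "u = v * w" by (auto elim: dvdE)
  have "fps_nth w 0 = 0"
  proof (rule ccontr)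
    assume "fps_nth w 0 \<noteq> 0"
    then have "w dvd 1" "u \<noteq> 0" using v w by auto
    then show False using False w by (metis dvd_refl mult_unit_dvd_iff)
  qed
  then show ?thesis
    by (intro that[of w v Vertical])
       (use v assms w in \<open>simp_all add: along_chart mult.commute hom_simps[OF is_hom_eval2[OF is_hom_fps_const]]\<close>)
qed

context base_ideal_system
begin

text \<open>
  Induction along the infinitely near points through which the arc passes. The difference of the orders
  of \<open>g0\<close> and of the exceptional divisor along the arc is nonnegative and decreases when a base point is
  blown up, because base points have positive multiplicity and the lifted arc meets the exceptional
  curve. At the first point outside \<open>K\<close> some general member of the system has a proper transform that
  does not pass through the point, so the exceptional divisor has the same order along the arc as
  this member, whereas by virtual passage it divides the total transform of \<open>f\<close>.
\<close>

lemma arc_at_point: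
  assumes p: "p \<in> P2" and f: "passes_virtually (K, \<mu>) f"
    and pred: "\<And>i. i < length ds \<Longrightarrow> (p, drop (Suc i) ds) \<in> K"
    and arc: "fps_nth u 0 = 0" "fps_nth v 0 = 0" "u \<noteq> 0 \<or> v \<noteq> 0"
    and g0: "g0 \<in> L" "along u v (total_transform g0 (p, ds)) \<noteq> 0"
  shows "\<exists>g\<in>L. along u v (total_transform g (p, ds)) dvd along u v (total_transform f (p, ds))"
  using pred arc g0(2)
proof (induction "subdegree (along u v (total_transform g0 (p, ds))) -
    subdegree (along u v (exc_divisor_eq \<mu> (p, ds)))" arbitrary: u v ds rule: less_induct)
  case less
  note hom = hom_simps[OF is_hom_eval2[OF is_hom_fps_const]] and pow = hom_power[OF is_hom_eval2[OF is_hom_fps_const]]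
  show ?case
  proof (cases "(p, ds) \<in> K")
    case notK: False
    then have q: "(p, ds) \<in> blowup_surface K" using p less.prems(1) by (auto simp: blowup_surface_def)
    then have "dvd_local (exc_divisor_eq \<mu> (p, ds)) (total_transform f (p, ds))"
      using f unfolding passes_virtually.simps by blast
    then obtain s t where s: "eval2 id 0 0 s \<noteq> 0"
      and eq: "s * total_transform f (p, ds) = t * exc_divisor_eq \<mu> (p, ds)"
      unfolding dvd_local_def by blast
    have "along u v s dvd 1" using s less.prems along_nth_0[of u v s] by simp
    moreover have "along u v (exc_divisor_eq \<mu> (p, ds)) dvd along u v s * along u v (total_transform f (p, ds))"
      using arg_cong[OF eq, of "along u v"] by (simp only: hom dvd_triv_right)
    ultimately have dvd_f: "along u v (exc_divisor_eq \<mu> (p, ds)) dvd along u v (total_transform f (p, ds))"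
      by (simp only: dvd_mult_unit_iff')
    show ?thesis
    proof (cases ds)
      case Nil
      then obtain g where g: "g \<in> L" "value_at p g \<noteq> 0" using not_base_pointD[OF p] notK by blast
      then have "fps_nth (along u v (total_transform g (p, ds))) 0 \<noteq> 0"
        using value_at_local_eq[OF p] Nil less.prems by (simp add: along_nth_0)
      then have "along u v (total_transform g (p, ds)) dvd along u v (total_transform f (p, ds))"
        by (rule fps_unit_dvd)
      then show ?thesis using g by blast
    next
      case (Cons a ds')
      then have "(p, ds') \<in> K" using less.prems(1)[of 0] by simp
      then obtain g where g: "g \<in> candidates (p, ds)" "eval2 id 0 0 (proper_transform g (p, ds)) \<noteq> 0"
        using notK Cons base_points_Cons_iff[of p a ds'] by auto
      have "g \<in> L" using g candidates_subset by blast
      have "along u v (proper_transform g (p, ds)) dvd 1" using g less.prems along_nth_0[of u v] by simp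
      then have "along u v (total_transform g (p, ds)) dvd along u v (total_transform f (p, ds))"
        unfolding total_transform_candidate[OF p g(1)] hom using dvd_f by (simp only: mult_unit_dvd_iff)
      then show ?thesis using \<open>g \<in> L\<close> by blast
    qed
  next
    case K: True
    obtain a u' v' where arc': "fps_nth u' 0 = 0" "fps_nth v' 0 = 0" "u' \<noteq> 0 \<or> v' \<noteq> 0"
      and ch: "\<And>g. along u' v' (chart a g) = along u v g"
      and exc: "fps_nth (along u' v' (exc_eq a)) 0 = 0" "along u' v' (exc_eq a) \<noteq> 0"
      using arc_lifts_to_blowup[OF less.prems(2-4)] by metis
    have tt: "along u' v' (total_transform g (p, a # ds)) = along u v (total_transform g (p, ds))" for g
      by (simp only: total_transform_Cons ch)
    let ?e = "along u' v' (exc_eq a)" and ?E = "along u v (exc_divisor_eq \<mu> (p, ds))"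
      and ?E' = "along u' v' (exc_divisor_eq \<mu> (p, a # ds))" and ?g = "along u v (total_transform g0 (p, ds))"
    have E': "?E' = ?e ^ \<mu> (p, ds) * ?E"
      by (simp only: exc_divisor_eq_Cons hom pow ch)
    have dvd: "?E dvd ?g" "?E' dvd along u' v' (total_transform g0 (p, a # ds))"
      by (intro hom_dvd[OF is_hom_eval2[OF is_hom_fps_const]] exc_divisor_eq_dvd_total_transform p g0)+
    have nz: "?E \<noteq> 0" using dvd(1) less.prems(5) by (metis dvd_0_left)
    have dvd': "?E' dvd ?g" using dvd(2) unfolding tt .
    have "subdegree ?e > 0" using exc by (metis gr0I subdegree_eq_0_iff)
    then have "subdegree ?E < subdegree ?E'"
      using nz exc base_mult_pos[OF K] by (simp add: E' subdegree_power del: base_mult.simps)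
    moreover have "subdegree ?E' \<le> subdegree ?g"
      using dvd' less.prems(5) by (rule dvd_imp_subdegree_le)
    ultimately have less': "subdegree (along u' v' (total_transform g0 (p, a # ds))) - subdegree ?E' < subdegree ?g - subdegree ?E"
      unfolding tt by linarith
    have "\<exists>g\<in>L. along u' v' (total_transform g (p, a # ds)) dvd along u' v' (total_transform f (p, a # ds))"
    proof (rule less.hyps[OF less' _ arc'])
      show "(p, drop (Suc i) (a # ds)) \<in> K" if "i < length (a # ds)" for i
        using that less.prems(1)[of "i - 1"] K by (cases i) auto
      show "along u' v' (total_transform g0 (p, a # ds)) \<noteq> 0"
        using less.prems(5) unfolding tt .
    qed
    then show ?thesis unfolding tt .
  qed
qed

end

lemma arc_local_coordinates:
  fixes c0 c1 c2 :: "'k::field fps"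
  assumes "fps_nth c0 0 \<noteq> 0 \<or> fps_nth c1 0 \<noteq> 0 \<or> fps_nth c2 0 \<noteq> 0"
  obtains p s u v where "p \<in> P2" "fps_nth s 0 \<noteq> 0" "fps_nth u 0 = 0" "fps_nth v 0 = 0"
    "\<And>m f. form m f \<Longrightarrow> eval3 fps_const c0 c1 c2 f = s ^ m * along u v (local_eq p f)"
proof -
  note local_coordinates = that
  have *: thesis if "p \<in> P2" "fps_nth s 0 \<noteq> 0" "fps_nth u 0 = 0" "fps_nth v 0 = 0"
     "c0 = s * along u v (local_eq p X)" "c1 = s * along u v (local_eq p Y)" "c2 = s * along u v (local_eq p Z)" for p s u v
  proof (rule local_coordinates[OF that(1-4)])
    fix m f assume "form m (f :: 'k poly3)"
    then have "eval3 fps_const c0 c1 c2 f =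
      s ^ m * eval3 fps_const (along u v (local_eq p X)) (along u v (local_eq p Y)) (along u v (local_eq p Z)) f"
      unfolding that(5-7) by (rule eval3_form_scale[OF is_hom_fps_const])
    also have "eval3 fps_const (along u v (local_eq p X)) (along u v (local_eq p Y)) (along u v (local_eq p Z)) f
       = along u v (local_eq p f)"
      using hom_eq_eval3[OF is_hom_comp[OF is_hom_eval2[OF is_hom_fps_const, of u v] is_hom_local_eq[of p]], of f]
      by simp
    finally show "eval3 fps_const c0 c1 c2 f = s ^ m * along u v (local_eq p f)" .
  qed
  note hom = hom_simps[OF is_hom_eval2[OF is_hom_fps_const]]
  have unit: "s * (w * inverse s) = w" if "fps_nth s 0 \<noteq> 0" for s w :: "'k fps"
    using that by (simp add: mult.left_commute[of s] mult.commute[of s] inverse_mult_eq_1)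
  consider "fps_nth c0 0 \<noteq> 0" | "fps_nth c0 0 = 0" "fps_nth c1 0 \<noteq> 0" | "fps_nth c0 0 = 0" "fps_nth c1 0 = 0" "fps_nth c2 0 \<noteq> 0"
    using assms by blast
  then show thesis
  proof cases
    case 1
    let ?v = "c1 * inverse c0" and ?w = "c2 * inverse c0"
    show thesis
      by (rule *[of "(1, fps_nth ?v 0, fps_nth ?w 0)" c0 "?v - fps_const (fps_nth ?v 0)" "?w - fps_const (fps_nth ?w 0)"])
         (use 1 in \<open>simp_all add: P2_def local_eq.simps hom unit\<close>)
  next
    case 2
    let ?v = "c0 * inverse c1" and ?w = "c2 * inverse c1"
    show thesis
      by (rule *[of "(0, 1, fps_nth ?w 0)" c1 ?v "?w - fps_const (fps_nth ?w 0)"])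
         (use 2 in \<open>simp_all add: P2_def local_eq.simps hom unit\<close>)
  next
    case 3
    show thesis
      by (rule *[of "(0, 0, 1)" c2 "c0 * inverse c2" "c1 * inverse c2"])
         (use 3 in \<open>simp_all add: P2_def local_eq.simps hom unit\<close>)
  qed
qed

text \<open>
  The valuative form of virtual passage: the order of \<open>f\<close> along the arc is at least the minimum of the
  orders of the members of the system. A constant arc is not centered at a base point, since \<open>g0\<close>
  does not vanish there.
\<close>

lemma (in base_ideal_system) order_along_arc:
  assumes f: "form d f" "passes_virtually (K, \<mu>) f"
    and nonconst: "fps_nth c0 0 \<noteq> 0 \<or> fps_nth c1 0 \<noteq> 0 \<or> fps_nth c2 0 \<noteq> 0"
    and g0: "g0 \<in> L" "eval3 fps_const c0 c1 c2 g0 \<noteq> 0"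
  shows "\<exists>g\<in>L. eval3 fps_const c0 c1 c2 g dvd eval3 fps_const c0 c1 c2 f"
proof -
  obtain p s u v where p: "p \<in> P2" and s: "fps_nth s 0 \<noteq> 0" and uv: "fps_nth u 0 = 0" "fps_nth v 0 = 0"
    and loc: "\<And>m f. form m f \<Longrightarrow> eval3 fps_const c0 c1 c2 f = s ^ m * along u v (local_eq p f)"
    using arc_local_coordinates[OF nonconst] by metis
  have g0nz: "along u v (local_eq p g0) \<noteq> 0"
    using g0(2) loc[OF form_L[OF g0(1)]] by auto
  have "\<exists>g\<in>L. along u v (total_transform g (p, [])) dvd along u v (total_transform f (p, []))"
  proof (cases "u \<noteq> 0 \<or> v \<noteq> 0")
    case True
    show ?thesis
      by (rule arc_at_point[OF p f(2) _ uv True g0(1)]) (use g0nz in auto)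
  next
    case False
    have "along 0 0 g = fps_const (eval2 id 0 0 g)" for g :: "'k poly2"
      by (rule hom_ext2[of "along 0 0" "\<lambda>g. fps_const (eval2 id 0 0 g)"])
         (simp_all add: is_hom_comp[OF is_hom_fps_const is_hom_origin])
    then have "fps_nth (along u v (local_eq p g0)) 0 \<noteq> 0" using g0nz False by auto
    then have "along u v (total_transform g0 (p, [])) dvd along u v (total_transform f (p, []))"
      unfolding total_transform.simps pullback.simps by (rule fps_unit_dvd)
    then show ?thesis using g0 by blast
  qed
  then obtain g where "g \<in> L" "along u v (local_eq p g) dvd along u v (local_eq p f)" by auto
  then show ?thesis
    by (intro bexI[of _ g]) (simp_all only: loc[OF form_L] loc[OF f(1)] mult_dvd_mono dvd_refl)
qed

section \<open>Polynomial functions on an infinite field and divisibility on lines\<close>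

lemma poly2_nonvanishing:
  fixes g :: "'k::alg_closed_field poly2"
  assumes "g \<noteq> 0"
  obtains a b where "eval2 id a b g \<noteq> 0"
proof -
  have "finite {a. poly (lead_coeff g) a = 0}" using assms by (intro poly_roots_finite) auto
  then obtain a where "a \<notin> {a. poly (lead_coeff g) a = 0}" by (rule exists_avoiding_finite)
  then have "coeff (map_poly (\<lambda>h. poly (map_poly id h) a) g) (degree g) \<noteq> 0"
    by (simp add: coeff_map_poly)
  then have "map_poly (\<lambda>h. poly (map_poly id h) a) g \<noteq> 0" by auto
  then have "finite {b. poly (map_poly (\<lambda>h. poly (map_poly id h) a) g) b = 0}"
    by (rule poly_roots_finite)
  then obtain b where "b \<notin> {b. poly (map_poly (\<lambda>h. poly (map_poly id h) a) g) b = 0}"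
    by (rule exists_avoiding_finite)
  then show ?thesis using that[of a b] by (simp add: eval2_def)
qed

lemma poly3_nonvanishing:
  fixes g :: "'k::alg_closed_field poly3"
  assumes "g \<noteq> 0"
  obtains a b c where "eval3 id a b c g \<noteq> 0"
proof -
  have "lead_coeff g \<noteq> 0" using assms by simp
  then obtain a b where "eval2 id a b (lead_coeff g) \<noteq> 0" by (rule poly2_nonvanishing)
  then have "coeff (map_poly (eval2 id a b) g) (degree g) \<noteq> 0"
    by (simp add: coeff_map_poly hom_0)
  then have "map_poly (eval2 id a b) g \<noteq> 0" by auto
  then have "finite {c. poly (map_poly (eval2 id a b) g) c = 0}"
    by (rule poly_roots_finite)
  then obtain c where "c \<notin> {c. poly (map_poly (eval2 id a b) g) c = 0}"
    by (rule exists_avoiding_finite)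
  then show ?thesis using that[of a b c] by (simp add: eval3_def)
qed

lemma dvd_if_order_le:
  fixes p q :: "'k::alg_closed_field poly"
  assumes "p \<noteq> 0" "q \<noteq> 0" "\<And>r. order r p \<le> order r q"
  shows "p dvd q"
  using assms
proof (induction "degree p" arbitrary: p q)
  case 0
  then show ?case using is_unit_iff_degree[of p] by (simp add: unit_imp_dvd)
next
  case (Suc n)
  then obtain r where r: "poly p r = 0" using alg_closed_imp_poly_has_root[of p] by auto
  then have "order r q > 0" using Suc.prems(1) Suc.prems(3)[of r] by (metis gr0I le_zero_eq order_root)
  then obtain p' q' where p': "p = [:- r, 1:] * p'" and q': "q = [:- r, 1:] * q'"
    using r Suc.prems(2) by (metis dvdE order_root poly_eq_0_iff_dvd less_irrefl)
  have nz: "p' \<noteq> 0" "q' \<noteq> 0" "p \<noteq> 0" "q \<noteq> 0" using Suc.prems p' q' by auto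
  have "n = degree p'" using Suc.hyps(2) nz by (simp add: p' degree_mult_eq del: mult_pCons_left)
  moreover have "order s p' \<le> order s q'" for s
    using Suc.prems(3)[of s] nz unfolding p' q' by (simp add: order_mult del: mult_pCons_left)
  ultimately have "p' dvd q'" using Suc.hyps(1) nz by blast
  then show ?case unfolding p' q' by (rule mult_dvd_mono[OF dvd_refl])
qed

text \<open>
  The Taylor expansion at \<open>r\<close>.
\<close>

definition expand_at :: "'k::field \<Rightarrow> 'k poly \<Rightarrow> 'k fps" where
  "expand_at r p = poly (map_poly fps_const p) (fps_const r + fps_X)"

lemma is_hom_expand_at [simp]: "is_hom (expand_at r)"
  unfolding expand_at_def [abs_def] by (intro is_hom_comp[OF is_hom_poly] is_hom_map_poly) simp

lemma expand_at_pCons: "expand_at r (pCons a p) = fps_const a + (fps_const r + fps_X) * expand_at r p"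
  by (simp add: expand_at_def map_poly_pCons)

lemma expand_at_nth_0: "fps_nth (expand_at r p) 0 = poly p r"
  by (induction p) (auto simp: expand_at_pCons hom_0[OF is_hom_expand_at])

lemma subdegree_expand_at:
  assumes "p \<noteq> 0"
  shows "expand_at r p \<noteq> 0" "subdegree (expand_at r p) = order r p"
proof -
  obtain q where q: "p = [:- r, 1:] ^ order r p * q" "\<not> [:- r, 1:] dvd q"
    using order_decomp[OF assms] by blast
  have "expand_at r [:- r, 1:] = fps_X"
    by (simp add: expand_at_pCons hom_0[OF is_hom_expand_at] fps_const_neg[symmetric] del: fps_const_neg)
  then have e: "expand_at r p = fps_X ^ order r p * expand_at r q"
    using arg_cong[OF q(1), of "expand_at r"]
    by (simp only: hom_mult[OF is_hom_expand_at] hom_power[OF is_hom_expand_at])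
  have "fps_nth (expand_at r q) 0 \<noteq> 0" using q(2) by (simp add: expand_at_nth_0 poly_eq_0_iff_dvd)
  then have "expand_at r q \<noteq> 0" "subdegree (expand_at r q) = 0"
    by (auto simp: subdegree_eq_0_iff)
  then show "expand_at r p \<noteq> 0" "subdegree (expand_at r p) = order r p"
    by (simp_all add: e fps_X_power_subdegree)
qed

text \<open>
  The restriction to the line with direction \<open>b\<close> through the generic point \<open>(X, Y, Z)\<close>, as a polynomial
  in the parameter of the line.
\<close>

definition shift_line :: "'k::field \<Rightarrow> 'k \<Rightarrow> 'k \<Rightarrow> 'k poly3 \<Rightarrow> 'k poly3 poly" where
  "shift_line b0 b1 b2 = eval3 (\<lambda>c. [:const3 c:]) [:X, const3 b0:] [:Y, const3 b1:] [:Z, const3 b2:]"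

lemma is_hom_shift_line [simp]: "is_hom (shift_line b0 b1 b2)"
  by (simp add: shift_line_def)

lemma shift_line_at_0: "poly (shift_line b0 b1 b2 f) 0 = f"
  by (rule hom_ext3[of "\<lambda>f. poly (shift_line b0 b1 b2 f) 0" "\<lambda>f. f"])
     (simp_all add: is_hom_comp[OF is_hom_poly is_hom_shift_line], simp_all add: shift_line_def)

text \<open>
  Only an upper bound for the degree is required, since \<open>c\<close> may be \<open>0\<close>; this makes the notion
  multiplicative.
\<close>

definition top_coeff :: "nat \<Rightarrow> 'a::comm_ring_1 poly \<Rightarrow> 'a \<Rightarrow> bool" where
  "top_coeff n p c \<longleftrightarrow> degree p \<le> n \<and> coeff p n = c"

lemma top_coeff_mult:
  assumes "top_coeff m p a" "top_coeff n q b"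
  shows "top_coeff (m + n) (p * q) (a * b)"
proof -
  have "degree p \<le> m" "degree q \<le> n" using assms by (auto simp: top_coeff_def)
  then have "degree (p * q) \<le> m + n"
    using degree_mult_le[of p q] by linarith
  moreover have "coeff (p * q) (m + n) = (\<Sum>i\<le>m + n. coeff p i * coeff q (m + n - i))"
    by (simp add: coeff_mult)
  moreover have "\<dots> = coeff p m * coeff q n"
  proof (subst sum.remove[of _ m])
    have "coeff p i * coeff q (m + n - i) = 0" if "i \<in> {..m + n} - {m}" for i
    proof (cases "i > m")
      case True
      then show ?thesis using \<open>degree p \<le> m\<close> by (simp add: coeff_eq_0)
    next
      case False
      then have "degree q < m + n - i" using \<open>degree q \<le> n\<close> that by auto
      then show ?thesis by (simp add: coeff_eq_0)
    qed
    then show "coeff p m * coeff q (m + n - m) + (\<Sum>i\<in>{..m + n} - {m}. coeff p i * coeff q (m + n - i)) = coeff p m * coeff q n"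
      by (simp add: sum.neutral)
  qed auto
  ultimately show ?thesis using assms by (simp add: top_coeff_def)
qed

lemma top_coeff_power: "top_coeff m p a \<Longrightarrow> top_coeff (m * n) (p ^ n) (a ^ n)"
proof (induction n)
  case 0
  then show ?case by (simp add: top_coeff_def)
next
  case (Suc n)
  then show ?case using top_coeff_mult[of m p a "m * n" "p ^ n" "a ^ n"] by simp
qed

lemma top_coeff_shift_line:
  assumes "form n f"
  shows "top_coeff n (shift_line b0 b1 b2 f) (const3 (eval3 id b0 b1 b2 f))"
  using assms
proof (induction f rule: form_induct)
  case zero
  then show ?case by (simp add: top_coeff_def hom_0[OF is_hom_shift_line] hom_0[OF is_hom_eval3])
next
  case (add f g)
  then show ?case by (auto simp: top_coeff_def hom_add[OF is_hom_shift_line] hom_add[OF is_hom_eval3]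
        intro: degree_add_le)
next
  case (monom c i j l)
  have lin: "top_coeff 1 [:a, b:] b" for a b :: "'a poly3" by (simp add: top_coeff_def)
  have "top_coeff (0 + 1 * i + 1 * j + 1 * l) ([:const3 c:] * [:X, const3 b0:] ^ i * [:Y, const3 b1:] ^ j * [:Z, const3 b2:] ^ l)
     (const3 c * const3 b0 ^ i * const3 b1 ^ j * const3 b2 ^ l)"
    by (intro top_coeff_mult top_coeff_power lin) (simp add: top_coeff_def)
  moreover have "const3 c * const3 b0 ^ i * const3 b1 ^ j * const3 b2 ^ l = const3 (c * b0 ^ i * b1 ^ j * b2 ^ l)"
    by (simp only: hom_mult[OF is_hom_const3] hom_power[OF is_hom_const3])
  ultimately show ?case using monom
    by (simp add: shift_line_def eval3_monom del: mult_pCons_left)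
qed

text \<open>
  As \<open>b\<close> is not on the curve of \<open>h\<close>, the restriction of \<open>h\<close> to every line of direction \<open>b\<close> has the same
  constant leading coefficient \<open>h(b)\<close>. Hence division by \<open>h\<close> with remainder is possible on the generic
  line and specializes to all lines. The line of this direction through the origin is excluded, so
  the coefficients of the remainder are shown to vanish outside a plane that contains it.
\<close>

lemma form_dvd_if_on_lines:
  fixes h f :: "'k::alg_closed_field poly3"
  assumes "form n h" "eval3 id b0 b1 b2 h \<noteq> 0"
    and lines: "\<And>a0 a1 a2. (\<And>t. (a0 + t * b0, a1 + t * b1, a2 + t * b2) \<noteq> (0, 0, 0)) \<Longrightarrow>
      eval3 (\<lambda>c. [:c:]) [:a0, b0:] [:a1, b1:] [:a2, b2:] h dvd eval3 (\<lambda>c. [:c:]) [:a0, b0:] [:a1, b1:] [:a2, b2:] f"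
  shows "h dvd f"
proof -
  let ?H = "shift_line b0 b1 b2 h" and ?P = "shift_line b0 b1 b2 f"
  define e where "e = eval3 id b0 b1 b2 h"
  have top: "degree ?H \<le> n" "coeff ?H n = const3 e"
    using top_coeff_shift_line[OF assms(1), of b0 b1 b2] by (auto simp: top_coeff_def e_def)
  have "e \<noteq> 0" using assms(2) by (simp add: e_def)
  then have deg: "degree ?H = n" using top by (metis le_degree order_antisym pCons_eq_0_iff)
  have "?H \<noteq> 0" using top \<open>e \<noteq> 0\<close> by auto
  obtain q r where qr: "pseudo_divmod ?P ?H = (q, r)" by (cases "pseudo_divmod ?P ?H")
  define k where "k = Suc (degree ?P) - degree ?H"
  have div: "smult (const3 e ^ k) ?P = ?H * q + r" and r: "r = 0 \<or> degree r < n"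
    using pseudo_divmod[OF \<open>?H \<noteq> 0\<close> qr] top deg by (auto simp: k_def)
  have "r = 0"
  proof (rule ccontr)
    assume "r \<noteq> 0"
    \<comment> \<open>a plane through the origin that contains the direction \<open>b\<close>: lines of this direction outside it avoid the origin\<close>
    obtain l :: "'k poly3" where l: "l \<noteq> 0" "form 1 l" "eval3 id b0 b1 b2 l = 0"
    proof (cases "b0 = 0")
      case True
      show ?thesis by (rule that[of X]) (use True in \<open>auto simp: X_def[symmetric]\<close>, auto simp: X_def)
    next
      case False
      have "coeff3 (const3 b0 * Y - const3 b1 * X) 0 1 0 \<noteq> 0"
        using False by (simp add: Y_def X_def)
      then have "const3 b0 * Y - const3 b1 * X \<noteq> 0" by (metis coeff_0)
      then show ?thesis
        by (intro that[of "const3 b0 * Y - const3 b1 * X"])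
           (auto simp: form_diff form_cmult hom_simps[OF is_hom_eval3] simp del: mult_pCons_left)
    qed
    have "lead_coeff r * l \<noteq> 0" using \<open>r \<noteq> 0\<close> l by simp
    then obtain a0 a1 a2 where a: "eval3 id a0 a1 a2 (lead_coeff r * l) \<noteq> 0" by (rule poly3_nonvanishing)
    let ?ev = "eval3 id a0 a1 a2"
    have ev: "is_hom ?ev" by simp
    have s: "is_hom (map_poly ?ev)" by (rule is_hom_map_poly[OF ev])
    have spec: "map_poly ?ev (shift_line b0 b1 b2 g) = eval3 (\<lambda>c. [:c:]) [:a0, b0:] [:a1, b1:] [:a2, b2:] g" for g
    proof (rule hom_ext3[of "\<lambda>g. map_poly ?ev (shift_line b0 b1 b2 g)"])
      show "is_hom (\<lambda>g. map_poly ?ev (shift_line b0 b1 b2 g))" by (rule is_hom_comp[OF s is_hom_shift_line])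
    qed (simp_all add: shift_line_def map_poly_pCons hom_0)
    have "(a0 + t * b0, a1 + t * b1, a2 + t * b2) \<noteq> (0, 0, 0)" for t
    proof
      assume *: "(a0 + t * b0, a1 + t * b1, a2 + t * b2) = (0, 0, 0)"
      then have "a0 = (- t) * b0" "a1 = (- t) * b1" "a2 = (- t) * b2"
        by (simp_all add: eq_neg_iff_add_eq_0)
      then have "?ev l = (- t) ^ 1 * eval3 id b0 b1 b2 l"
        using eval3_form_scale[OF is_hom_id(2) l(2), of "- t" b0 b1 b2] by simp
      then show False using a l by (simp add: hom_mult[OF ev])
    qed
    then have "map_poly ?ev ?H dvd map_poly ?ev ?P" unfolding spec by (rule lines)
    moreover have "map_poly ?ev (smult (const3 e ^ k) ?P) = map_poly ?ev [:const3 e ^ k:] * map_poly ?ev ?P"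
      by (subst hom_mult[OF s, symmetric]) simp
    ultimately have "map_poly ?ev ?H dvd map_poly ?ev (?H * q + r)" using div by (metis dvd_mult)
    then have "map_poly ?ev ?H dvd map_poly ?ev r"
      by (simp add: hom_simps[OF s] dvd_add_right_iff)
    moreover have "map_poly ?ev r \<noteq> 0"
    proof
      assume "map_poly ?ev r = 0"
      then have "?ev (lead_coeff r) = 0" by (metis coeff_map_poly hom_0[OF ev] coeff_0)
      then show False using a by (simp add: hom_mult[OF ev])
    qed
    ultimately have "degree (map_poly ?ev ?H) \<le> degree (map_poly ?ev r)"
      by (rule dvd_imp_degree_le)
    also have "\<dots> \<le> degree r" by (rule map_poly_degree_leq)
    also have "\<dots> < n" using r \<open>r \<noteq> 0\<close> by simp
    also have "n \<le> degree (map_poly ?ev ?H)"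
      using top \<open>e \<noteq> 0\<close> by (intro le_degree) (simp add: coeff_map_poly hom_0)
    finally show False by simp
  qed
  then have "poly (smult (const3 e ^ k) ?P) 0 = poly (?H * q) 0" using div by simp
  then have "const3 e ^ k * f = h * poly q 0" by (simp add: shift_line_at_0)
  then have "h dvd const3 e ^ k * f" by simp
  moreover have "const3 e ^ k dvd 1" using \<open>e \<noteq> 0\<close> by (simp add: is_unit_power_iff is_unit_const_poly_iff dvd_field_iff)
  ultimately show ?thesis by (metis dvd_mult_unit_iff')
qed


section \<open>Forms of degree \<open>d\<close> passing virtually through the base points of a Cremona map\<close>

lemma linear_formE:
  assumes "form 1 w"
  obtains a b c where "w = const3 a * X + const3 b * Y + const3 c * Z"
proof -
  have "\<exists>a b c. w = const3 a * X + const3 b * Y + const3 c * Z"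
    using assms
  proof (induction w rule: form_induct)
    case zero
    show ?case by (intro exI[of _ 0]) simp
  next
    case (add f g)
    then obtain a b c a' b' c' where f: "f = const3 a * X + const3 b * Y + const3 c * Z"
      and g: "g = const3 a' * X + const3 b' * Y + const3 c' * Z" by blast
    have "f + g = const3 (a + a') * X + const3 (b + b') * Y + const3 (c + c') * Z"
      unfolding f g by (simp only: hom_add[OF is_hom_const3] algebra_simps)
    then show ?case by blast
  next
    case (monom e i j l)
    then consider "i = 1" "j = 0" "l = 0" | "i = 0" "j = 1" "l = 0" | "i = 0" "j = 0" "l = 1"
      by linarith
    then show ?case
    proof cases
      case 1
      then have "monom3 e i j l = const3 e * X + const3 0 * Y + const3 0 * Z" by (simp add: monom3_eq)
      then show ?thesis by blast
    next
      case 2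
      then have "monom3 e i j l = const3 0 * X + const3 e * Y + const3 0 * Z" by (simp add: monom3_eq)
      then show ?thesis by blast
    next
      case 3
      then have "monom3 e i j l = const3 0 * X + const3 0 * Y + const3 e * Z" by (simp add: monom3_eq)
      then show ?thesis by blast
    qed
  qed
  then show ?thesis using that by blast
qed

lemma fps_common_power:
  fixes c0 c1 c2 :: "'k::field fps"
  assumes "c0 \<noteq> 0 \<or> c1 \<noteq> 0 \<or> c2 \<noteq> 0"
  obtains s e0 e1 e2 where "s \<noteq> 0" "c0 = s * e0" "c1 = s * e1" "c2 = s * e2"
    "fps_nth e0 0 \<noteq> 0 \<or> fps_nth e1 0 \<noteq> 0 \<or> fps_nth e2 0 \<noteq> 0"
proof -
  let ?C = "{c0, c1, c2} - {0}"
  obtain c where "c \<in> ?C" using assms by blast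
  then obtain s where s: "s \<in> ?C" "\<And>c. c \<in> ?C \<Longrightarrow> subdegree s \<le> subdegree c"
    using ex_has_least_nat[of "\<lambda>c. c \<in> ?C" c subdegree] by blast
  have "s dvd c" if "c \<in> {c0, c1, c2}" for c
  proof (cases "c = 0")
    case False
    then show ?thesis using s that by (auto simp: fps_dvd_iff)
  qed simp
  then have "s dvd c0" "s dvd c1" "s dvd c2" by simp_all
  then obtain e0 e1 e2 where e: "c0 = s * e0" "c1 = s * e1" "c2 = s * e2" by (metis dvdE)
  have "s \<noteq> 0" using s by auto
  have "s = s * e0 \<or> s = s * e1 \<or> s = s * e2" using s(1) e by auto
  then have "e0 = 1 \<or> e1 = 1 \<or> e2 = 1" using \<open>s \<noteq> 0\<close> by auto
  then show ?thesis using that[OF \<open>s \<noteq> 0\<close> e] by auto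
qed

lemma graded_part_base_ideal_iff:
  assumes "form d f0" "form d f1" "form d f2"
  shows "g \<in> graded_part (ideal_gen {f0, f1, f2}) d \<longleftrightarrow>
    (\<exists>a b c. g = const3 a * f0 + const3 b * f1 + const3 c * f2)"
proof
  assume "\<exists>a b c. g = const3 a * f0 + const3 b * f1 + const3 c * f2"
  then obtain a b c where g: "g = const3 a * f0 + const3 b * f1 + const3 c * f2" by blast
  have "g \<in> ideal_gen {f0, f1, f2}" unfolding g ideal_gen_three by blast
  moreover have "form d g" unfolding g by (intro form_add form_cmult assms)
  ultimately show "g \<in> graded_part (ideal_gen {f0, f1, f2}) d" by (simp add: graded_part_def)
next
  assume g: "g \<in> graded_part (ideal_gen {f0, f1, f2}) d"
  show "\<exists>a b c. g = const3 a * f0 + const3 b * f1 + const3 c * f2"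
  proof (cases "g = 0")
    case True
    then show ?thesis by (intro exI[of _ 0]) simp
  next
    case False
    then obtain a b c where "form 0 a" "form 0 b" "form 0 c" "g = a * f0 + b * f1 + c * f2"
      using homogeneous_part_of_ideal[OF assms, of d g] g by (auto simp: graded_part_def)
    then show ?thesis using form_0_const by metis
  qed
qed

lemma base_ideal_system_three:
  fixes f0 f1 f2 :: "'k::alg_closed_field poly3"
  assumes "form d f0" "form d f1" "form d f2" "\<exists>f\<in>{f0, f1, f2}. f \<noteq> 0"
  shows "base_ideal_system (ideal_gen {f0, f1, f2}) d"
proof
  let ?I = "ideal_gen {f0, f1, f2}"
  have f: "f0 \<in> ?I" "f1 \<in> ?I" "f2 \<in> ?I" by (auto intro: ideal_gen_base)
  then have "{f0, f1, f2} \<subseteq> graded_part ?I d" using assms by (auto simp: graded_part_def)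
  then have "?I \<subseteq> ideal_gen (graded_part ?I d)"
    using ideal_gen_base by (intro ideal_gen_minimal) auto
  moreover have "ideal_gen (graded_part ?I d) \<subseteq> ?I"
    by (intro ideal_gen_minimal) (auto simp: graded_part_def)
  ultimately show "?I = ideal_gen (graded_part ?I d)" by blast
  show "\<exists>f\<in>?I. f \<noteq> 0" using f assms(4) by blast
qed

lemma represents_identityE:
  assumes "represents_identity (a, b, c)"
  obtains h where "h \<noteq> 0" "a = h * X" "b = h * Y" "c = h * Z"
  using assms unfolding represents_identity_def by blast

lemma form_of_multiple_of_X:
  assumes "form m (h * X)" "h \<noteq> 0"
  obtains n where "m = Suc n" "form n h"
proof -
  have X: "(X :: 'a poly3) \<noteq> 0" by (simp add: X_def)
  have shift: "hpart n h * X = hpart (Suc n) (h * X)" for n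
    using hpart_mult_form[OF form_X, of "Suc n" h] by simp
  obtain n where n: "hpart n h \<noteq> 0" using sum_hpart[of h] assms(2) by (metis sum.neutral)
  then have "hpart (Suc n) (h * X) \<noteq> 0" using shift[of n] X by (metis mult_eq_0_iff)
  then have m: "m = Suc n" using hpart_form[OF assms(1), of "Suc n"] by (auto split: if_splits)
  then have "hpart n h * X = h * X" using shift[of n] hpart_form[OF assms(1), of "Suc n"] by simp
  then have "hpart n h = h" using X by simp
  then show ?thesis using that[OF m] form_hpart[of n h] by simp
qed

text \<open>
  With the inverse map \<open>G\<close> one has \<open>f\<^sub>i(G) = h x\<^sub>i\<close>, and the claim reduces to \<open>h dvd f(G)\<close>. Along a germ of a
  line away from the origin one of the coordinates \<open>x\<^sub>i\<close> is a unit, so that \<open>h\<close> has the minimal order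
  among the members of the net composed with \<open>G\<close>.
\<close>

theorem virtual_forms_of_degree_d:
  fixes f0 f1 f2 :: "'k::alg_closed_field poly3"
  assumes cremona: "cremona d (f0, f1, f2)" and d: "d > 0"
  defines "I \<equiv> ideal_gen {f0, f1, f2}"
  assumes f: "form d f" "passes_virtually (base_points I d, base_mult (graded_part I d)) f"
  shows "f \<in> I"
proof -
  obtain e g0 g1 g2 where F: "form d f0" "form d f1" "form d f2"
    and G: "form e g0" "form e g1" "form e g2"
    and GF: "represents_identity (compose (g0, g1, g2) (f0, f1, f2))"
    and FG: "represents_identity (compose (f0, f1, f2) (g0, g1, g2))"
    using cremona unfolding cremona_def by auto
  let ?\<phi> = "eval3 const3 g0 g1 g2" and ?\<psi> = "eval3 const3 f0 f1 f2"
  obtain h where h: "h \<noteq> 0" "?\<phi> f0 = h * X" "?\<phi> f1 = h * Y" "?\<phi> f2 = h * Z"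
    using FG by (auto elim: represents_identityE)
  obtain h' where h': "h' \<noteq> 0" "?\<psi> g0 = h' * X" "?\<psi> g1 = h' * Y" "?\<psi> g2 = h' * Z"
    using GF by (auto elim: represents_identityE)
  have "f0 \<noteq> 0" using h by (auto simp: hom_0[OF is_hom_eval3] X_def)
  then interpret base_ideal_system I d
    unfolding I_def using F by (intro base_ideal_system_three) auto
  have LI: "g \<in> L \<longleftrightarrow> (\<exists>a b c. g = const3 a * f0 + const3 b * f1 + const3 c * f2)" for g
    unfolding I_def using graded_part_base_ideal_iff[OF F] .
  have \<phi>_form: "form (d * e) (?\<phi> g)" if "form d g" for g using form_eval3[OF that G] .
  obtain n where n: "d * e = Suc n" "form n h"
    using form_of_multiple_of_X[of "d * e" h] \<phi>_form[OF F(1)] h by auto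
  obtain b0 b1 b2 where b: "eval3 id b0 b1 b2 h \<noteq> 0" using h(1) by (rule poly3_nonvanishing)
  have "h dvd ?\<phi> f"
  proof (rule form_dvd_if_on_lines[OF n(2) b])
    fix a0 a1 a2 assume a: "\<And>t. (a0 + t * b0, a1 + t * b1, a2 + t * b2) \<noteq> (0, 0, 0)"
    let ?line = "eval3 (\<lambda>c. [:c:]) [:a0, b0:] [:a1, b1:] [:a2, b2:]"
    
    show "?line h dvd ?line (?\<phi> f)"
    proof (cases "?line (?\<phi> f) = 0")
      case False
      have line_h: "?line h \<noteq> 0"
      proof
        assume *: "?line h = 0"
        have "map_poly (eval3 id a0 a1 a2) (shift_line b0 b1 b2 h) = ?line h"
        proof (rule hom_ext3[of "\<lambda>g. map_poly (eval3 id a0 a1 a2) (shift_line b0 b1 b2 g)"])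
          show "is_hom (\<lambda>g. map_poly (eval3 id a0 a1 a2) (shift_line b0 b1 b2 g))"
            by (rule is_hom_comp[OF is_hom_map_poly is_hom_shift_line]) simp
        qed (simp_all add: shift_line_def map_poly_pCons hom_0)
        then have "coeff (map_poly (eval3 id a0 a1 a2) (shift_line b0 b1 b2 h)) n = 0" using * by simp
        then show False using top_coeff_shift_line[OF n(2), of b0 b1 b2] b
          by (simp add: coeff_map_poly hom_0 top_coeff_def)
      qed
      have "order r (?line h) \<le> order r (?line (?\<phi> f))" for r
      proof -
        \<comment> \<open>the germ at parameter \<open>r\<close> of the line, with \<open>?A\<close> the restriction of polynomials to it and \<open>?c0, ?c1, ?c2\<close> its image under \<open>G\<close>\<close>
        let ?\<alpha> = "\<lambda>a b. fps_const (a + r * b) + fps_const b * fps_X"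
        let ?A = "eval3 fps_const (?\<alpha> a0 b0) (?\<alpha> a1 b1) (?\<alpha> a2 b2)"
        have A: "is_hom ?A" by simp
        have ex: "expand_at r [:a, b:] = ?\<alpha> a b" for a b
          by (simp add: expand_at_pCons hom_0[OF is_hom_expand_at] algebra_simps fps_const_add[symmetric] fps_const_mult[symmetric] del: fps_const_add fps_const_mult)
        have ex': "expand_at r [:c:] = fps_const c" for c
          by (simp add: expand_at_pCons hom_0[OF is_hom_expand_at])
        have exA: "expand_at r (?line g) = ?A g" for g
          by (subst hom_eval3[OF is_hom_expand_at is_hom_pCons]) (simp only: ex ex')
        have Ah: "?A h \<noteq> 0" using exA[of "h"] subdegree_expand_at(1)[OF line_h] by metis
        let ?c0 = "?A g0" and ?c1 = "?A g1" and ?c2 = "?A g2"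
        have comp: "?A (?\<phi> g) = eval3 fps_const ?c0 ?c1 ?c2 g" for g
          by (subst hom_eval3[OF A is_hom_const3]) simp
        have fc: "eval3 fps_const ?c0 ?c1 ?c2 f0 = ?A h * ?\<alpha> a0 b0" "eval3 fps_const ?c0 ?c1 ?c2 f1 = ?A h * ?\<alpha> a1 b1"
           "eval3 fps_const ?c0 ?c1 ?c2 f2 = ?A h * ?\<alpha> a2 b2"
          unfolding comp[symmetric] h(2-4) hom_mult[OF A] by simp_all
        have "?\<alpha> a0 b0 \<noteq> 0 \<or> ?\<alpha> a1 b1 \<noteq> 0 \<or> ?\<alpha> a2 b2 \<noteq> 0"
        proof -
          have "fps_nth (?\<alpha> a b) 0 = a + r * b" for a b by simp
          then show ?thesis using a[of r] by (metis fps_zero_nth)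
        qed
        then have "\<exists>g\<in>{f0, f1, f2}. eval3 fps_const ?c0 ?c1 ?c2 g \<noteq> 0"
          using fc Ah by auto
        then obtain fi where fi: "fi \<in> {f0, f1, f2}" "eval3 fps_const ?c0 ?c1 ?c2 fi \<noteq> 0" by blast
        then have fiL: "fi \<in> L" using F ideal_gen_base[of fi "{f0, f1, f2}"] by (auto simp: graded_part_def I_def)
        have "?c0 \<noteq> 0 \<or> ?c1 \<noteq> 0 \<or> ?c2 \<noteq> 0"
        proof (rule ccontr)
          assume "\<not> ?thesis"
          then have "eval3 fps_const ?c0 ?c1 ?c2 fi = 0"
            using eval3_form_scale[OF is_hom_fps_const form_L[OF fiL], of 0 0 0 0]
            by (simp add: zero_power[OF d])
          with fi show False by simp
        qed
        then obtain s e0 e1 e2 where s: "s \<noteq> 0" "?c0 = s * e0" "?c1 = s * e1" "?c2 = s * e2"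
          and e: "fps_nth e0 0 \<noteq> 0 \<or> fps_nth e1 0 \<noteq> 0 \<or> fps_nth e2 0 \<noteq> 0"
          by (rule fps_common_power)
        have scale: "eval3 fps_const ?c0 ?c1 ?c2 g = s ^ d * eval3 fps_const e0 e1 e2 g" if "form d g" for g
          unfolding s(2-4) by (rule eval3_form_scale[OF is_hom_fps_const that])
        have "eval3 fps_const e0 e1 e2 fi \<noteq> 0" using fi(2) scale[OF form_L[OF fiL]] by auto
        then obtain g where g: "g \<in> L" "eval3 fps_const e0 e1 e2 g dvd eval3 fps_const e0 e1 e2 f"
          using order_along_arc[OF f(1) f(2) e fiL] by blast
        then have dvd: "eval3 fps_const ?c0 ?c1 ?c2 g dvd eval3 fps_const ?c0 ?c1 ?c2 f"
          unfolding scale[OF form_L[OF g(1)]] scale[OF f(1)] by (intro mult_dvd_mono dvd_refl)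
        obtain x y z where g_eq: "g = const3 x * f0 + const3 y * f1 + const3 z * f2" using g(1) LI by blast
        have "?A h dvd eval3 fps_const ?c0 ?c1 ?c2 g"
          unfolding g_eq hom_simps[OF is_hom_eval3[OF is_hom_fps_const]] fc by (simp add: dvd_add)
        then have "?A h dvd ?A (?\<phi> f)" using dvd unfolding comp by (rule dvd_trans)
        then have "expand_at r (?line h) dvd expand_at r (?line (?\<phi> f))" by (simp only: exA)
        then have "subdegree (expand_at r (?line h)) \<le> subdegree (expand_at r (?line (?\<phi> f)))"
          by (rule dvd_imp_subdegree_le[OF _ subdegree_expand_at(1)[OF False]])
        then show ?thesis
          by (simp only: subdegree_expand_at(2)[OF False] subdegree_expand_at(2)[OF line_h])
      qed
      then show ?thesis using line_h False by (intro dvd_if_order_le)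
    qed simp
  qed
  then obtain w where "?\<phi> f = w * h" by (metis dvdE mult.commute)
  then have "?\<phi> f = hpart (Suc n) (w * h)"
    using \<phi>_form[OF f(1)] n(1) by (simp add: hpart_form)
  also have "\<dots> = hpart 1 w * h" using n(2) by (simp add: hpart_mult_form)
  finally have \<phi>f: "?\<phi> f = hpart 1 w * h" .
  obtain x y z where w: "hpart 1 w = const3 x * X + const3 y * Y + const3 z * Z"
    using linear_formE[OF form_hpart] .
  \<comment> \<open>\<open>D\<close> vanishes on the image of \<open>G\<close>, which is dense because \<open>F\<close> is the inverse of \<open>G\<close> as a rational map\<close>
  define D where "D = f - (const3 x * f0 + const3 y * f1 + const3 z * f2)"
  have D: "form d D" unfolding D_def by (intro form_diff form_add form_cmult F f)
  have "?\<phi> D = 0"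
    unfolding D_def hom_simps[OF is_hom_eval3[OF is_hom_const3]] \<phi>f w h(2-4)
    by (simp add: algebra_simps del: mult_pCons_left)
  then have "?\<psi> (?\<phi> D) = 0" by (simp add: hom_0)
  also have "?\<psi> (?\<phi> D) = eval3 const3 (h' * X) (h' * Y) (h' * Z) D"
    using hom_eval3[OF is_hom_eval3[OF is_hom_const3] is_hom_const3, of f0 f1 f2 g0 g1 g2 D] h'
    by simp
  also have "\<dots> = h' ^ d * eval3 const3 X Y Z D" by (rule eval3_form_scale[OF is_hom_const3 D])
  also have "eval3 const3 X Y Z D = D" using hom_eq_eval3[of "\<lambda>f. f" D] by simp
  finally have "D = 0" using h' by simp
  then have "f \<in> L" unfolding LI D_def by auto
  then show ?thesis by (simp add: graded_part_def)
qed

section \<open>Integral elements from a faithful finite module\<close>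

text \<open>
  Polynomials that are homogeneous of degree \<open>s\<close> if the indeterminate has weight \<open>1\<close> and the elements
  of \<open>J ^ i\<close> have weight \<open>i\<close>. A monic one with root \<open>f\<close> is an equation of integral dependence.
\<close>

definition rees_polys :: "'a::comm_ring_1 set \<Rightarrow> nat \<Rightarrow> 'a poly set" where
  "rees_polys J s = {P. degree P \<le> s \<and> (\<forall>j\<le>s. coeff P j \<in> ideal_pow J (s - j))}"

lemma rees_polys_add: "P \<in> rees_polys J s \<Longrightarrow> Q \<in> rees_polys J s \<Longrightarrow> P + Q \<in> rees_polys J s"
  by (auto simp: rees_polys_def ideal_add degree_add_le)

lemma rees_polys_diff: "P \<in> rees_polys J s \<Longrightarrow> Q \<in> rees_polys J s \<Longrightarrow> P - Q \<in> rees_polys J s"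
  by (auto simp: rees_polys_def ideal_diff degree_diff_le)

lemma rees_polys_mult:
  assumes "P \<in> rees_polys J s" "Q \<in> rees_polys J t"
  shows "P * Q \<in> rees_polys J (s + t)"
  unfolding rees_polys_def
proof (intro CollectI conjI allI impI)
  show "degree (P * Q) \<le> s + t"
    using assms degree_mult_le[of P Q] by (auto simp: rees_polys_def)
  fix j assume j: "j \<le> s + t"
  have "coeff P i * coeff Q (j - i) \<in> ideal_pow J (s + t - j)" if "i \<le> j" for i
  proof (cases "i \<le> s \<and> j - i \<le> t")
    case True
    then have "coeff P i * coeff Q (j - i) \<in> ideal_pow J ((s - i) + (t - (j - i)))"
      using assms by (intro ideal_pow_mult) (auto simp: rees_polys_def)
    also have "(s - i) + (t - (j - i)) = s + t - j" using True that by auto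
    finally show ?thesis .
  next
    case False
    then have "coeff P i = 0 \<or> coeff Q (j - i) = 0"
      using assms by (auto simp: rees_polys_def coeff_eq_0)
    then show ?thesis by (auto simp: ideal_0)
  qed
  then show "coeff (P * Q) j \<in> ideal_pow J (s + t - j)"
    by (auto simp: coeff_mult intro!: ideal_sum)
qed

lemma coeff_rees_polys_mult:
  assumes "P \<in> rees_polys J s" "Q \<in> rees_polys J t"
  shows "coeff (P * Q) (s + t) = coeff P s * coeff Q t"
  using top_coeff_mult[of s P "coeff P s" t Q "coeff Q t"] assms by (auto simp: top_coeff_def rees_polys_def)

lemma integral_closure_if_rees_root:
  assumes P: "P \<in> rees_polys J s" "coeff P s = 1" "poly P f = 0" and s: "s \<ge> 1"
  shows "f \<in> integral_closure J"
proof -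
  have deg: "degree P = s" using P by (intro order_antisym le_degree) (auto simp: rees_polys_def)
  have "(\<Sum>j\<le>s. coeff P j * f ^ j) = (\<Sum>i\<le>s. coeff P (s - i) * f ^ (s - i))"
    by (rule sum.reindex_bij_witness[of _ "\<lambda>i. s - i" "\<lambda>i. s - i"]) auto
  also have "\<dots> = f ^ s + (\<Sum>i=1..s. coeff P (s - i) * f ^ (s - i))"
  proof -
    have "{..s} = insert 0 {1..s}" by auto
    then show ?thesis using P(2) by simp
  qed
  finally have "f ^ s + (\<Sum>i=1..s. coeff P (s - i) * f ^ (s - i)) = 0"
    using P(3) by (simp add: poly_altdef deg)
  moreover have "coeff P (s - i) \<in> ideal_pow J i" if "i \<in> {1..s}" for i
  proof -
    have "coeff P (s - i) \<in> ideal_pow J (s - (s - i))" using P(1) by (simp add: rees_polys_def)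
    then show ?thesis using that by simp
  qed
  ultimately show ?thesis using s unfolding integral_closure_def
    by (intro CollectI exI[of _ s] conjI exI[of _ "\<lambda>i. coeff P (s - i)"]) auto
qed

text \<open>
  A homogeneous linear system \<open>D v = N v\<close> with \<open>D\<close> diagonal and monic of degree \<open>s\<close> in \<open>f\<close> and the entries
  of \<open>N\<close> of lower degree. Multiplying the equations by the pivot \<open>?P\<close> and substituting eliminates one
  unknown and doubles \<open>s\<close>, while the shape of the system is preserved. With a single unknown \<open>v c\<close> left,
  its coefficient must vanish.
\<close>

lemma rees_elimination:
  fixes f :: "'a::idom" and v :: "'b \<Rightarrow> 'a"
  assumes "finite A" "A \<noteq> {}" "s \<ge> 1" "\<And>a. a \<in> A \<Longrightarrow> v a \<noteq> 0"
    and "\<And>a. a \<in> A \<Longrightarrow> D a \<in> rees_polys J s \<and> coeff (D a) s = 1"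
    and "\<And>a b. a \<in> A \<Longrightarrow> b \<in> A \<Longrightarrow> N a b \<in> rees_polys J s \<and> coeff (N a b) s = 0"
    and "\<And>a. a \<in> A \<Longrightarrow> poly (D a) f * v a = (\<Sum>b\<in>A. poly (N a b) f * v b)"
  shows "f \<in> integral_closure J"
  using assms
proof (induction A arbitrary: s D N rule: finite_ne_induct)
  case (singleton c)
  let ?P = "D c - N c c"
  have "poly ?P f * v c = 0" using singleton.prems(5)[of c] by (simp add: algebra_simps)
  then have "poly ?P f = 0" using singleton.prems by auto
  moreover have "?P \<in> rees_polys J s" "coeff ?P s = 1"
    using singleton.prems by (auto intro: rees_polys_diff)
  ultimately show ?case using integral_closure_if_rees_root[of ?P J s f] singleton.prems(1) by (simp only:)
next
  case (insert c A)
  let ?P = "D c - N c c"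
  let ?D = "\<lambda>a. ?P * D a" and ?N = "\<lambda>a b. ?P * N a b + N a c * N c b"
  have P: "?P \<in> rees_polys J s" "coeff ?P s = 1"
    using insert.prems by (auto intro: rees_polys_diff)
  have pivot: "poly ?P f * v c = (\<Sum>b\<in>A. poly (N c b) f * v b)"
    using insert.prems(5)[of c] insert.hyps by (simp add: algebra_simps)
  show ?case
  proof (rule insert.IH[of "s + s" ?D ?N])
    show "?D a \<in> rees_polys J (s + s) \<and> coeff (?D a) (s + s) = 1" if "a \<in> A" for a
    proof -
      have a: "D a \<in> rees_polys J s" "coeff (D a) s = 1" using insert.prems(3)[of a] that by auto
      show ?thesis using rees_polys_mult[OF P(1) a(1)]
        unfolding coeff_rees_polys_mult[OF P(1) a(1)] P(2) a(2) by simp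
    qed
    show "?N a b \<in> rees_polys J (s + s) \<and> coeff (?N a b) (s + s) = 0" if "a \<in> A" "b \<in> A" for a b
    proof -
      have ab: "N a b \<in> rees_polys J s" "coeff (N a b) s = 0" and ac: "N a c \<in> rees_polys J s" "coeff (N a c) s = 0"
        and cb: "N c b \<in> rees_polys J s" using insert.prems(4) that by auto
      show ?thesis using rees_polys_add[OF rees_polys_mult[OF P(1) ab(1)] rees_polys_mult[OF ac(1) cb]]
        unfolding coeff_add coeff_rees_polys_mult[OF P(1) ab(1)] coeff_rees_polys_mult[OF ac(1) cb] ab(2) ac(2) by simp
    qed
    show "poly (?D a) f * v a = (\<Sum>b\<in>A. poly (?N a b) f * v b)" if "a \<in> A" for a
    proof -
      have "poly (?D a) f * v a = poly ?P f * (poly (N a c) f * v c + (\<Sum>b\<in>A. poly (N a b) f * v b))"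
        using insert.prems(5)[of a] insert.hyps that by (simp add: mult.assoc)
      also have "\<dots> = poly (N a c) f * (poly ?P f * v c) + poly ?P f * (\<Sum>b\<in>A. poly (N a b) f * v b)"
        by (simp only: distrib_left mult.left_commute)
      also have "\<dots> = (\<Sum>b\<in>A. poly (?N a b) f * v b)"
        unfolding pivot sum_distrib_left sum.distrib[symmetric]
        by (intro sum.cong refl) (simp add: algebra_simps)
      finally show ?thesis .
    qed
  qed (use insert.prems in auto)
qed

text \<open>
  The determinant trick, with the determinant replaced by elimination: the equations
  \<open>f v\<^sub>a = \<Sum> c\<^sub>a\<^sub>b v\<^sub>b\<close> form a homogeneous system as above with \<open>s = 1\<close>.
\<close>

lemma integral_if_stabilizes:
  fixes f :: "'a::idom" and v :: "'b \<Rightarrow> 'a"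
  assumes "finite A" "A \<noteq> {}" "\<And>a. a \<in> A \<Longrightarrow> v a \<noteq> 0"
    and "\<And>a. a \<in> A \<Longrightarrow> \<exists>c. (\<forall>b\<in>A. c b \<in> J) \<and> f * v a = (\<Sum>b\<in>A. c b * v b)"
  shows "f \<in> integral_closure J"
proof -
  obtain c where c: "\<And>a b. a \<in> A \<Longrightarrow> b \<in> A \<Longrightarrow> c a b \<in> J"
    "\<And>a. a \<in> A \<Longrightarrow> f * v a = (\<Sum>b\<in>A. c a b * v b)"
    using bchoice[of A "\<lambda>a c. (\<forall>b\<in>A. c b \<in> J) \<and> f * v a = (\<Sum>b\<in>A. c b * v b)"] assms(4) by blast
  show ?thesis
  proof (rule rees_elimination[where s = 1 and D = "\<lambda>_. [:0, 1:]" and N = "\<lambda>a b. [:c a b:]", OF assms(1,2)])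
    show "[:0, 1:] \<in> rees_polys J 1 \<and> coeff [:0, 1:] 1 = (1::'a)"
      by (auto simp: rees_polys_def ideal_0 le_Suc_eq coeff_pCons)
    show "[:c a b:] \<in> rees_polys J 1 \<and> coeff [:c a b:] 1 = 0" if "a \<in> A" "b \<in> A" for a b
      using ideal_pow_1I[OF c(1)[OF that]] by (auto simp: rees_polys_def le_Suc_eq coeff_pCons ideal_0)
  qed (use assms c in auto)
qed


section \<open>The saturation\<close>

definition exponents :: "nat \<Rightarrow> (nat \<times> nat \<times> nat) set" where
  "exponents n = {(i, j, l). i + j + l = n}"

fun monomial :: "nat \<times> nat \<times> nat \<Rightarrow> 'k::field poly3" where
  "monomial (i, j, l) = monom3 1 i j l"

lemma finite_exponents [simp]: "finite (exponents n)"
  by (rule finite_subset[of _ "{..n} \<times> {..n} \<times> {..n}"]) (auto simp: exponents_def)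

lemma exponents_nonempty: "exponents n \<noteq> {}"
proof -
  have "(n, 0, 0) \<in> exponents n" by (simp add: exponents_def)
  then show ?thesis by blast
qed

lemma monomial_nonzero: "monomial a \<noteq> 0"
  by (cases a) (simp add: monom_eq_0_iff)

lemma form_monomial: "a \<in> exponents n \<Longrightarrow> form n (monomial a)"
  using form_monom3 by (auto simp: exponents_def)

lemma monomial_in_power: "a \<in> exponents n \<Longrightarrow> monomial a \<in> ideal_pow (ideal_gen {X, Y, Z}) n"
proof (cases a)
  case (fields i j l)
  assume "a \<in> exponents n"
  then have n: "n = i + j + l" by (simp add: fields exponents_def)
  have "monomial a = X ^ i * Y ^ j * Z ^ l" by (simp add: fields monom3_eq one_pCons[symmetric])
  also have "\<dots> \<in> ideal_pow (ideal_gen {X, Y, Z}) n"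
    unfolding n by (intro ideal_pow_mult power_in_ideal_pow ideal_gen_base) auto
  finally show ?thesis .
qed

definition monomial_span :: "nat \<Rightarrow> 'k::field poly3 set \<Rightarrow> 'k poly3 set" where
  "monomial_span n J = {\<Sum>a\<in>exponents n. c a * monomial a | c. \<forall>a\<in>exponents n. c a \<in> J}"

lemma monomial_span_add:
  assumes "is_ideal J" "f \<in> monomial_span n J" "g \<in> monomial_span n J"
  shows "f + g \<in> monomial_span n J"
proof -
  obtain c c' where "f = (\<Sum>a\<in>exponents n. c a * monomial a)" "\<forall>a\<in>exponents n. c a \<in> J"
    "g = (\<Sum>a\<in>exponents n. c' a * monomial a)" "\<forall>a\<in>exponents n. c' a \<in> J"
    using assms by (auto simp: monomial_span_def)
  then have "f + g = (\<Sum>a\<in>exponents n. (c a + c' a) * monomial a) \<and> (\<forall>a\<in>exponents n. c a + c' a \<in> J)"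
    using assms(1) by (auto simp: sum.distrib distrib_right intro: ideal_add)
  then show ?thesis unfolding monomial_span_def by (intro CollectI exI[of _ "\<lambda>a. c a + c' a"])
qed

lemma monomial_span_base:
  assumes "is_ideal J" "x \<in> J" "a \<in> exponents n"
  shows "x * monomial a \<in> monomial_span n J"
proof -
  have "x * monomial a = (\<Sum>b\<in>exponents n. (if b = a then x else 0) * monomial b)"
    using assms(3) by (simp add: if_distribR sum.delta if_distrib[of "\<lambda>x. x * _"] cong: if_cong)
  moreover have "\<forall>b\<in>exponents n. (if b = a then x else 0) \<in> J" using assms by (auto simp: ideal_0)
  ultimately show ?thesis unfolding monomial_span_def
    by (intro CollectI exI[of _ "\<lambda>b. if b = a then x else 0"]) auto
qed

lemma monomial_span_0: "is_ideal J \<Longrightarrow> 0 \<in> monomial_span n J"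
proof -
  assume J: "is_ideal J"
  obtain a where "a \<in> exponents n" using exponents_nonempty by blast
  then show ?thesis using monomial_span_base[OF J ideal_0[OF J], of a n] by simp
qed

text \<open>
  A monomial of degree at least \<open>n\<close> is a multiple of one of degree \<open>n\<close>.
\<close>

lemma form_mult_in_monomial_span:
  assumes "is_ideal J" "x \<in> J" "form m r" "n \<le> m"
  shows "r * x \<in> monomial_span n J"
  using assms(3)
proof (induction r rule: form_induct)
  case zero
  then show ?case using assms by (simp add: monomial_span_0)
next
  case (add f g)
  then show ?case using monomial_span_add[OF assms(1)] by (simp add: distrib_right)
next
  case (monom c i j l)
  define i' j' where "i' = min i n" and "j' = min j (n - i')"
  define l' where "l' = n - i' - j'"
  have le: "i' \<le> i" "j' \<le> j" "l' \<le> l" "i' + j' + l' = n"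
    using monom assms(4) by (auto simp: i'_def j'_def l'_def)
  have "monom3 c i j l = monom3 c (i - i') (j - j') (l - l') * monomial (i', j', l')"
    using le by (simp add: mult_monom)
  then have "monom3 c i j l * x = (monom3 c (i - i') (j - j') (l - l') * x) * monomial (i', j', l')"
    by (simp only: mult_ac)
  also have "\<dots> \<in> monomial_span n J"
    using le assms by (intro monomial_span_base ideal_mult) (auto simp: exponents_def)
  finally show ?case .
qed

context
  fixes f0 f1 f2 :: "'k::alg_closed_field poly3" and d :: nat
  assumes F: "form d f0" "form d f1" "form d f2"
begin

abbreviation "I\<^sub>F \<equiv> ideal_gen {f0, f1, f2}"

lemma gens_in: "f0 \<in> I\<^sub>F" "f1 \<in> I\<^sub>F" "f2 \<in> I\<^sub>F"
  by (auto intro: ideal_gen_base)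

lemma hpart_ideal:
  assumes "f \<in> I\<^sub>F"
  obtains a b c where "\<And>m. hpart m f = (if m < d then 0 else hpart (m - d) a * f0 + hpart (m - d) b * f1 + hpart (m - d) c * f2)"
proof -
  obtain a b c where "f = a * f0 + b * f1 + c * f2" using assms by (auto simp: ideal_gen_three)
  then show ?thesis using F by (intro that[of a b c]) (simp add: hpart_add hpart_mult_form)
qed

lemma hpart_in_ideal: "f \<in> I\<^sub>F \<Longrightarrow> hpart m f \<in> I\<^sub>F"
  by (rule hpart_ideal[of f]) (auto intro!: ideal_add[OF is_ideal_gen] ideal_mult[OF is_ideal_gen] gens_in ideal_0)

text \<open>
  As \<open>I\<close> is generated in degree \<open>d\<close>, a part of degree at least \<open>n + d\<close> has coefficients of degree at least
  \<open>n\<close> with respect to the generators: \<open>I \<inter> m\<^sup>n\<^sup>+\<^sup>d = m\<^sup>n I\<close> for the irrelevant ideal \<open>m\<close>.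
\<close>

lemma in_monomial_span:
  assumes "f \<in> I\<^sub>F" "\<And>m. m < n + d \<Longrightarrow> hpart m f = 0"
  shows "f \<in> monomial_span n I\<^sub>F"
proof -
  obtain a b c where abc: "\<And>m. hpart m f = (if m < d then 0 else hpart (m - d) a * f0 + hpart (m - d) b * f1 + hpart (m - d) c * f2)"
    using hpart_ideal[OF assms(1)] by blast
  have "hpart m f \<in> monomial_span n I\<^sub>F" for m
  proof (cases "m < n + d")
    case True
    then show ?thesis using assms(2) by (simp add: monomial_span_0)
  next
    case False
    then have "n \<le> m - d" by simp
    then have "hpart (m - d) a * f0 + hpart (m - d) b * f1 + hpart (m - d) c * f2 \<in> monomial_span n I\<^sub>F"
      by (intro monomial_span_add form_mult_in_monomial_span[OF _ _ form_hpart] is_ideal_gen gens_in)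
    then show ?thesis using False abc[of m] by simp
  qed
  then show ?thesis
    by (subst sum_hpart) (intro sum_closed[where P = "\<lambda>f. f \<in> monomial_span n I\<^sub>F"] monomial_span_0 monomial_span_add is_ideal_gen)
qed

lemma integral_if_saturated:
  assumes "\<And>a. a \<in> exponents n \<Longrightarrow> monomial a * f \<in> I\<^sub>F" "\<And>m. m < d \<Longrightarrow> hpart m f = 0"
  shows "f \<in> integral_closure I\<^sub>F"
proof (rule integral_if_stabilizes[OF finite_exponents exponents_nonempty monomial_nonzero])
  fix a assume a: "a \<in> exponents n"
  have "hpart m (f * monomial a) = 0" if "m < n + d" for m
    using that assms(2)[of "m - n"] by (auto simp: hpart_mult_form[OF form_monomial[OF a]])
  then have "f * monomial a \<in> monomial_span n I\<^sub>F"
    using assms(1)[OF a] by (intro in_monomial_span) (simp_all add: mult.commute)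
  then show "\<exists>c. (\<forall>b\<in>exponents n. c b \<in> I\<^sub>F) \<and> f * monomial a = (\<Sum>b\<in>exponents n. c b * monomial b)"
    unfolding monomial_span_def by blast
qed

lemma four_in_net_dependent:
  assumes "\<And>i. i < 4 \<Longrightarrow> \<exists>a b c. g i = const3 a * f0 + const3 b * f1 + const3 c * f2"
  obtains c :: "nat \<Rightarrow> 'k" where "\<exists>i<4. c i \<noteq> 0" "(\<Sum>i<4. const3 (c i) * g i) = 0"
proof -
  obtain x y z where g: "\<And>i. i < 4 \<Longrightarrow> g i = const3 (x i) * f0 + const3 (y i) * f1 + const3 (z i) * f2"
    using assms by metis
  define M where "M i j = (if j = 0 then x i else if j = 1 then y i else z i)" for i j :: nat
  have "card {..<3::nat} < card {..<4::nat}" by simp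
  then obtain c where c: "\<exists>i\<in>{..<4}. c i \<noteq> 0" "\<forall>j\<in>{..<3}. (\<Sum>i<4. c i * M i j) = 0"
    using homogeneous_system_solvable[of "{..<3}" "{..<4}" M] by auto
  have zero: "(\<Sum>i<4. c i * x i) = 0" "(\<Sum>i<4. c i * y i) = 0" "(\<Sum>i<4. c i * z i) = 0"
    using c(2)[rule_format, of 0] c(2)[rule_format, of 1] c(2)[rule_format, of 2] by (simp_all add: M_def)
  have "(\<Sum>i<4. const3 (c i) * g i) =
      (\<Sum>i<4. const3 (c i * x i) * f0 + const3 (c i * y i) * f1 + const3 (c i * z i) * f2)"
    by (intro sum.cong refl) (simp only: lessThan_iff g hom_mult[OF is_hom_const3] distrib_left mult.assoc)
  also have "\<dots> = const3 (\<Sum>i<4. c i * x i) * f0 + const3 (\<Sum>i<4. c i * y i) * f1 + const3 (\<Sum>i<4. c i * z i) * f2"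
    by (simp only: sum.distrib sum_distrib_right[symmetric] hom_sum[OF is_hom_const3])
  also have "\<dots> = 0" by (simp only: zero) simp
  finally show ?thesis using that c(1) by blast
qed

lemma sum_lessThan_4: "(\<Sum>i<4. t i) = t 0 + t 1 + t 2 + t (3::nat)"
  by (simp add: eval_nat_numeral)

lemma less_4_cases:
  assumes "(i::nat) < 4"
  obtains "i = 0" | "i = 1" | "i = 2" | "i = 3"
  using assms by linarith

text \<open>
  A dimension count. For \<open>d - m \<ge> 2\<close> four independent multiples of \<open>g\<close> would lie in a space of dimension
  at most \<open>3\<close>. For \<open>d - m = 1\<close> the multiples \<open>X g, Y g, Z g\<close> span the net, so that \<open>g\<close> divides all of its
  members; then \<open>g\<close> is constant and \<open>d = 1\<close>.
\<close>

lemma no_common_multiple_in_net: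
  assumes coprime: "\<And>h. h dvd f0 \<Longrightarrow> h dvd f1 \<Longrightarrow> h dvd f2 \<Longrightarrow> is_unit h"
    and d: "d \<ge> 2" and m: "m < d" and g: "form m g"
    and net: "\<And>h. form (d - m) h \<Longrightarrow> h * g \<in> I\<^sub>F"
  shows "g = 0"
proof (rule ccontr)
  assume g0: "g \<noteq> 0"
  have span: "\<exists>a b c. h * g = const3 a * f0 + const3 b * f1 + const3 c * f2" if "form (d - m) h" for h
  proof -
    have "form d (h * g)" using form_mult[OF that g] m by simp
    then show ?thesis using graded_part_base_ideal_iff[OF F, of "h * g"] net[OF that] by (simp add: graded_part_def)
  qed
  show False
  proof (cases "d - m \<ge> 2")
    case True
    define e where "e = d - m - 2"
    have e: "d - m = Suc (Suc e)" using True by (simp add: e_def)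
    define h :: "nat \<Rightarrow> 'k poly3" where "h i = (if i = 0 then monom3 1 (Suc (Suc e)) 0 0
      else if i = 1 then monom3 1 (Suc e) 1 0 else if i = 2 then monom3 1 (Suc e) 0 1 else monom3 1 e 2 0)" for i
    have h: "h 0 = monom3 1 (Suc (Suc e)) 0 0" "h 1 = monom3 1 (Suc e) 1 0"
      "h 2 = monom3 1 (Suc e) 0 1" "h 3 = monom3 1 e 2 0"
      by (simp_all add: h_def)
    have "form (d - m) (h i)" if "i < 4" for i
      using that
    proof (cases rule: less_4_cases)
      case 1
      then show ?thesis using form_monom3[of "Suc (Suc e)" 0 0 "1::'k"] by (simp only: h e add_0_right)
    next
      case 2
      then show ?thesis using form_monom3[of "Suc e" 1 0 "1::'k"] by (simp only: h e add_0_right Suc_eq_plus1)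
    next
      case 3
      then show ?thesis using form_monom3[of "Suc e" 0 1 "1::'k"] by (simp only: h e add_0_right Suc_eq_plus1)
    next
      case 4
      then show ?thesis using form_monom3[of e 2 0 "1::'k"] by (simp only: h e add_0_right add_2_eq_Suc')
    qed
    then have "\<exists>a b c. h i * g = const3 a * f0 + const3 b * f1 + const3 c * f2" if "i < 4" for i
      using that by (intro span)
    then obtain c where c: "\<exists>i<4. c i \<noteq> 0" "(\<Sum>i<4. const3 (c i) * (h i * g)) = 0"
      by (rule four_in_net_dependent)
    have "(\<Sum>i<4. const3 (c i) * h i) * g = 0"
      using c(2) by (simp only: sum_distrib_right mult.assoc)
    then have "(\<Sum>i<4. const3 (c i) * h i) = 0" using g0 by simp
    then have z: "coeff3 (\<Sum>i<4. const3 (c i) * h i) i' j l = 0" for i' j l by simp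
    have "c 0 = 0" using z[of 0 0 "Suc (Suc e)"] by (simp add: sum_lessThan_4 h h(2)[simplified])
    moreover have "c 1 = 0" using z[of 0 1 "Suc e"] by (simp add: sum_lessThan_4 h h(2)[simplified])
    moreover have "c 2 = 0" using z[of 1 0 "Suc e"] by (simp add: sum_lessThan_4 h h(2)[simplified])
    moreover have "c 3 = 0" using z[of 0 2 "e"] by (simp add: sum_lessThan_4 h h(2)[simplified])
    ultimately show False using c(1) by (metis less_4_cases)
  next
    case False
    then have dm: "d - m = Suc 0" using m by simp
    have "g dvd f" if f: "f \<in> {f0, f1, f2}" for f
    proof -
      define h where "h i = (if i = 0 then X * g else if i = 1 then Y * g else if i = 2 then Z * g else f)" for i :: nat
      have h: "h 0 = X * g" "h 1 = Y * g" "h 2 = Z * g" "h 3 = f" by (simp_all add: h_def)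
      have "f \<in> graded_part I\<^sub>F d" using f F gens_in by (auto simp: graded_part_def)
      then have fs: "\<exists>a b c. f = const3 a * f0 + const3 b * f1 + const3 c * f2"
        using graded_part_base_ideal_iff[OF F] by blast
      have "\<exists>a b c. h i = const3 a * f0 + const3 b * f1 + const3 c * f2" if "i < 4" for i
        using that fs span[of X] span[of Y] span[of Z]
        by (cases rule: less_4_cases) (simp_all only: h dm form_X form_Y form_Z simp_thms)
      then obtain c where c: "\<exists>i<4. c i \<noteq> 0" "(\<Sum>i<4. const3 (c i) * h i) = 0"
        by (rule four_in_net_dependent)
      let ?l = "const3 (c 0) * X + const3 (c 1) * Y + const3 (c 2) * Z"
      have eq: "?l * g + const3 (c 3) * f = 0"
        using c(2) unfolding sum_lessThan_4 h by (simp only: distrib_right mult.assoc)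
      have "c 3 \<noteq> 0"
      proof
        assume c3: "c 3 = 0"
        then have "?l = 0" using eq g0 by simp
        then have z: "coeff3 ?l i j l = 0" for i j l by simp
        have "c 0 = 0" using z[of 0 0 1] by (simp add: X_def Y_def Z_def)
        moreover have "c 1 = 0" using z[of 0 1 0] by (simp add: X_def Y_def Z_def)
        moreover have "c 2 = 0" using z[of 1 0 0] by (simp add: X_def Y_def Z_def)
        ultimately show False using c(1) c3 by (metis less_4_cases)
      qed
      then have "const3 (c 3) dvd 1" by (simp add: is_unit_const_poly_iff dvd_field_iff)
      moreover have "const3 (c 3) * f = - (?l * g)"
        unfolding eq_neg_iff_add_eq_0 using eq by (subst add.commute)
      then have "g dvd const3 (c 3) * f" by (metis dvd_minus_iff dvd_triv_right)
      ultimately show ?thesis by (metis dvd_mult_unit_iff')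
    qed
    then have "is_unit g" using coprime by blast
    then obtain g' where g': "g * g' = 1" by (metis dvdE)
    have "monom g m * grading g' = 1"
      using arg_cong[OF g', of grading] g by (simp add: hom_simps[OF is_hom_grading] grading_form_iff)
    moreover have "grading g' \<noteq> 0" using g' by auto
    ultimately have "m + degree (grading g') = 0"
      using degree_mult_eq[of "monom g m" "grading g'"] g0 by (simp add: degree_monom_eq monom_eq_0_iff)
    then show False using dm d by simp
  qed
qed

end


section \<open>Valuations of integral elements\<close>

lemma
  assumes "valuation_ring W"
  shows valuation_ring_0: "0 \<in> W" and valuation_ring_1: "1 \<in> W"
    and valuation_ring_add: "a \<in> W \<Longrightarrow> b \<in> W \<Longrightarrow> a + b \<in> W"
    and valuation_ring_mult: "a \<in> W \<Longrightarrow> b \<in> W \<Longrightarrow> a * b \<in> W"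
    and valuation_ring_minus: "a \<in> W \<Longrightarrow> - a \<in> W"
    and valuation_ring_inverse: "a \<in> W \<or> inverse a \<in> W"
  using assms by (auto simp: valuation_ring_def)

lemma valuation_ring_power: "valuation_ring W \<Longrightarrow> a \<in> W \<Longrightarrow> a ^ n \<in> W"
  by (induction n) (auto simp: valuation_ring_1 valuation_ring_mult)

lemma valuation_ring_sum: "valuation_ring W \<Longrightarrow> (\<And>x. x \<in> A \<Longrightarrow> f x \<in> W) \<Longrightarrow> sum f A \<in> W"
  by (rule sum_closed[where P = "\<lambda>x. x \<in> W"]) (auto simp: valuation_ring_0 valuation_ring_add)

lemma val_le_refl: "valuation_ring W \<Longrightarrow> val_le W a a"
  unfolding val_le_def by (rule bexI[of _ 1]) (auto simp: valuation_ring_1)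

lemma val_le_trans: "valuation_ring W \<Longrightarrow> val_le W a b \<Longrightarrow> val_le W b c \<Longrightarrow> val_le W a c"
  unfolding val_le_def by (metis mult.assoc valuation_ring_mult)

lemma val_le_mult: "valuation_ring W \<Longrightarrow> val_le W a b \<Longrightarrow> val_le W a' b' \<Longrightarrow> val_le W (a * a') (b * b')"
  unfolding val_le_def by (metis (no_types, lifting) mult.assoc mult.left_commute valuation_ring_mult)

lemma val_le_linear: "valuation_ring W \<Longrightarrow> val_le W a b \<or> val_le W b a"
proof (cases "a = 0 \<or> b = 0")
  case True
  assume "valuation_ring W"
  then show ?thesis using True unfolding val_le_def by (auto intro: bexI[of _ 0] simp: valuation_ring_0)
next
  case False
  assume "valuation_ring W"
  then have "b / a \<in> W \<or> a / b \<in> W" using valuation_ring_inverse[of W "b / a"] by simp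
  moreover have "b = a * (b / a)" "a = b * (a / b)" using False by simp_all
  ultimately show ?thesis unfolding val_le_def by blast
qed

lemma is_ideal_val_le:
  assumes "valuation_ring W" "range to_fract \<subseteq> W"
  shows "is_ideal {f. val_le W a (to_fract f)}"
  unfolding is_ideal_iff
proof (intro conjI ballI allI)
  show "0 \<in> {f. val_le W a (to_fract f)}"
    using assms by (auto simp: val_le_def valuation_ring_0 intro: bexI[of _ 0])
next
  fix f g assume "f \<in> {f. val_le W a (to_fract f)}" "g \<in> {f. val_le W a (to_fract f)}"
  then obtain s t where "s \<in> W" "to_fract f = a * s" "t \<in> W" "to_fract g = a * t" by (auto simp: val_le_def)
  then have "to_fract (f + g) = a * (s + t)" "s + t \<in> W"
    using assms by (auto simp: distrib_left valuation_ring_add)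
  then show "f + g \<in> {f. val_le W a (to_fract f)}" by (auto simp: val_le_def)
next
  fix c f assume "f \<in> {f. val_le W a (to_fract f)}"
  then obtain s where "s \<in> W" "to_fract f = a * s" by (auto simp: val_le_def)
  moreover have "to_fract c \<in> W" using assms(2) by blast
  ultimately have "to_fract (c * f) = a * (to_fract c * s)" "to_fract c * s \<in> W"
    using assms(1) by (simp_all add: valuation_ring_mult)
  then show "c * f \<in> {f. val_le W a (to_fract f)}" by (auto simp: val_le_def)
qed

text \<open>
  After division by \<open>g\<close> an equation of integral dependence over \<open>J\<close> becomes one over the valuation ring,
  which is integrally closed.
\<close>

lemma integral_closure_val_le:
  assumes W: "valuation_ring W" "range to_fract \<subseteq> W"
    and g: "\<And>h. h \<in> J \<Longrightarrow> val_le W (to_fract g) (to_fract h)"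
    and f: "f \<in> integral_closure J"
  shows "val_le W (to_fract g) (to_fract f)"
proof -
  obtain n a where n: "n \<ge> 1" and a: "\<And>i. i \<in> {1..n} \<Longrightarrow> a i \<in> ideal_pow J i"
    and eq: "f ^ n + (\<Sum>i=1..n. a i * f ^ (n - i)) = 0"
    using f unfolding integral_closure_def by blast
  have pow: "val_le W (to_fract g ^ i) (to_fract x)" if "x \<in> ideal_pow J i" for x i
  proof -
    have list: "val_le W (to_fract g ^ length gs) (to_fract (prod_list gs))" if "set gs \<subseteq> J" for gs
      using that by (induction gs) (simp_all add: val_le_refl val_le_mult W g)
    have "ideal_pow J i \<subseteq> {x. val_le W (to_fract g ^ i) (to_fract x)}"
      by (rule ideal_pow_minimal[OF is_ideal_val_le[OF W]]) (use list in auto)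
    then show ?thesis using that by auto
  qed
  show ?thesis
  proof (cases "g = 0")
    case True
    have "a i = 0" if "i \<in> {1..n}" for i
      using pow[OF a[OF that]] True that by (auto simp: val_le_def power_0_left)
    then have "f ^ n = 0" using eq by simp
    then have "f = 0" by simp
    then show ?thesis using True by (simp add: val_le_refl[OF W(1)])
  next
    case False
    define y where "y = to_fract f / to_fract g"
    have fy: "to_fract f = to_fract g * y" using False by (simp add: y_def)
    obtain b where b: "\<And>i. i \<in> {1..n} \<Longrightarrow> b i \<in> W \<and> to_fract (a i) = to_fract g ^ i * b i"
      using pow[OF a] unfolding val_le_def by metis
    have "to_fract f ^ n + (\<Sum>i=1..n. to_fract (a i) * to_fract f ^ (n - i)) = to_fract (f ^ n + (\<Sum>i=1..n. a i * f ^ (n - i)))"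
      by (simp add: hom_power[OF is_hom_to_fract])
    also have "\<dots> = 0" by (simp only: eq to_fract_0)
    also have "to_fract f ^ n + (\<Sum>i=1..n. to_fract (a i) * to_fract f ^ (n - i)) =
        to_fract g ^ n * (y ^ n + (\<Sum>i=1..n. b i * y ^ (n - i)))"
      unfolding distrib_left sum_distrib_left
    proof (intro arg_cong2[where f = "(+)"] sum.cong refl)
      show "to_fract f ^ n = to_fract g ^ n * y ^ n" by (simp add: fy power_mult_distrib)
      fix i assume i: "i \<in> {1..n}"
      then have "to_fract g ^ n = to_fract g ^ i * to_fract g ^ (n - i)" by (simp add: power_add[symmetric])
      then show "to_fract (a i) * to_fract f ^ (n - i) = to_fract g ^ n * (b i * y ^ (n - i))"
        using b[OF i] by (simp add: fy power_mult_distrib mult_ac)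
    qed
    finally have eq': "y ^ n + (\<Sum>i=1..n. b i * y ^ (n - i)) = 0" using False by simp
    have "y \<in> W"
    proof (rule ccontr)
      assume y: "y \<notin> W"
      then have inv: "inverse y \<in> W" using valuation_ring_inverse[OF W(1)] by blast
      have "y \<noteq> 0" using y valuation_ring_0[OF W(1)] by auto
      have "y = - (\<Sum>i=1..n. b i * inverse y ^ (i - 1))"
      proof -
        have "y ^ n = y ^ (n - 1) * y" using n by (metis power_minus_mult less_le_trans zero_less_one)
        moreover have "(\<Sum>i=1..n. b i * y ^ (n - i)) = y ^ (n - 1) * (\<Sum>i=1..n. b i * inverse y ^ (i - 1))"
          unfolding sum_distrib_left
        proof (intro sum.cong refl)
          fix i assume "i \<in> {1..n}"
          then have "y ^ (n - 1) = y ^ (n - i) * y ^ (i - 1)" by (simp add: power_add[symmetric])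
          moreover have "y ^ (i - 1) * inverse y ^ (i - 1) = 1" using \<open>y \<noteq> 0\<close> by (simp add: power_mult_distrib[symmetric])
          ultimately show "b i * y ^ (n - i) = y ^ (n - 1) * (b i * inverse y ^ (i - 1))" by (simp add: mult_ac)
        qed
        ultimately have "y ^ (n - 1) * (y + (\<Sum>i=1..n. b i * inverse y ^ (i - 1))) = 0"
          using eq' by (simp add: distrib_left)
        then show ?thesis using \<open>y \<noteq> 0\<close> by (simp add: eq_neg_iff_add_eq_0)
      qed
      also have "\<dots> \<in> W"
        using b inv by (intro valuation_ring_minus valuation_ring_sum valuation_ring_mult valuation_ring_power W) auto
      finally show False using y by blast
    qed
    then show ?thesis using fy by (auto simp: val_le_def)
  qed
qed

lemma minimal_generator:
  assumes W: "valuation_ring W" "range to_fract \<subseteq> W"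
  obtains g where "g \<in> ideal_gen {f0, f1, f2}" "\<And>h. h \<in> ideal_gen {f0, f1, f2} \<Longrightarrow> val_le W (to_fract g) (to_fract h)"
proof -
  have "\<exists>g\<in>{f0, f1, f2}. \<forall>h\<in>{f0, f1, f2}. val_le W (to_fract g) (to_fract h)"
    using val_le_linear[OF W(1), of "to_fract f0" "to_fract f1"] val_le_linear[OF W(1), of "to_fract f0" "to_fract f2"]
      val_le_linear[OF W(1), of "to_fract f1" "to_fract f2"] val_le_refl[OF W(1)] val_le_trans[OF W(1)]
    by (metis insertE insertI1 insertI2 singletonD)
  then obtain g where g: "g \<in> {f0, f1, f2}" "\<forall>h\<in>{f0, f1, f2}. val_le W (to_fract g) (to_fract h)" by blast
  then have "ideal_gen {f0, f1, f2} \<subseteq> {h. val_le W (to_fract g) (to_fract h)}"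
    by (intro ideal_gen_minimal is_ideal_val_le W) auto
  then show ?thesis using that[OF ideal_gen_base[OF g(1)]] by blast
qed

lemma integral_closure_hom:
  assumes h: "is_hom h" and J: "\<And>x. x \<in> J \<Longrightarrow> h x \<in> J" and f: "f \<in> integral_closure J"
  shows "h f \<in> integral_closure J"
proof -
  obtain n a where n: "n \<ge> 1" and a: "\<And>i. i \<in> {1..n} \<Longrightarrow> a i \<in> ideal_pow J i"
    and eq: "f ^ n + (\<Sum>i=1..n. a i * f ^ (n - i)) = 0"
    using f unfolding integral_closure_def by blast
  have "h x \<in> ideal_pow J i" if "x \<in> ideal_pow J i" for x i
  proof -
    have list: "h (prod_list gs) \<in> ideal_pow J (length gs)" if "set gs \<subseteq> J" for gs
    proof -
      have "h (prod_list gs) = prod_list (map h gs)" by (induction gs) (auto simp: hom_simps[OF h])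
      then show ?thesis using prod_list_in_ideal_pow[of "map h gs" J] that J by auto
    qed
    have "ideal_pow J i \<subseteq> {x. h x \<in> ideal_pow J i}"
      by (rule ideal_pow_minimal[OF is_ideal_vimage[OF h is_ideal_pow]]) (use list in auto)
    then show ?thesis using that by auto
  qed
  then have "\<forall>i\<in>{1..n}. h (a i) \<in> ideal_pow J i" using a by blast
  moreover have "h f ^ n + (\<Sum>i=1..n. h (a i) * h f ^ (n - i)) = 0"
    using arg_cong[OF eq, of h] by (simp add: hom_simps[OF h] hom_power[OF h] hom_sum[OF h])
  ultimately show ?thesis using n unfolding integral_closure_def
    by (intro CollectI exI[of _ n] conjI exI[of _ "\<lambda>i. h (a i)"]) auto
qed

text \<open>
  Interpolation over an infinite field by successive division by linear factors \<open>t - c\<close>: the quotient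
  has its values in \<open>S\<close> at all constants except \<open>c\<close>, because nonzero constants are units. The exceptional
  set \<open>B\<close> collects these \<open>c\<close>.
\<close>

lemma coeffs_in_ideal_if_values:
  fixes p :: "'k::alg_closed_field poly3 poly"
  assumes S: "is_ideal S" and "finite B" "\<And>c. c \<notin> B \<Longrightarrow> poly p (const3 c) \<in> S"
  shows "coeff p m \<in> S"
  using assms(2,3)
proof (induction "degree p" arbitrary: p B m rule: less_induct)
  case less
  obtain c0 where c0: "c0 \<notin> B" using exists_avoiding_finite[OF less.prems(1)] .
  show ?case
  proof (cases "degree p = 0")
    case True
    then obtain x where "p = [:x:]" by (metis degree_eq_zeroE)
    then show ?thesis using less.prems(2)[OF c0] ideal_0[OF S] by (cases m) auto
  next
    case False
    define q where "q = synthetic_div p (const3 c0)"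
    have p: "p = [:- const3 c0, 1:] * q + [:poly p (const3 c0):]"
      using synthetic_div_correct'[of "const3 c0" p] by (simp only: q_def)
    have "poly q (const3 c) \<in> S" if c: "c \<notin> insert c0 B" for c
    proof -
      have "poly p (const3 c) = (const3 c - const3 c0) * poly q (const3 c) + poly p (const3 c0)"
        using arg_cong[OF p, of "\<lambda>p. poly p (const3 c)"] by (simp del: mult_pCons_left)
      then have "(const3 c - const3 c0) * poly q (const3 c) = poly p (const3 c) - poly p (const3 c0)" by simp
      also have "\<dots> \<in> S" using c c0 less.prems(2) by (intro ideal_diff[OF S]) auto
      finally have "const3 (inverse (c - c0)) * ((const3 c - const3 c0) * poly q (const3 c)) \<in> S"
        by (rule ideal_mult[OF S])
      moreover have "const3 (inverse (c - c0)) * (const3 c - const3 c0) = 1"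
        using c by (simp add: one_pCons)
      ultimately show ?thesis by (simp only: mult.assoc[symmetric] mult_1_left)
    qed
    moreover have "degree q < degree p" using False by (simp add: q_def degree_synthetic_div)
    ultimately have q: "coeff q m \<in> S" for m
      using less.hyps[of q "insert c0 B"] less.prems(1) by blast
    have "coeff p m = (case m of 0 \<Rightarrow> 0 | Suc n \<Rightarrow> coeff q n) - const3 c0 * coeff q m + coeff [:poly p (const3 c0):] m"
    proof -
      define e where "e = const3 c0"
      have "p = [:- e, 1:] * q + [:poly p e:]" using p by (simp only: e_def)
      from arg_cong[OF this, of "\<lambda>p. coeff p m"] show ?thesis
        unfolding e_def[symmetric] by (simp add: coeff_pCons split: nat.splits)
    qed
    also have "\<dots> \<in> S"
      using q less.prems(2)[OF c0] ideal_0[OF S]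
      by (intro ideal_add[OF S] ideal_diff[OF S] ideal_mult[OF S]) (auto split: nat.splits simp: coeff_pCons)
    finally show ?thesis .
  qed
qed

text \<open>
  The torus acts on the integral closure of a homogeneous ideal, and \<open>grading f\<close> takes the translates of
  \<open>f\<close> as values at the constants. By interpolation the homogeneous parts of \<open>f\<close> inherit the lower bound
  for the values of the translates.
\<close>

lemma integral_closure_subset_divisorial_cover:
  fixes f0 f1 f2 :: "'k::alg_closed_field poly3"
  assumes F: "form d f0" "form d f1" "form d f2"
  shows "integral_closure (ideal_gen {f0, f1, f2}) \<subseteq> divisorial_cover (ideal_gen {f0, f1, f2})"
proof
  let ?I = "ideal_gen {f0, f1, f2}"
  fix f assume f: "f \<in> integral_closure ?I"
  have "val_ideal_le W ?I (hpart m f)" if "divisorial W" for W m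
  proof -
    have W: "valuation_ring W" "range to_fract \<subseteq> W" using that by (auto simp: divisorial_def)
    obtain g where g: "g \<in> ?I" "\<And>h. h \<in> ?I \<Longrightarrow> val_le W (to_fract g) (to_fract h)"
      using minimal_generator[OF W] by metis
    have "poly (grading f) (const3 c) \<in> {f. val_le W (to_fract g) (to_fract f)}" for c
    proof -
      let ?t = "eval3 const3 (const3 c * X) (const3 c * Y) (const3 c * Z)"
      have t: "is_hom ?t" by simp
      have id: "eval3 const3 X Y Z = (\<lambda>f :: 'k poly3. f)"
        by (rule ext, rule hom_eq_eval3[OF is_hom_id(1), symmetric])
      have "?t f = poly (grading f) (const3 c)"
        by (subst eval3_grading[OF is_hom_const3]) (simp add: id)
      moreover have "?t fi \<in> ?I" if "fi \<in> {f0, f1, f2}" for fi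
      proof -
        have "form d fi" using that F by auto
        then have "?t fi = const3 c ^ d * fi"
          using eval3_form_scale[OF is_hom_const3, of d fi "const3 c" X Y Z] by (simp only: id)
        then show ?thesis using ideal_mult[OF is_ideal_gen ideal_gen_base[OF that]] by metis
      qed
      then have "{f0, f1, f2} \<subseteq> {x. ?t x \<in> ?I}" by blast
      then have "?I \<subseteq> {x. ?t x \<in> ?I}"
        by (intro ideal_gen_minimal is_ideal_vimage t is_ideal_gen)
      then have "?t f \<in> integral_closure ?I"
        by (intro integral_closure_hom[OF t _ f]) auto
      then have "val_le W (to_fract g) (to_fract (?t f))"
        using integral_closure_val_le[OF W, of ?I g] g(2) by blast
      ultimately show ?thesis by simp
    qed
    then have "hpart m f \<in> {f. val_le W (to_fract g) (to_fract f)}"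
      unfolding hpart_def by (intro coeffs_in_ideal_if_values[OF is_ideal_val_le[OF W], of "{}"]) auto
    then show ?thesis using g unfolding val_ideal_le_def by blast
  qed
  then have "f = (\<Sum>m\<le>degree (grading f). hpart m f) \<and>
      (\<forall>m\<le>degree (grading f). hpart m f \<in> {f. form m f \<and> (\<forall>W. divisorial W \<longrightarrow> val_ideal_le W ?I f)})"
    using sum_hpart[of f] by simp
  then show "f \<in> divisorial_cover ?I"
    unfolding divisorial_cover_def direct_sum_def by blast
qed

lemma poly_sum_le:
  fixes p :: "'a::comm_ring_1 poly"
  assumes "degree p \<le> n"
  shows "poly p x = (\<Sum>i\<le>n. coeff p i * x ^ i)"
proof -
  have "(\<Sum>i\<le>degree p. coeff p i * x ^ i) = (\<Sum>i\<le>n. coeff p i * x ^ i)"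
    using assms by (intro sum.mono_neutral_left) (auto simp: coeff_eq_0)
  then show ?thesis using poly_altdef[of p x] by simp
qed

section \<open>Four rational functions in three variables are algebraically dependent\<close>

lemma coeff3_nonzero_degree: "coeff3 f i j l \<noteq> 0 \<Longrightarrow> i + j + l \<le> degree (grading f)"
proof (rule le_degree)
  assume "coeff3 f i j l \<noteq> 0"
  then have "coeff3 (hpart (i + j + l) f) i j l \<noteq> 0" by (simp add: coeff3_hpart)
  then show "coeff (grading f) (i + j + l) \<noteq> 0" unfolding hpart_def by auto
qed

lemma degree_grading_mult: "degree (grading (f * g)) \<le> degree (grading f) + degree (grading g)"
  by (simp add: hom_mult[OF is_hom_grading] degree_mult_le)

lemma degree_grading_power: "degree (grading f) \<le> D \<Longrightarrow> degree (grading (f ^ n)) \<le> D * n"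
  unfolding hom_power[OF is_hom_grading]
  by (rule order_trans[OF degree_power_le]) simp

text \<open>
  The denominators are taken from a multiplicative set, either all nonzero elements or the complement
  of a prime ideal.
\<close>

lemma fract_common_denominator:
  fixes x :: "'i \<Rightarrow> 'a::idom fract"
  assumes "finite E" and mult: "\<And>s t. s \<in> M \<Longrightarrow> t \<in> M \<Longrightarrow> s * t \<in> M" and "1 \<in> M"
    and "\<And>e. e \<in> E \<Longrightarrow> \<exists>a s. s \<in> M \<and> s \<noteq> 0 \<and> x e = to_fract a / to_fract s"
  shows "\<exists>s a. s \<in> M \<and> s \<noteq> 0 \<and> (\<forall>e\<in>E. x e = to_fract (a e) / to_fract s)"
  using assms(1,4)
proof (induction E rule: finite_induct)
  case empty
  show ?case using assms(3) by (intro exI[of _ 1]) auto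
next
  case (insert e E)
  obtain s a where s: "s \<in> M" "s \<noteq> 0" "\<And>e. e \<in> E \<Longrightarrow> x e = to_fract (a e) / to_fract s"
    using insert by blast
  obtain b t where t: "t \<in> M" "t \<noteq> 0" "x e = to_fract b / to_fract t"
    using insert.prems by blast
  let ?a = "\<lambda>e'. if e' = e then b * s else a e' * t"
  have "\<forall>e'\<in>insert e E. x e' = to_fract (?a e') / to_fract (s * t)"
    using s t insert.hyps by auto
  moreover have "s * t \<in> M" "s * t \<noteq> 0" using s t mult by auto
  ultimately show ?case by (intro exI[of _ "s * t"] exI[of _ ?a] conjI)
qed

lemma fract_cases:
  fixes x :: "'a::idom fract"
  obtains a b where "b \<noteq> 0" "x = to_fract a / to_fract b"
  by (cases x) (auto simp: Fract_conv_to_fract)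

abbreviation fconst :: "'k::field \<Rightarrow> 'k poly3 fract" where
  "fconst c \<equiv> to_fract (const3 c)"

lemma is_hom_fconst [simp]: "is_hom (\<lambda>c. fconst c)"
  by (rule is_hom_comp[OF is_hom_to_fract is_hom_const3])

text \<open>
  Counting: with a common denominator \<open>s\<close>, let \<open>D\<close> bound the degrees of \<open>s\<close> and the numerators. The monomials of degree less than \<open>N\<close> in
  each of the four functions, multiplied by \<open>s ^ (4 N)\<close>, are \<open>N ^ 4\<close> polynomials of degree at most
  \<open>4 N D\<close>, which have at most \<open>(4 N D + 1) ^ 3\<close> coefficients.
\<close>

lemma four_algebraically_dependent:
  fixes a b c e :: "'k::field poly3 fract"
  obtains \<Phi> :: "'k poly3 poly" where "\<Phi> \<noteq> 0" "poly (map_poly (eval3 (\<lambda>c. fconst c) a b c) \<Phi>) e = 0"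
proof -
  let ?x = "\<lambda>i::nat. if i = 0 then a else if i = 1 then b else if i = 2 then c else e"
  have "\<exists>s n. s \<in> UNIV \<and> s \<noteq> 0 \<and> (\<forall>i\<in>{..<4}. ?x i = to_fract (n i) / to_fract s)"
    by (rule fract_common_denominator) (auto intro: fract_cases)
  then obtain s n where s: "s \<noteq> 0" and n: "\<And>i. i < 4 \<Longrightarrow> ?x i = to_fract (n i) / to_fract s" by auto
  have x: "to_fract (n 0) = a * to_fract s" "to_fract (n 1) = b * to_fract s"
    "to_fract (n 2) = c * to_fract s" "to_fract (n 3) = e * to_fract s"
    using n[of 0] n[of 1] n[of 2] n[of 3] s by simp_all
  define D where "D = degree (grading s) + degree (grading (n 0)) + degree (grading (n 1))
      + degree (grading (n 2)) + degree (grading (n 3))"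
  \<comment> \<open>large enough for \<open>(4 N D + 1) ^ 3 \<le> N ^ 3 (4 D + 1) ^ 3 < N ^ 4\<close>\<close>
  define N where "N = (4 * D + 1) ^ 3 + 1"
  define w where "w = (\<lambda>(i, j, l, m). n 0 ^ i * n 1 ^ j * n 2 ^ l * n 3 ^ m * s ^ (4 * N - (i + j + l + m)))"
  let ?E = "{..<N} \<times> {..<N} \<times> {..<N} \<times> {..<N}"
  let ?J = "{..4 * N * D} \<times> {..4 * N * D} \<times> {..4 * N * D}"
  have deg: "degree (grading (w \<alpha>)) \<le> 4 * N * D" if "\<alpha> \<in> ?E" for \<alpha>
  proof -
    obtain i j l m where \<alpha>: "\<alpha> = (i, j, l, m)" by (cases \<alpha>)
    have lt: "i + j + l + m \<le> 4 * N" using that by (auto simp: \<alpha>)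
    have p: "degree (grading (n 0 ^ i)) \<le> D * i" "degree (grading (n 1 ^ j)) \<le> D * j" "degree (grading (n 2 ^ l)) \<le> D * l"
      "degree (grading (n 3 ^ m)) \<le> D * m" "degree (grading (s ^ (4 * N - (i + j + l + m)))) \<le> D * (4 * N - (i + j + l + m))"
      by (intro degree_grading_power, simp add: D_def)+
    have "degree (grading (w \<alpha>)) \<le> D * i + D * j + D * l + D * m + D * (4 * N - (i + j + l + m))"
      unfolding \<alpha> w_def prod.case
      by (intro order_trans[OF degree_grading_mult] add_mono p)
    also have "\<dots> = D * (i + j + l + m + (4 * N - (i + j + l + m)))" by (simp add: algebra_simps)
    also have "\<dots> = 4 * N * D" using lt by simp
    finally show ?thesis .
  qed
  have "card ?J < card ?E"
  proof -
    have "card ?J = (4 * N * D + 1) ^ 3" by (simp add: card_cartesian_product power3_eq_cube)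
    also have "\<dots> \<le> (N * (4 * D + 1)) ^ 3" by (intro power_mono) (auto simp: N_def algebra_simps)
    also have "\<dots> = N ^ 3 * (4 * D + 1) ^ 3" by (rule power_mult_distrib)
    also have "\<dots> < N ^ 3 * N" by (intro mult_strict_left_mono) (auto simp: N_def)
    also have "\<dots> = card ?E" by (simp add: card_cartesian_product power3_eq_cube mult_ac)
    finally show ?thesis .
  qed
  moreover have "finite ?J" "finite ?E" by simp_all
  ultimately have "\<exists>\<gamma>. (\<exists>\<alpha>\<in>?E. \<gamma> \<alpha> \<noteq> 0) \<and>
      (\<forall>\<beta>\<in>?J. (\<Sum>\<alpha>\<in>?E. \<gamma> \<alpha> * (case \<beta> of (i, j, l) \<Rightarrow> coeff3 (w \<alpha>) i j l)) = 0)"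
    by (intro homogeneous_system_solvable)
  then obtain \<gamma> where \<gamma>: "\<exists>\<alpha>\<in>?E. \<gamma> \<alpha> \<noteq> 0"
    "\<forall>\<beta>\<in>?J. (\<Sum>\<alpha>\<in>?E. \<gamma> \<alpha> * (case \<beta> of (i, j, l) \<Rightarrow> coeff3 (w \<alpha>) i j l)) = 0"
    by (elim exE conjE)
  have rel: "(\<Sum>\<alpha>\<in>?E. const3 (\<gamma> \<alpha>) * w \<alpha>) = 0"
  proof (rule poly3_eqI)
    fix i j l
    have "(\<Sum>\<alpha>\<in>?E. \<gamma> \<alpha> * coeff3 (w \<alpha>) i j l) = 0"
    proof (cases "(i, j, l) \<in> ?J")
      case True
      from bspec[OF \<gamma>(2) this] show ?thesis by (simp only: prod.case)
    next
      case False
      have "coeff3 (w \<alpha>) i j l = 0" if "\<alpha> \<in> ?E" for \<alpha>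
      proof (rule ccontr)
        assume "coeff3 (w \<alpha>) i j l \<noteq> 0"
        then have "i + j + l \<le> 4 * N * D" using deg[OF that] by (blast dest: coeff3_nonzero_degree intro: order_trans)
        then have "i \<le> 4 * N * D" "j \<le> 4 * N * D" "l \<le> 4 * N * D" by linarith+
        then have "(i, j, l) \<in> ?J" by (simp only: mem_Sigma_iff atMost_iff simp_thms)
        with False show False by contradiction
      qed
      then show ?thesis by (intro sum.neutral) auto
    qed
    then show "coeff3 (\<Sum>\<alpha>\<in>?E. const3 (\<gamma> \<alpha>) * w \<alpha>) i j l = coeff3 0 i j l" by (simp add: coeff_sum)
  qed
  define \<Phi> :: "'k poly3 poly" where "\<Phi> = (\<Sum>(i, j, l, m)\<in>?E. monom (monom3 (\<gamma> (i, j, l, m)) i j l) m)"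
  have coeff: "coeff3 (coeff \<Phi> m) i j l = \<gamma> (i, j, l, m)" if "(i, j, l, m) \<in> ?E" for i j l m
  proof -
    have "coeff3 (coeff \<Phi> m) i j l = (\<Sum>\<alpha>\<in>?E. if \<alpha> = (i, j, l, m) then \<gamma> \<alpha> else 0)"
      unfolding \<Phi>_def coeff_sum
      by (intro sum.cong refl) (auto split: if_splits)
    also have "\<dots> = \<gamma> (i, j, l, m)" using that by (subst sum.delta) auto
    finally show ?thesis .
  qed
  have "\<Phi> \<noteq> 0"
  proof
    assume "\<Phi> = 0"
    then have "\<gamma> \<alpha> = 0" if "\<alpha> \<in> ?E" for \<alpha> using that coeff by (cases \<alpha>) fastforce
    then show False using \<gamma>(1) by blast
  qed
  moreover
  let ?h = "\<lambda>\<Psi>. poly (map_poly (eval3 (\<lambda>c. fconst c) a b c) \<Psi>) e"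
  have h: "is_hom ?h" by (intro is_hom_comp[OF is_hom_poly] is_hom_map_poly is_hom_eval3 is_hom_fconst)
  have "to_fract s ^ (4 * N) * ?h \<Phi> = 0"
  proof -
    have "to_fract s ^ (4 * N) * ?h (monom (monom3 (\<gamma> (i, j, l, m)) i j l) m) = to_fract (const3 (\<gamma> (i, j, l, m)) * w (i, j, l, m))"
      if "(i, j, l, m) \<in> ?E" for i j l m
    proof -
      have "4 * N = i + j + l + m + (4 * N - (i + j + l + m))" using that by auto
      then have "to_fract s ^ (4 * N) = to_fract s ^ i * to_fract s ^ j * to_fract s ^ l * to_fract s ^ m *
        to_fract s ^ (4 * N - (i + j + l + m))" by (metis power_add)
      moreover have "?h (monom (monom3 (\<gamma> (i, j, l, m)) i j l) m) = fconst (\<gamma> (i, j, l, m)) * a ^ i * b ^ j * c ^ l * e ^ m"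
        by (simp only: map_poly_monom[where f = "eval3 (\<lambda>c. fconst c) a b c", OF hom_0[OF is_hom_eval3[OF is_hom_fconst, of a b c]]] poly_monom eval3_monom[OF is_hom_fconst])
      moreover have "to_fract (const3 (\<gamma> (i, j, l, m)) * w (i, j, l, m)) = fconst (\<gamma> (i, j, l, m)) *
        ((a * to_fract s) ^ i * (b * to_fract s) ^ j * (c * to_fract s) ^ l * (e * to_fract s) ^ m *
        to_fract s ^ (4 * N - (i + j + l + m)))"
        unfolding w_def prod.case by (simp only: to_fract_mult hom_power[OF is_hom_to_fract] x)
      ultimately show ?thesis by (simp only: power_mult_distrib mult_ac)
    qed
    then have "to_fract s ^ (4 * N) * ?h \<Phi> = (\<Sum>\<alpha>\<in>?E. to_fract (const3 (\<gamma> \<alpha>) * w \<alpha>))"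
      unfolding \<Phi>_def hom_sum[OF h] sum_distrib_left by (intro sum.cong refl) (auto split: prod.splits)
    also have "\<dots> = to_fract (\<Sum>\<alpha>\<in>?E. const3 (\<gamma> \<alpha>) * w \<alpha>)" by (simp only: to_fract_sum)
    finally show ?thesis by (simp only: rel to_fract_0)
  qed
  then have "?h \<Phi> = 0" using s by simp
  ultimately show ?thesis by (rule that)
qed

text \<open>
  A relation modulo \<open>Q\<close> can be divided by the power of \<open>\<tau>\<close> that it contains, as \<open>\<tau>\<close> is a nonzerodivisor
  modulo \<open>Q\<close>; what remains has a nonzero constant coefficient, which is a relation modulo \<open>Q'\<close> for the
  other elements. The set \<open>B\<close> is a subring that contains all values: a valuation ring or the whole
  ring.
\<close>

lemma peel_variable:
  assumes h: "is_hom h" and B: "\<And>s. h s \<in> B" "\<tau> \<in> B" "\<And>x y. x \<in> B \<Longrightarrow> y \<in> B \<Longrightarrow> x + y \<in> B" "\<And>x y. x \<in> B \<Longrightarrow> y \<in> B \<Longrightarrow> x * y \<in> B"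
    and Q: "\<And>x. x \<in> B \<Longrightarrow> \<tau> * x \<in> Q \<Longrightarrow> x \<in> Q"
    and Q': "\<And>a x. a \<in> B \<Longrightarrow> x \<in> B \<Longrightarrow> a + \<tau> * x \<in> Q \<Longrightarrow> a \<in> Q'"
    and \<Phi>: "\<Phi> \<noteq> 0" "poly (map_poly h \<Phi>) \<tau> \<in> Q"
  shows "\<exists>s. s \<noteq> 0 \<and> h s \<in> Q'"
  using \<Phi>
proof (induction \<Phi>)
  case 0
  then show ?case by simp
next
  case (pCons a p)
  have val: "poly (map_poly h p) \<tau> \<in> B" for p
  proof (induction p)
    case 0
    then show ?case using B(1)[of 0] h by (simp add: hom_0)
  next
    case (pCons a p)
    then show ?case using B h by (simp add: map_poly_pCons hom_0)
  qed
  have eq: "poly (map_poly h (pCons a p)) \<tau> = h a + \<tau> * poly (map_poly h p) \<tau>"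
    using h by (simp add: map_poly_pCons hom_0)
  show ?case
  proof (cases "a = 0")
    case False
    have "h a \<in> Q'" using Q'[OF B(1) val] pCons.prems(2) unfolding eq by blast
    then show ?thesis using False by blast
  next
    case True
    then have "\<tau> * poly (map_poly h p) \<tau> \<in> Q" using pCons.prems(2) eq hom_0[OF h] by simp
    then have "poly (map_poly h p) \<tau> \<in> Q" using Q val by blast
    moreover have "p \<noteq> 0" using True pCons.prems by auto
    ultimately show ?thesis using pCons.IH by blast
  qed
qed

lemma hom_poly_map_poly:
  assumes "is_hom g" "is_hom h"
  shows "g (poly (map_poly h p) x) = poly (map_poly (\<lambda>c. g (h c)) p) (g x)"
  by (induction p) (use assms in \<open>simp_all add: map_poly_pCons hom_simps\<close>)

lemma prime_idealD:
  assumes "prime_ideal P"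
  shows "is_ideal P" "1 \<notin> P" "a * b \<in> P \<Longrightarrow> a \<in> P \<or> b \<in> P"
proof -
  show "is_ideal P" "a * b \<in> P \<Longrightarrow> a \<in> P \<or> b \<in> P" using assms by (auto simp: prime_ideal_def)
  show "1 \<notin> P"
  proof
    assume "1 \<in> P"
    then have "x \<in> P" for x using ideal_mult[OF \<open>is_ideal P\<close>, of 1 x] by simp
    then show False using assms by (auto simp: prime_ideal_def)
  qed
qed

lemma prime_ideal_kernel:
  fixes h :: "'a::comm_ring_1 \<Rightarrow> 'b::idom"
  assumes "is_hom h"
  shows "prime_ideal {a. h a = 0}"
proof -
  have "1 \<notin> {a. h a = 0}" using hom_1[OF assms] by simp
  then have "{a. h a = 0} \<noteq> UNIV" by blast
  then show ?thesis unfolding prime_ideal_def is_ideal_iff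
    using assms by (simp add: hom_simps)
qed

lemma peel_variable_prime:
  assumes h: "is_hom h" and Q: "prime_ideal Q" "Q \<subset> Q'" "is_ideal Q'" and t: "t \<in> Q'" "t \<notin> Q"
    and \<Phi>: "\<Phi> \<noteq> 0" "poly (map_poly h \<Phi>) t \<in> Q"
  obtains s where "s \<noteq> 0" "h s \<in> Q'"
proof -
  have "\<exists>s. s \<noteq> 0 \<and> h s \<in> Q'"
  proof (rule peel_variable[where B = UNIV, OF h _ _ _ _ _ _ \<Phi>])
    show "x \<in> Q" if "t * x \<in> Q" for x using prime_idealD(3)[OF Q(1) that] t by blast
    show "a \<in> Q'" if "a + t * x \<in> Q" for a x
    proof -
      have "a + t * x \<in> Q'" using that Q(2) by blast
      then have "(a + t * x) - t * x \<in> Q'" by (intro ideal_diff ideal_mult_right Q(3) t(1))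
      then show ?thesis by simp
    qed
  qed simp_all
  then show ?thesis using that by blast
qed

text \<open>
  Elements that separate the four members of a chain of primes would be algebraically independent
  together with \<open>\<xi>\<close>: a relation between the four elements yields, by eliminating one of the separating
  elements at each step of the chain, a nonzero polynomial in \<open>\<xi>\<close> in the last prime.
\<close>

lemma height_le_2:
  fixes P :: "'k::field poly3 set"
  assumes free: "\<And>p. p \<noteq> 0 \<Longrightarrow> poly (map_poly const3 p) \<xi> \<notin> P"
  shows "height P \<le> enat 2"
  unfolding height_def
proof (rule Sup_least, clarify)
  fix n C assume prime: "\<forall>i\<le>n. prime_ideal (C i)" and strict: "\<forall>i<n. C i \<subset> C (Suc i)" and P: "P = C n"
  show "enat n \<le> enat 2"
  proof (rule ccontr)
    assume "\<not> enat n \<le> enat 2"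
    then obtain m where n: "n = Suc (Suc (Suc m))" by (metis enat_ord_simps(1) not_less_eq_eq numeral_2_eq_2 Suc_le_D)
    let ?P0 = "C m" and ?P1 = "C (Suc m)" and ?P2 = "C (Suc (Suc m))"
    have pr: "prime_ideal ?P0" "prime_ideal ?P1" "prime_ideal ?P2" "prime_ideal P" using prime n P by auto
    have sub: "?P0 \<subset> ?P1" "?P1 \<subset> ?P2" "?P2 \<subset> P" using strict n P by auto
    obtain t1 t2 t3 where t: "t1 \<in> ?P1" "t1 \<notin> ?P0" "t2 \<in> ?P2" "t2 \<notin> ?P1" "t3 \<in> P" "t3 \<notin> ?P2"
      using sub by blast
    obtain \<Phi> :: "'k poly3 poly" where \<Phi>: "\<Phi> \<noteq> 0"
      "poly (map_poly (eval3 (\<lambda>c. fconst c) (to_fract \<xi>) (to_fract t3) (to_fract t2)) \<Phi>) (to_fract t1) = 0"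
      by (rule four_algebraically_dependent)
    have "to_fract (poly (map_poly (eval3 const3 \<xi> t3 t2) \<Phi>) t1) = 0"
      using \<Phi>(2) by (subst hom_poly_map_poly) (simp_all add: hom_eval3)
    then have rel: "poly (map_poly (eval3 const3 \<xi> t3 t2) \<Phi>) t1 \<in> ?P0"
      using ideal_0[OF prime_idealD(1)[OF pr(1)]] by simp
    note ideals = prime_idealD(1)[OF pr(2)] prime_idealD(1)[OF pr(3)] prime_idealD(1)[OF pr(4)]
    obtain s3 where s3: "s3 \<noteq> 0" "eval3 const3 \<xi> t3 t2 s3 \<in> ?P1"
      using peel_variable_prime[OF is_hom_eval3[OF is_hom_const3] pr(1) sub(1) ideals(1) t(1,2) \<Phi>(1) rel] .
    obtain s2 where s2: "s2 \<noteq> 0" "eval2 const3 \<xi> t3 s2 \<in> ?P2"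
      using peel_variable_prime[OF is_hom_eval2[OF is_hom_const3] pr(2) sub(2) ideals(2) t(3,4) s3(1) s3(2)[unfolded eval3_def]] .
    have hom1: "is_hom (\<lambda>p. poly (map_poly const3 p) \<xi>)"
      by (intro is_hom_comp[OF is_hom_poly] is_hom_map_poly is_hom_const3)
    obtain s1 where s1: "s1 \<noteq> 0" "poly (map_poly const3 s1) \<xi> \<in> P"
      using peel_variable_prime[OF hom1 pr(3) sub(3) ideals(3) t(5,6) s2(1) s2(2)[unfolded eval2_def]] .
    then show False using free by blast
  qed
qed

text \<open>
  Two residually independent elements, \<open>\<xi>\<close> and an element \<open>T\<close> of positive value would be algebraically
  independent: a relation between them, with \<open>T\<close> eliminated, is a relation between the residues with
  coefficients in \<open>k[\<xi>]\<close>, whose nonzero elements are units of the valuation ring.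
\<close>

lemma residue_trdeg_le_1:
  fixes W :: "'k::field poly3 fract set"
  assumes W: "valuation_ring W" "range to_fract \<subseteq> W"
    and nontrivial: "\<exists>T\<in>max_ideal W. T \<noteq> 0"
    and free: "\<And>p. p \<noteq> 0 \<Longrightarrow> poly (map_poly const3 p) \<xi> \<notin> center W"
    and A: "range to_fract \<subseteq> A"
  shows "residue_trdeg A W \<le> enat 1"
  unfolding residue_trdeg_def
proof (rule Sup_least, clarify)
  fix n t assume indep: "residually_alg_indep A W n t"
  show "enat n \<le> enat 1"
  proof (rule ccontr)
    assume "\<not> enat n \<le> enat 1"
    then obtain n' where n: "n = Suc (Suc n')" by (metis One_nat_def enat_ord_simps(1) not_less_eq_eq Suc_le_D)
    have tW: "t 0 \<in> W" "t 1 \<in> W" using indep n by (auto simp: residually_alg_indep_def)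
    obtain T where T: "T \<in> max_ideal W" "T \<noteq> 0" using nontrivial by blast
    have TW: "T \<in> W" "inverse T \<notin> W" using T by (auto simp: max_ideal_def)
    let ?x = "to_fract \<xi>"
    have toW: "to_fract a \<in> W" for a using W(2) by blast
    obtain \<Phi> :: "'k poly3 poly" where \<Phi>: "\<Phi> \<noteq> 0"
      "poly (map_poly (eval3 (\<lambda>c. fconst c) ?x (t 0) (t 1)) \<Phi>) T = 0"
      by (rule four_algebraically_dependent)
    have eW: "eval3 (\<lambda>c. fconst c) ?x (t 0) (t 1) s \<in> W" for s
    proof (induction s rule: poly3_induct)
      case (monom c i j l)
      show ?case by (simp only: eval3_monom[OF is_hom_fconst])
          (intro valuation_ring_mult valuation_ring_power W(1) toW tW)
    qed (simp_all add: hom_simps[OF is_hom_eval3] valuation_ring_0 valuation_ring_add W(1))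
    have max: "a \<in> max_ideal W" if "x \<in> W" "a + T * x = 0" for a x
    proof -
      have a: "a = T * (- x)" using that by (simp add: eq_neg_iff_add_eq_0)
      have aW: "a \<in> W" unfolding a by (intro valuation_ring_mult valuation_ring_minus W(1) TW that)
      have "inverse a \<notin> W" if "a \<noteq> 0"
      proof
        assume "inverse a \<in> W"
        then have "(- x) * inverse a \<in> W" using \<open>x \<in> W\<close> by (intro valuation_ring_mult valuation_ring_minus W(1))
        moreover have "(- x) * inverse a = inverse T" using that a by (simp add: field_simps)
        ultimately show False using TW by simp
      qed
      then show ?thesis using aW by (auto simp: max_ideal_def)
    qed
    obtain s where s: "s \<noteq> 0" "eval3 (\<lambda>c. fconst c) ?x (t 0) (t 1) s \<in> max_ideal W"
      using peel_variable[OF is_hom_eval3[OF is_hom_fconst], of ?x "t 0" "t 1" W T "{0}" "max_ideal W" \<Phi>]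
        eW TW T \<Phi> max W(1) by (auto simp: valuation_ring_add valuation_ring_mult)
    let ?c = "\<lambda>l j. poly (map_poly (\<lambda>c. fconst c) (coeff (coeff s l) j)) ?x"
    define M where "M = degree s + (\<Sum>l\<le>degree s. degree (coeff s l))"
    have M: "coeff (coeff s l) j = 0" if "\<not> (j \<le> M \<and> l \<le> M)" for j l
    proof (cases "l \<le> degree s")
      case True
      then have "degree (coeff s l) \<le> (\<Sum>l\<le>degree s. degree (coeff s l))" by (intro member_le_sum) auto
      then have "degree (coeff s l) < j" using that True by (auto simp: M_def)
      then show ?thesis by (rule coeff_eq_0)
    next
      case False
      then show ?thesis by (simp add: coeff_eq_0)
    qed
    have "eval3 (\<lambda>c. fconst c) ?x (t 0) (t 1) s = (\<Sum>l\<le>M. eval2 (\<lambda>c. fconst c) ?x (t 0) (coeff s l) * t 1 ^ l)"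
    proof -
      have "degree (map_poly (eval2 (\<lambda>c. fconst c) ?x (t 0)) s) \<le> M"
        by (rule order_trans[OF map_poly_degree_leq]) (simp add: M_def)
      then show ?thesis
        unfolding eval3_def by (subst poly_sum_le, assumption) (simp add: coeff_map_poly hom_0)
    qed
    also have "\<dots> = (\<Sum>l\<le>M. \<Sum>j\<le>M. ?c l j * (t 0 ^ j * t 1 ^ l))"
    proof (intro sum.cong refl)
      fix l
      have deg: "degree (coeff s l) \<le> M" using M[of _ l] by (metis degree_le not_less)
      have "degree (map_poly (\<lambda>h. poly (map_poly (\<lambda>c. fconst c) h) ?x) (coeff s l)) \<le> M"
        by (rule order_trans[OF map_poly_degree_leq deg])
      then have "eval2 (\<lambda>c. fconst c) ?x (t 0) (coeff s l) = (\<Sum>j\<le>M. ?c l j * t 0 ^ j)"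
        unfolding eval2_def by (subst poly_sum_le, assumption) (simp add: coeff_map_poly)
      then show "eval2 (\<lambda>c. fconst c) ?x (t 0) (coeff s l) * t 1 ^ l = (\<Sum>j\<le>M. ?c l j * (t 0 ^ j * t 1 ^ l))"
        by (simp add: sum_distrib_right mult.assoc)
    qed
    also have "\<dots> = (\<Sum>(l, j)\<in>{..M} \<times> {..M}. ?c l j * (t 0 ^ j * t 1 ^ l))"
      by (rule sum.cartesian_product)
    finally have eval: "eval3 (\<lambda>c. fconst c) ?x (t 0) (t 1) s = (\<Sum>(l, j)\<in>{..M} \<times> {..M}. ?c l j * (t 0 ^ j * t 1 ^ l))" .
    \<comment> \<open>exponent vectors of \<open>t 0 ^ j * t 1 ^ l\<close>, padded to the length \<open>n\<close>\<close>
    define \<epsilon> where "\<epsilon> = (\<lambda>(l, j). j # l # replicate n' (0::nat))"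
    have inj: "inj_on \<epsilon> ({..M} \<times> {..M})" by (auto simp: inj_on_def \<epsilon>_def)
    let ?E = "\<epsilon> ` ({..M} \<times> {..M})" and ?C = "\<lambda>\<alpha>. ?c (\<alpha> ! 1) (\<alpha> ! 0)"
    have prod: "(\<Prod>i<n. t i ^ (\<epsilon> (l, j) ! i)) = t 0 ^ j * t 1 ^ l" for l j
      unfolding n by (simp add: prod.lessThan_Suc_shift \<epsilon>_def del: prod.lessThan_Suc)
    have sum: "(\<Sum>\<alpha>\<in>?E. ?C \<alpha> * (\<Prod>i<n. t i ^ (\<alpha> ! i))) \<in> max_ideal W"
    proof -
      have "(\<Sum>\<alpha>\<in>?E. ?C \<alpha> * (\<Prod>i<n. t i ^ (\<alpha> ! i))) = (\<Sum>\<beta>\<in>{..M} \<times> {..M}. ?C (\<epsilon> \<beta>) * (\<Prod>i<n. t i ^ (\<epsilon> \<beta> ! i)))"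
        using inj by (subst sum.reindex) auto
      also have "\<dots> = (\<Sum>(l, j)\<in>{..M} \<times> {..M}. ?c l j * (t 0 ^ j * t 1 ^ l))"
        by (intro sum.cong refl) (auto simp only: prod split: prod.splits, simp add: \<epsilon>_def)
      finally show ?thesis using s(2) eval by simp
    qed
    have c_eq: "?c l j = to_fract (poly (map_poly const3 (coeff (coeff s l) j)) \<xi>)" for l j
      by (subst hom_poly_map_poly) simp_all
    have EA: "\<forall>\<alpha>\<in>?E. length \<alpha> = n \<and> ?C \<alpha> \<in> A"
      unfolding c_eq using A by (auto simp: \<epsilon>_def n)
    have "\<forall>E c. finite E \<and> (\<forall>\<alpha>\<in>E. length \<alpha> = n \<and> c \<alpha> \<in> A) \<and>
        (\<Sum>\<alpha>\<in>E. c \<alpha> * (\<Prod>i<n. t i ^ (\<alpha> ! i))) \<in> max_ideal W \<longrightarrow> (\<forall>\<alpha>\<in>E. c \<alpha> \<in> max_ideal W)"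
      using indep unfolding residually_alg_indep_def by (rule conjunct2)
    from spec[OF spec[OF this, of ?E], of ?C]
    have all: "\<forall>\<alpha>\<in>?E. ?C \<alpha> \<in> max_ideal W"
      by (rule mp) (intro conjI EA sum finite_imageI finite_SigmaI finite_atMost)
    obtain l j where lj: "coeff (coeff s l) j \<noteq> 0" using s(1) by (metis coeff_0 poly_eqI)
    then have "j \<le> M \<and> l \<le> M" using M by blast
    then have "\<epsilon> (l, j) \<in> ?E" by auto
    then have "?C (\<epsilon> (l, j)) \<in> max_ideal W" using all by blast
    then have "to_fract (poly (map_poly const3 (coeff (coeff s l) j)) \<xi>) \<in> max_ideal W"
      unfolding c_eq by (simp add: \<epsilon>_def)
    then show False using free[OF lj] by (simp add: center_def)
  qed
qed

section \<open>Discrete valuations\<close>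

definition ord_at :: "'a::idom \<Rightarrow> 'a \<Rightarrow> nat" where
  "ord_at \<pi> x = (LEAST n. \<not> \<pi> ^ Suc n dvd x)"

locale finite_prime =
  fixes \<pi> :: "'a::idom"
  assumes prime: "prime_elem \<pi>" and finite_order: "x \<noteq> 0 \<Longrightarrow> \<exists>n. \<not> \<pi> ^ n dvd x"
begin

lemma power_dvd_iff_le_ord:
  assumes "x \<noteq> 0"
  shows "\<pi> ^ n dvd x \<longleftrightarrow> n \<le> ord_at \<pi> x"
proof -
  obtain m where m: "\<not> \<pi> ^ m dvd x" using finite_order[OF assms] by blast
  then have "\<exists>n. \<not> \<pi> ^ Suc n dvd x"
    by (cases m) auto
  then have not: "\<not> \<pi> ^ Suc (ord_at \<pi> x) dvd x" unfolding ord_at_def by (rule LeastI_ex)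
  have dvd: "\<pi> ^ n dvd x" if n: "n \<le> ord_at \<pi> x"
  proof (cases n)
    case (Suc k)
    then have "k < ord_at \<pi> x" using n by simp
    then show ?thesis unfolding ord_at_def Suc using not_less_Least by blast
  qed simp
  show ?thesis
  proof
    assume "\<pi> ^ n dvd x"
    show "n \<le> ord_at \<pi> x"
    proof (rule ccontr)
      assume "\<not> n \<le> ord_at \<pi> x"
      then have "\<pi> ^ Suc (ord_at \<pi> x) dvd \<pi> ^ n" by (intro le_imp_power_dvd) simp
      then show False using not \<open>\<pi> ^ n dvd x\<close> dvd_trans by blast
    qed
  qed (rule dvd)
qed

lemma ord_decomp:
  assumes "x \<noteq> 0"
  obtains y where "x = \<pi> ^ ord_at \<pi> x * y" "\<not> \<pi> dvd y"
proof -
  have "\<pi> ^ ord_at \<pi> x dvd x" using power_dvd_iff_le_ord[OF assms] by simp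
  then obtain y where y: "x = \<pi> ^ ord_at \<pi> x * y" by (elim dvdE)
  moreover have "\<not> \<pi> dvd y"
  proof
    assume "\<pi> dvd y"
    then obtain z where "y = \<pi> * z" by (elim dvdE)
    then have "x = \<pi> ^ Suc (ord_at \<pi> x) * z" using y by (simp add: mult_ac)
    then have "\<pi> ^ Suc (ord_at \<pi> x) dvd x" by (metis dvd_triv_left)
    then show False using power_dvd_iff_le_ord[OF assms, of "Suc (ord_at \<pi> x)"] by simp
  qed
  ultimately show ?thesis by (rule that)
qed

lemma ord_mult:
  assumes "x \<noteq> 0" "y \<noteq> 0"
  shows "ord_at \<pi> (x * y) = ord_at \<pi> x + ord_at \<pi> y"
proof -
  obtain x' where x': "x = \<pi> ^ ord_at \<pi> x * x'" "\<not> \<pi> dvd x'" using ord_decomp[OF assms(1)] .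
  obtain y' where y': "y = \<pi> ^ ord_at \<pi> y * y'" "\<not> \<pi> dvd y'" using ord_decomp[OF assms(2)] .
  have "x * y = \<pi> ^ ord_at \<pi> x * x' * (\<pi> ^ ord_at \<pi> y * y')"
    using x'(1) y'(1) by simp
  then have xy: "x * y = \<pi> ^ (ord_at \<pi> x + ord_at \<pi> y) * (x' * y')"
    by (simp only: power_add mult_ac)
  have pi: "\<pi> \<noteq> 0" using prime by auto
  have "\<not> \<pi> dvd x' * y'" using x'(2) y'(2) prime by (simp add: prime_elem_dvd_mult_iff)
  then have "\<not> \<pi> ^ Suc (ord_at \<pi> x + ord_at \<pi> y) dvd x * y"
    unfolding xy power_Suc2 using pi by (simp del: power_Suc2)
  moreover have "\<pi> ^ (ord_at \<pi> x + ord_at \<pi> y) dvd x * y" unfolding xy by (rule dvd_triv_left)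
  moreover have "x * y \<noteq> 0" using assms by simp
  ultimately show ?thesis using power_dvd_iff_le_ord[of "x * y"] by (metis not_less_eq_eq order_antisym)
qed

lemma ord_add:
  assumes "x \<noteq> 0" "y \<noteq> 0" "x + y \<noteq> 0"
  shows "min (ord_at \<pi> x) (ord_at \<pi> y) \<le> ord_at \<pi> (x + y)"
  using assms power_dvd_iff_le_ord by (metis dvd_add min.cobounded1 min.cobounded2)

end

text \<open>
  The value of \<open>w\<close> at \<open>0\<close> is arbitrary; in the valuation ring \<open>0\<close> is treated separately.
\<close>

locale discrete_valuation =
  fixes w :: "'a::idom \<Rightarrow> nat"
  assumes w_mult: "x \<noteq> 0 \<Longrightarrow> y \<noteq> 0 \<Longrightarrow> w (x * y) = w x + w y"
    and w_add: "x \<noteq> 0 \<Longrightarrow> y \<noteq> 0 \<Longrightarrow> x + y \<noteq> 0 \<Longrightarrow> min (w x) (w y) \<le> w (x + y)"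
begin

definition W :: "'a fract set" where
  "W = {to_fract a / to_fract b | a b. b \<noteq> 0 \<and> (a = 0 \<or> w b \<le> w a)}"

lemma w_1: "w 1 = 0"
  using w_mult[of 1 1] by simp

lemma w_minus: "x \<noteq> 0 \<Longrightarrow> w (- x) = w x"
proof -
  assume "x \<noteq> 0"
  have "w (- 1) = 0" using w_mult[of "- 1" "- 1"] w_1 by simp
  then show ?thesis using w_mult[of "- 1" x] \<open>x \<noteq> 0\<close> by simp
qed

lemma in_W_iff:
  assumes "b \<noteq> 0"
  shows "to_fract a / to_fract b \<in> W \<longleftrightarrow> a = 0 \<or> w b \<le> w a"
proof
  assume "to_fract a / to_fract b \<in> W"
  then obtain c e where ce: "to_fract a / to_fract b = to_fract c / to_fract e" "e \<noteq> 0" "c = 0 \<or> w e \<le> w c"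
    unfolding W_def by blast
  then have "to_fract (a * e) = to_fract (c * b)" using assms by (simp add: frac_eq_eq)
  then have eq: "a * e = c * b" by (simp only: to_fract_eq_iff)
  show "a = 0 \<or> w b \<le> w a"
  proof (cases "a = 0")
    case False
    then have "c \<noteq> 0" using eq ce(2) by auto
    then have "w a + w e = w c + w b" using eq w_mult[OF False ce(2)] w_mult[OF _ assms] by metis
    then show ?thesis using ce(3) \<open>c \<noteq> 0\<close> by linarith
  qed simp
qed (use assms in \<open>auto simp: W_def\<close>)

lemma valuation_ring_W: "valuation_ring W"
proof -
  have "0 \<in> W" using in_W_iff[of 1 0] by simp
  moreover have "1 \<in> W" using in_W_iff[of 1 1] by simp
  moreover have "x + y \<in> W \<and> x * y \<in> W \<and> - x \<in> W" if "x \<in> W" "y \<in> W" for x y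
  proof -
    obtain a b where x: "b \<noteq> 0" "x = to_fract a / to_fract b" by (rule fract_cases)
    obtain c e where y: "e \<noteq> 0" "y = to_fract c / to_fract e" by (rule fract_cases)
    have a: "a = 0 \<or> w b \<le> w a" and c: "c = 0 \<or> w e \<le> w c" using that x y in_W_iff by auto
    have be: "b * e \<noteq> 0" using x y by simp
    have sum: "x + y = to_fract (a * e + c * b) / to_fract (b * e)"
      and prod: "x * y = to_fract (a * c) / to_fract (b * e)" and minus: "- x = to_fract (- a) / to_fract b"
      using x y by (simp_all add: add_frac_eq)
    have "w (b * e) \<le> w (a * e + c * b)" if nz: "a * e + c * b \<noteq> 0"
    proof (cases "a = 0 \<or> c = 0")
      case True
      then show ?thesis using nz a c x y by (auto simp: w_mult)
    next
      case False
      then have "min (w (a * e)) (w (c * b)) \<le> w (a * e + c * b)" using nz x y by (intro w_add) auto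
      then show ?thesis using a c False x y by (auto simp: w_mult)
    qed
    then have "x + y \<in> W" unfolding sum in_W_iff[OF be] by blast
    moreover have "x * y \<in> W" unfolding prod in_W_iff[OF be] using a c x y
      by (cases "a = 0 \<or> c = 0") (auto simp: w_mult)
    moreover have "- x \<in> W" unfolding minus in_W_iff[OF x(1)] using a
      by (cases "a = 0") (auto simp: w_minus)
    ultimately show ?thesis by blast
  qed
  moreover have "x \<in> W \<or> inverse x \<in> W" for x
  proof -
    obtain a b where x: "b \<noteq> 0" "x = to_fract a / to_fract b" by (rule fract_cases)
    show ?thesis
    proof (cases "a = 0")
      case True
      then show ?thesis using x in_W_iff[of 1 0] by simp
    next
      case False
      have "inverse x = to_fract b / to_fract a" using x by simp
      then show ?thesis using False x in_W_iff[OF x(1), of a] in_W_iff[OF False, of b] by auto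
    qed
  qed
  ultimately show ?thesis unfolding valuation_ring_def by blast
qed

lemma range_subset_W: "range to_fract \<subseteq> W"
  using in_W_iff[of 1] w_1 by auto

lemma in_max_ideal_iff:
  assumes "b \<noteq> 0"
  shows "to_fract a / to_fract b \<in> max_ideal W \<longleftrightarrow> a = 0 \<or> w b < w a"
proof (cases "a = 0")
  case True
  then show ?thesis using in_W_iff[OF assms, of a] by (simp add: max_ideal_def)
next
  case False
  have "inverse (to_fract a / to_fract b) = to_fract b / to_fract a" by simp
  then have "inverse (to_fract a / to_fract b) \<in> W \<longleftrightarrow> w a \<le> w b"
    using in_W_iff[OF False, of b] assms by simp
  then show ?thesis using False assms in_W_iff[OF assms, of a] by (auto simp: max_ideal_def)
qed

lemma center_W: "center W = {a. a = 0 \<or> 0 < w a}"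
  using in_max_ideal_iff[of 1] w_1 by (auto simp: center_def)

lemma val_le_W:
  assumes "val_le W (to_fract g) (to_fract f)" "f \<noteq> 0"
  shows "g \<noteq> 0 \<and> w g \<le> w f"
proof -
  obtain t where t: "t \<in> W" "to_fract f = to_fract g * t" using assms by (auto simp: val_le_def)
  then have g: "g \<noteq> 0" using assms by auto
  then have "t = to_fract f / to_fract g" using t by simp
  then show ?thesis using t in_W_iff[OF g, of f] assms(2) g by auto
qed

end


section \<open>The divisorial valuation of an exceptional curve\<close>

text \<open>
  Restrictions to the two coordinate axes, with kernels generated by \<open>U\<close> and \<open>V\<close>.
\<close>

definition restrict_U :: "'k::field poly2 \<Rightarrow> 'k poly" where
  "restrict_U = map_poly (\<lambda>c. coeff c 0)"

definition restrict_V :: "'k::field poly2 \<Rightarrow> 'k poly" where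
  "restrict_V g = coeff g 0"

lemma is_hom_coeff_0: "is_hom (\<lambda>p. coeff p 0)"
  by (auto simp: is_hom_def coeff_mult_0)

lemma is_hom_restrict [simp]: "is_hom restrict_U" "is_hom restrict_V"
  unfolding restrict_U_def restrict_V_def [abs_def] by (intro is_hom_map_poly is_hom_coeff_0)+

lemma linear_dvd_iff: "[:0, 1:] dvd (p :: 'a::comm_ring_1 poly) \<longleftrightarrow> coeff p 0 = 0"
  using poly_eq_0_iff_dvd[of p 0] by (simp add: poly_0_coeff_0)

lemma dvd_iff_restrict: "U dvd g \<longleftrightarrow> restrict_U g = 0" "V dvd g \<longleftrightarrow> restrict_V g = 0"
  by (auto simp: U_def V_def restrict_U_def restrict_V_def const_poly_dvd_iff linear_dvd_iff poly_eq_iff coeff_map_poly)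

lemma restrict_simps:
  "restrict_U V = [:0, 1:]" "restrict_V U = [:0, 1:]"
  "restrict_U (const2 c) = [:c:]" "restrict_V (const2 c) = [:c:]"
  by (simp_all add: restrict_U_def restrict_V_def U_def V_def map_poly_pCons)

lemma prime_elem_if_kernel:
  fixes h :: "'a::idom \<Rightarrow> 'b::idom"
  assumes "is_hom h" "\<And>x. \<pi> dvd x \<longleftrightarrow> h x = 0" "\<pi> \<noteq> 0"
  shows "prime_elem \<pi>"
  unfolding prime_elem_def using assms by (simp add: hom_mult hom_1)

lemma power_U_dvd: "U ^ n dvd g \<Longrightarrow> g \<noteq> 0 \<Longrightarrow> n \<le> degree (lead_coeff g)"
proof -
  assume "U ^ n dvd g" "g \<noteq> 0"
  then have "[:0, 1:] ^ n dvd lead_coeff g" by (simp add: U_def const_power const_poly_dvd_iff)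
  then have "degree ([:0, 1::'a:] ^ n) \<le> degree (lead_coeff g)" using \<open>g \<noteq> 0\<close> by (intro dvd_imp_degree_le) auto
  then show ?thesis by (simp add: degree_power_eq)
qed

lemma power_V_dvd: "V ^ n dvd g \<Longrightarrow> g \<noteq> 0 \<Longrightarrow> n \<le> degree g"
  using dvd_imp_degree_le[of "V ^ n" g] by (simp add: V_def degree_power_eq)

lemma pullback_at_origin: "eval2 id 0 0 (pullback ds g) = eval2 id 0 0 g"
proof (induction ds)
  case (Cons a ds)
  have step: "eval2 id 0 0 (chart a g) = eval2 id 0 0 g" for g
  proof (rule hom_ext2[of "\<lambda>g. eval2 id 0 0 (chart a g)"])
    show "is_hom (\<lambda>g. eval2 id 0 0 (chart a g))" by (rule is_hom_comp[OF is_hom_origin is_hom_chart])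
  qed (cases a; simp add: hom_simps[OF is_hom_origin])+
  show ?case unfolding pullback.simps step by (rule Cons)
qed simp

text \<open>
  The restriction to the line through the origin of the affine space that is the cone over \<open>p\<close>.
\<close>

definition cone_restriction :: "'k::field pt \<Rightarrow> 'k poly3 \<Rightarrow> 'k poly" where
  "cone_restriction p f = map_poly (value_at p) (grading f)"

lemma is_hom_cone_restriction [simp]: "is_hom (cone_restriction p)"
  unfolding cone_restriction_def [abs_def]
  by (rule is_hom_comp[OF is_hom_map_poly[OF is_hom_value_at] is_hom_grading])

lemma cone_restriction_const: "cone_restriction p (const3 e) = [:e:]"
proof -
  have "value_at p (const3 e) = e" by (cases p) simp
  then show ?thesis
    by (simp add: cone_restriction_def grading_def map_poly_pCons hom_0[OF is_hom_value_at] del: value_at.simps)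
qed

lemma cone_restriction_form: "form m f \<Longrightarrow> cone_restriction p f = monom (value_at p f) m"
  by (simp add: cone_restriction_def grading_form_iff map_poly_monom hom_0[OF is_hom_value_at])

text \<open>
  The cone over a line through \<open>p\<close> is a plane; its ideal, the kernel of \<open>\<eta>\<close>, is a prime strictly
  between \<open>0\<close> and the ideal of the cone over \<open>p\<close>.
\<close>

lemma plane_through_line:
  fixes p :: "'k::field pt"
  assumes p: "p \<in> P2"
  obtains \<eta> :: "'k poly3 \<Rightarrow> 'k poly2" and f g \<xi> where "is_hom \<eta>" "f \<noteq> 0" "\<eta> f = 0" "\<eta> g \<noteq> 0"
    "cone_restriction p g = 0" "\<And>f. \<eta> f = 0 \<Longrightarrow> cone_restriction p f = 0" "cone_restriction p \<xi> = [:0, 1:]"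
proof -
  obtain A B C l0 l1 l2 where l: "form 1 l0" "form 1 l1" "form 1 l2"
    and inv: "\<And>f. eval3 const3 l0 l1 l2 (eval3 const3 A B C f) = f"
    and \<sigma>: "eval3 const3 A B C l0 = X" "eval3 const3 A B C l1 = Y" "eval3 const3 A B C l2 = Z"
    and loc: "\<And>f. local_eq p f = eval3 const2 1 U V (eval3 const3 A B C f)"
    using adapted_coordinates[OF p] by metis
  have "value_at p l0 = 1" "value_at p l1 = 0" "value_at p l2 = 0"
    by (simp_all add: value_at_local_eq[OF p] loc \<sigma> hom_1[OF is_hom_origin])
  then have c: "cone_restriction p l0 = [:0, 1:]" "cone_restriction p l1 = 0" "cone_restriction p l2 = 0"
    using l by (simp_all add: cone_restriction_form monom_Suc monom_0)
  define \<eta> where "\<eta> f = eval3 const2 U V 0 (eval3 const3 A B C f)" for f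
  have \<eta>: "is_hom \<eta>" unfolding \<eta>_def [abs_def] by (rule is_hom_comp[OF is_hom_eval3 is_hom_eval3]) simp_all
  have restrict: "cone_restriction p f = restrict_V (\<eta> f)" for f
  proof -
    have "cone_restriction p (eval3 const3 l0 l1 l2 g) = restrict_V (eval3 const2 U V 0 g)" for g
      by (rule hom_ext3[of "\<lambda>g. cone_restriction p (eval3 const3 l0 l1 l2 g)" "\<lambda>g. restrict_V (eval3 const2 U V 0 g)"])
         (simp_all add: c cone_restriction_const restrict_simps hom_0[OF is_hom_restrict(2)]
            is_hom_comp[OF is_hom_restrict(2) is_hom_eval3] is_hom_comp[OF is_hom_cone_restriction is_hom_eval3],
          simp add: restrict_V_def V_def)
    from this[of "eval3 const3 A B C f"] show ?thesis by (simp add: inv \<eta>_def)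
  qed
  have "l2 \<noteq> 0" using \<sigma>(3) hom_0[OF is_hom_eval3[OF is_hom_const3, of A B C]] by (auto simp: Z_def)
  then show ?thesis
    using that[OF \<eta>, of l2 l1 l0] c restrict \<sigma> hom_0[OF is_hom_restrict(2)] by (simp add: \<eta>_def)
qed

text \<open>
  The coordinates at an infinitely near point are rational functions of the plane, that is, quotients of
  forms of the same degree. In the chart with slope \<open>s\<close> the new coordinates \<open>B/A\<close> and \<open>C/B - s\<close> have the
  common denominator \<open>A B\<close>.
\<close>

lemma forms_for_coordinates:
  fixes p :: "'k::field pt"
  assumes p: "p \<in> P2"
  obtains m and A B C :: "'k poly3" where "form m A" "form m B" "form m C"
    "total_transform A (p, ds) \<noteq> 0" "total_transform B (p, ds) = U * total_transform A (p, ds)"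
    "total_transform C (p, ds) = V * total_transform A (p, ds)"
proof -
  have "\<exists>m A B C. form m A \<and> form m B \<and> form m C \<and> total_transform A (p, ds) \<noteq> 0 \<and>
    total_transform B (p, ds) = U * total_transform A (p, ds) \<and> total_transform C (p, ds) = V * total_transform A (p, ds)"
  proof (induction ds)
    case Nil
    obtain A B C l0 l1 l2 where l: "form 1 l0" "form 1 l1" "form 1 l2"
      and \<sigma>: "eval3 const3 A B C l0 = X" "eval3 const3 A B C l1 = Y" "eval3 const3 A B C l2 = Z"
      and loc: "\<And>f. local_eq p f = eval3 const2 1 U V (eval3 const3 A B C f)"
      using adapted_coordinates[OF p] by metis
    show ?case
      by (intro exI[of _ 1] exI[of _ l0] exI[of _ l1] exI[of _ l2]) (simp add: l[simplified] loc \<sigma>)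
  next
    case (Cons a ds)
    then obtain m A B C where f: "form m A" "form m B" "form m C" and A: "total_transform A (p, ds) \<noteq> 0"
      and B: "total_transform B (p, ds) = U * total_transform A (p, ds)"
      and C: "total_transform C (p, ds) = V * total_transform A (p, ds)" by blast
    let ?t = "\<lambda>f. total_transform f (p, a # ds)"
    have t: "?t A \<noteq> 0" "?t B = chart a U * ?t A" "?t C = chart a V * ?t A"
      using A unfolding total_transform_Cons B C by (simp_all add: hom_mult[OF is_hom_chart] del: total_transform.simps)
    show ?case
    proof (cases a)
      case (Slope s)
      have "?t (A * B) = U * ?t A * ?t A" "?t (B * B) = U * (U * ?t A * ?t A)"
        "?t (C * A - const3 s * (A * B)) = V * (U * ?t A * ?t A)"
      proof -
        define x e where "x = ?t A" and "e = const2 s"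
        have BC: "?t B = U * x" "?t C = U * (V + e) * x" using t by (simp_all only: Slope chart_simps x_def e_def)
        show "?t (A * B) = U * ?t A * ?t A" "?t (B * B) = U * (U * ?t A * ?t A)"
          "?t (C * A - const3 s * (A * B)) = V * (U * ?t A * ?t A)"
          unfolding total_simps total_transform_const3 BC
          unfolding x_def[symmetric] e_def[symmetric]
          by (simp_all add: algebra_simps)
      qed
      moreover have "U * ?t A * ?t A \<noteq> 0" using t by simp
      ultimately have "?t (A * B) \<noteq> 0 \<and> ?t (B * B) = U * ?t (A * B) \<and> ?t (C * A - const3 s * (A * B)) = V * ?t (A * B)"
        by (simp only: simp_thms)
      moreover have "form (m + m) (A * B)" "form (m + m) (B * B)" "form (m + m) (C * A - const3 s * (A * B))"
        by (intro form_diff form_cmult form_mult f)+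
      ultimately show ?thesis by blast
    next
      case Vertical
      have "?t (A * C) = V * ?t A * ?t A" "?t (A * B) = U * (V * ?t A * ?t A)" "?t (C * C) = V * (V * ?t A * ?t A)"
        unfolding total_simps t by (simp_all add: Vertical mult_ac del: total_transform.simps)
      moreover have "V * ?t A * ?t A \<noteq> 0" using t by simp
      ultimately have "?t (A * C) \<noteq> 0 \<and> ?t (A * B) = U * ?t (A * C) \<and> ?t (C * C) = V * ?t (A * C)"
        by (simp only: simp_thms)
      moreover have "form (m + m) (A * C)" "form (m + m) (A * B)" "form (m + m) (C * C)"
        by (intro form_mult f)+
      ultimately show ?thesis by blast
    qed
  qed
  then show ?thesis using that by blast
qed

text \<open>
  An exceptional curve with equation \<open>T\<close> in the chart at the point \<open>(p, ds)\<close>. In the application it is a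
  coordinate axis; \<open>r\<close> is the restriction to it, \<open>T'\<close> is the coordinate on it, and the map to the plane
  contracts it to \<open>p\<close>.
\<close>

locale exceptional_curve =
  fixes p :: "'k::field pt" and ds :: "'k direction list" and T T' :: "'k poly2" and r :: "'k poly2 \<Rightarrow> 'k poly"
  assumes p: "p \<in> P2"
    and r: "is_hom r" "r (const2 c) = [:c:]" "T dvd g \<longleftrightarrow> r g = 0" "r T' = [:0, 1:]"
    and T: "T \<noteq> 0" "g \<noteq> 0 \<Longrightarrow> \<exists>n. \<not> T ^ n dvd g"
    and coordinate: "\<exists>m A B. form m A \<and> form m B \<and> total_transform A (p, ds) \<noteq> 0 \<and>
      total_transform B (p, ds) = T' * total_transform A (p, ds)"
    and contracted: "T dvd pullback ds U" "T dvd pullback ds V"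
begin

text \<open>
  The total transform, extended from forms to all polynomials by recording the degree in a new
  variable: \<open>\<theta> f = \<Sum> s ^ m * f\<^sub>m\<close>, where \<open>f\<^sub>m\<close> is the total transform of the part of degree \<open>m\<close>. This is the
  pullback to the cone over the chart, and it is injective.
\<close>

definition \<theta> :: "'k poly3 \<Rightarrow> 'k poly2 poly" where
  "\<theta> f = map_poly (\<lambda>f. total_transform f (p, ds)) (grading f)"

lemma is_hom_\<theta>: "is_hom \<theta>"
  unfolding \<theta>_def [abs_def] by (rule is_hom_comp[OF is_hom_map_poly[OF is_hom_total_transform] is_hom_grading])

lemma \<theta>_form: "form m f \<Longrightarrow> \<theta> f = monom (total_transform f (p, ds)) m"
  unfolding \<theta>_def grading_form_iff by (simp add: map_poly_monom total_simps(4) del: total_transform.simps)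

lemma \<theta>_eq_0_iff: "\<theta> f = 0 \<longleftrightarrow> f = 0"
proof
  assume 0: "\<theta> f = 0"
  have "hpart m f = 0" for m
  proof -
    have "coeff (\<theta> f) m = total_transform (hpart m f) (p, ds)"
      by (simp add: \<theta>_def coeff_map_poly total_simps(4) hpart_def del: total_transform.simps)
    then show ?thesis using 0 total_transform_eq_0_iff[OF form_hpart p, of m f ds] by simp
  qed
  then show "f = 0" by (subst sum_hpart) simp
qed (simp add: hom_0[OF is_hom_\<theta>])

lemma restrict_total_transform: "r (total_transform f (p, ds)) = [:value_at p f:]"
proof -
  have "r (pullback ds g) = [:eval2 id 0 0 g:]" for g
  proof (rule hom_ext2[of "\<lambda>g. r (pullback ds g)"])
    show "is_hom (\<lambda>g. r (pullback ds g))" by (rule is_hom_comp[OF r(1) is_hom_pullback])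
    show "is_hom (\<lambda>g. [:eval2 id 0 0 g:])" by (rule is_hom_comp[OF is_hom_pCons is_hom_origin])
  qed (use contracted r in simp_all)
  then show ?thesis by (simp add: value_at_local_eq[OF p])
qed

lemma restrict_\<theta>: "map_poly r (\<theta> f) = map_poly (\<lambda>c. [:c:]) (cone_restriction p f)"
  by (rule poly_eqI)
     (simp add: \<theta>_def cone_restriction_def coeff_map_poly hom_0[OF r(1)] total_simps(4)
        hom_0[OF is_hom_value_at] restrict_total_transform del: total_transform.simps)

abbreviation \<pi> :: "'k poly2 poly" where "\<pi> \<equiv> [:T:]"

lemma \<pi>_dvd_iff: "\<pi> dvd x \<longleftrightarrow> map_poly r x = 0"
  by (auto simp: const_poly_dvd_iff r(3) poly_eq_iff coeff_map_poly hom_0[OF r(1)])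

sublocale finite_prime \<pi>
proof
  show "prime_elem \<pi>"
    by (rule prime_elem_if_kernel[OF is_hom_map_poly[OF r(1)] \<pi>_dvd_iff]) (simp add: T)
  show "\<exists>n. \<not> \<pi> ^ n dvd x" if "x \<noteq> 0" for x
  proof -
    have "lead_coeff x \<noteq> 0" using that by simp
    then obtain n where "\<not> T ^ n dvd lead_coeff x" using T(2) by blast
    then have "\<not> \<pi> ^ n dvd x" by (auto simp: const_power const_poly_dvd_iff)
    then show ?thesis by blast
  qed
qed

definition w :: "'k poly3 \<Rightarrow> nat" where
  "w f = ord_at \<pi> (\<theta> f)"

sublocale discrete_valuation w
  by unfold_locales
     (use ord_mult ord_add in \<open>auto simp: w_def hom_mult[OF is_hom_\<theta>] hom_add[OF is_hom_\<theta>] \<theta>_eq_0_iff\<close>,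
      metis hom_add[OF is_hom_\<theta>] \<theta>_eq_0_iff ord_add min_le_iff_disj)

lemma power_dvd_\<theta>_iff: "f \<noteq> 0 \<Longrightarrow> \<pi> ^ n dvd \<theta> f \<longleftrightarrow> n \<le> w f"
  unfolding w_def by (rule power_dvd_iff_le_ord) (simp add: \<theta>_eq_0_iff)

lemma center_iff: "a \<in> center W \<longleftrightarrow> cone_restriction p a = 0"
proof (cases "a = 0")
  case True
  then show ?thesis by (simp add: center_W hom_0)
next
  case False
  have "0 < w a \<longleftrightarrow> \<pi> dvd \<theta> a" using power_dvd_\<theta>_iff[OF False, of 1] by (simp add: Suc_le_eq)
  also have "\<dots> \<longleftrightarrow> cone_restriction p a = 0"
    unfolding \<pi>_dvd_iff restrict_\<theta> by (simp add: map_poly_eq_0_iff)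
  finally show ?thesis using False by (simp add: center_W)
qed

lemma center_kernel: "center W = {a. cone_restriction p a = 0}"
  using center_iff by blast

text \<open>
  Restricted to the cone over \<open>p\<close>, a suitable linear form becomes the coordinate of this line.
\<close>

lemma variable_free:
  obtains \<xi> where "\<And>q. q \<noteq> 0 \<Longrightarrow> poly (map_poly const3 q) \<xi> \<notin> center W"
proof -
  obtain \<xi> where \<xi>: "cone_restriction p \<xi> = [:0, 1:]" using plane_through_line[OF p] by metis
  have "cone_restriction p (poly (map_poly const3 q) \<xi>) = q" for q
  proof -
    have "cone_restriction p (poly (map_poly const3 q) \<xi>) = poly (map_poly (\<lambda>c. [:c:]) q) [:0, 1:]"
      by (subst hom_poly_map_poly) (simp_all add: cone_restriction_const \<xi>)
    also have "\<dots> = q" by (induction q) (simp_all add: map_poly_pCons)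
    finally show ?thesis .
  qed
  then show ?thesis using that[of \<xi>] by (simp add: center_iff)
qed

text \<open>
  The rational function \<open>B / A\<close> equals \<open>T'\<close> in the chart, so it restricts to the coordinate of the
  exceptional curve, while elements of the local ring at the center are constant along the curve.
\<close>

lemma residually_transcendental: "\<exists>t. residually_alg_indep (localization (center W)) W 1 t"
proof -
  obtain m A B where A: "form m A" "form m B" "total_transform A (p, ds) \<noteq> 0"
    and B: "total_transform B (p, ds) = T' * total_transform A (p, ds)"
    using coordinate by blast
  have A0: "A \<noteq> 0" "\<theta> A \<noteq> 0" using A \<theta>_form[OF A(1)] by (auto simp: total_simps simp del: total_transform.simps)
  have \<theta>B: "\<theta> B = [:T':] * \<theta> A"
    using A B by (simp add: \<theta>_form smult_monom del: total_transform.simps)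
  have T'0: "[:T':] \<noteq> 0" using r(4) hom_0[OF r(1)] by auto
  let ?t = "to_fract B / to_fract A"
  have tW: "?t \<in> W"
  proof -
    have "ord_at \<pi> (\<theta> A) \<le> ord_at \<pi> (\<theta> B)" unfolding \<theta>B ord_mult[OF T'0 A0(2)] by simp
    then show ?thesis using in_W_iff[OF A0(1)] by (simp add: w_def)
  qed
  have "\<forall>\<alpha>\<in>E. c \<alpha> \<in> max_ideal W"
    if E: "finite E" "\<forall>\<alpha>\<in>E. length \<alpha> = 1 \<and> c \<alpha> \<in> localization (center W)"
    and sum: "(\<Sum>\<alpha>\<in>E. c \<alpha> * (\<Prod>i<1. ?t ^ (\<alpha> ! i))) \<in> max_ideal W" for E :: "nat list set" and c
  proof -
    let ?M = "{s. cone_restriction p s \<noteq> 0}"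
    have "\<exists>s a. s \<in> ?M \<and> s \<noteq> 0 \<and> (\<forall>\<alpha>\<in>E. c \<alpha> = to_fract (a \<alpha>) / to_fract s)"
    proof (rule fract_common_denominator[OF E(1)])
      show "\<exists>a s. s \<in> ?M \<and> s \<noteq> 0 \<and> c \<alpha> = to_fract a / to_fract s" if \<alpha>: "\<alpha> \<in> E" for \<alpha>
      proof -
        have "c \<alpha> \<in> localization (center W)" using E(2) \<alpha> by blast
        then obtain a s where "c \<alpha> = to_fract a / to_fract s" "s \<notin> center W"
          unfolding localization_def by blast
        then show ?thesis by (intro exI[of _ a] exI[of _ s]) (auto simp: center_iff hom_0)
      qed
    qed (auto simp: hom_mult hom_1)
    then obtain s a where s: "cone_restriction p s \<noteq> 0" "s \<noteq> 0"
      and a: "\<And>\<alpha>. \<alpha> \<in> E \<Longrightarrow> c \<alpha> = to_fract (a \<alpha>) / to_fract s" by blast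
    have ws: "w s = 0" using s center_iff[of s] by (simp add: center_W)
    define N where "N = (\<Sum>\<alpha>\<in>E. \<alpha> ! 0)"
    have N: "\<alpha> ! 0 \<le> N" if "\<alpha> \<in> E" for \<alpha> unfolding N_def using that E(1) by (intro member_le_sum) auto
    \<comment> \<open>the sum is \<open>num / (s A ^ N)\<close>, so \<open>T\<close> divides \<open>\<theta> num\<close> to a higher power than \<open>\<theta> A ^ N\<close>\<close>
    define num where "num = (\<Sum>\<alpha>\<in>E. a \<alpha> * B ^ (\<alpha> ! 0) * A ^ (N - \<alpha> ! 0))"
    have "(\<Sum>\<alpha>\<in>E. c \<alpha> * (\<Prod>i<1. ?t ^ (\<alpha> ! i))) = to_fract num / to_fract (s * A ^ N)"
      unfolding num_def to_fract_sum sum_divide_distrib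
    proof (intro sum.cong refl)
      fix \<alpha> assume \<alpha>: "\<alpha> \<in> E"
      have "to_fract (A ^ N) = to_fract A ^ (\<alpha> ! 0) * to_fract A ^ (N - \<alpha> ! 0)"
        using N[OF \<alpha>] by (simp add: hom_power[OF is_hom_to_fract] power_add[symmetric])
      then show "c \<alpha> * (\<Prod>i<1. ?t ^ (\<alpha> ! i)) = to_fract (a \<alpha> * B ^ (\<alpha> ! 0) * A ^ (N - \<alpha> ! 0)) / to_fract (s * A ^ N)"
        using A0 s by (simp add: a[OF \<alpha>] hom_power[OF is_hom_to_fract] power_divide)
    qed
    then have num: "num = 0 \<or> w (s * A ^ N) < w num"
      using sum in_max_ideal_iff[of "s * A ^ N" num] s A0 by simp
    define S where "S = (\<Sum>\<alpha>\<in>E. \<theta> (a \<alpha>) * [:T':] ^ (\<alpha> ! 0))"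
    have "\<theta> num = (\<Sum>\<alpha>\<in>E. \<theta> (a \<alpha>) * [:T':] ^ (\<alpha> ! 0) * \<theta> A ^ N)"
      unfolding num_def hom_sum[OF is_hom_\<theta>]
    proof (intro sum.cong refl)
      fix \<alpha> assume \<alpha>: "\<alpha> \<in> E"
      have "\<theta> A ^ N = \<theta> A ^ (\<alpha> ! 0) * \<theta> A ^ (N - \<alpha> ! 0)" using N[OF \<alpha>] by (simp add: power_add[symmetric])
      then show "\<theta> (a \<alpha> * B ^ (\<alpha> ! 0) * A ^ (N - \<alpha> ! 0)) = \<theta> (a \<alpha>) * [:T':] ^ (\<alpha> ! 0) * \<theta> A ^ N"
        by (simp only: hom_mult[OF is_hom_\<theta>] hom_power[OF is_hom_\<theta>] \<theta>B power_mult_distrib mult_ac)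
    qed
    then have \<theta>num: "\<theta> num = S * \<theta> A ^ N" by (simp only: S_def sum_distrib_right)
    have "\<pi> dvd S"
    proof (cases "S = 0")
      case False
      then have "\<theta> num \<noteq> 0" unfolding \<theta>num using A0(2) by simp
      then have "num \<noteq> 0" by (simp add: \<theta>_eq_0_iff)
      have "ord_at \<pi> (\<theta> A ^ N) = w (A ^ N)" by (simp add: w_def hom_power[OF is_hom_\<theta>])
      moreover have "w num = ord_at \<pi> S + ord_at \<pi> (\<theta> A ^ N)"
        unfolding w_def \<theta>num using False A0 by (intro ord_mult) auto
      moreover have "w (s * A ^ N) = w (A ^ N)" using s A0 ws by (subst w_mult) auto
      ultimately have "1 \<le> ord_at \<pi> S" using num \<open>num \<noteq> 0\<close> by linarith
      then show ?thesis using power_dvd_iff_le_ord[OF False, of 1] by simp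
    qed simp
    then have "map_poly r S = 0" by (simp only: \<pi>_dvd_iff)
    moreover have "map_poly r S = (\<Sum>\<alpha>\<in>E. map_poly (\<lambda>c. [:c:]) (cone_restriction p (a \<alpha>)) * [:monom 1 (\<alpha> ! 0):])"
    proof -
      have T'1: "map_poly r [:T':] = [:monom 1 1:]" using r(4) hom_0[OF r(1)] by (simp add: map_poly_pCons monom_Suc monom_0)
      show ?thesis unfolding S_def hom_sum[OF is_hom_map_poly[OF r(1)]]
        by (simp only: hom_mult[OF is_hom_map_poly[OF r(1)]] hom_power[OF is_hom_map_poly[OF r(1)]] restrict_\<theta> T'1)
           (simp only: const_power monom_power power_one mult_1_left)
    qed
    ultimately have zero: "coeff (coeff (\<Sum>\<alpha>\<in>E. map_poly (\<lambda>c. [:c:]) (cone_restriction p (a \<alpha>)) * [:monom 1 (\<alpha> ! 0):]) n) i = 0" for n i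
      by simp
    have "cone_restriction p (a \<beta>) = 0" if \<beta>: "\<beta> \<in> E" for \<beta>
    proof (rule poly_eqI)
      fix n
      have "coeff (coeff (map_poly (\<lambda>c. [:c:]) (cone_restriction p (a \<alpha>)) * [:monom 1 (\<alpha> ! 0):]) n) (\<beta> ! 0) =
          (if \<alpha> = \<beta> then coeff (cone_restriction p (a \<alpha>)) n else 0)" if "\<alpha> \<in> E" for \<alpha>
      proof -
        have "length \<alpha> = 1" "length \<beta> = 1" using E(2) that \<beta> by auto
        then have "\<alpha> = \<beta> \<longleftrightarrow> \<alpha> ! 0 = \<beta> ! 0" by (auto simp: list_eq_iff_nth_eq)
        then show ?thesis by (simp add: coeff_map_poly smult_monom)
      qed
      then have "0 = (\<Sum>\<alpha>\<in>E. if \<alpha> = \<beta> then coeff (cone_restriction p (a \<alpha>)) n else 0)"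
        using zero[of n "\<beta> ! 0"] by (simp add: coeff_sum)
      then show "coeff (cone_restriction p (a \<beta>)) n = coeff 0 n" using \<beta> E(1) by (simp add: sum.delta)
    qed
    then show ?thesis
      using a ws in_max_ideal_iff[OF s(2)] center_iff by (auto simp: center_W)
  qed
  then have "residually_alg_indep (localization (center W)) W 1 (\<lambda>_. ?t)"
    using tW unfolding residually_alg_indep_def by blast
  then show ?thesis by blast
qed

lemma divisorial_W: "divisorial W"
proof -
  obtain \<xi> where free: "\<And>q. q \<noteq> 0 \<Longrightarrow> poly (map_poly const3 q) \<xi> \<notin> center W"
    using variable_free by blast
  obtain \<eta> :: "'k poly3 \<Rightarrow> 'k poly2" and f g where \<eta>: "is_hom \<eta>" "f \<noteq> 0" "\<eta> f = 0" "\<eta> g \<noteq> 0"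
    "cone_restriction p g = 0" "\<And>f. \<eta> f = 0 \<Longrightarrow> cone_restriction p f = 0"
    using plane_through_line[OF p] by metis
  have "height (center W) = enat 2"
  proof (rule antisym)
    show "height (center W) \<le> enat 2" by (rule height_le_2[OF free])
    define C where "C i = (if i = 0 then {0} else if i = 1 then {f. \<eta> f = 0} else center W)" for i :: nat
    have "prime_ideal {f :: 'k poly3. f = 0}" by (rule prime_ideal_kernel) simp
    then have "prime_ideal (C i)" for i
      using prime_ideal_kernel[OF \<eta>(1)] prime_ideal_kernel[OF is_hom_cone_restriction, of p]
      by (simp add: C_def center_kernel)
    moreover have "C i \<subset> C (Suc i)" if "i < 2" for i
    proof -
      have "{0} \<subset> {f. \<eta> f = 0}" using \<eta>(2,3) hom_0[OF \<eta>(1)] by blast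
      moreover have "{f. \<eta> f = 0} \<subset> center W" unfolding center_kernel using \<eta>(4-6) by blast
      moreover have "i = 0 \<or> i = 1" using that by linarith
      ultimately show ?thesis by (auto simp: C_def)
    qed
    moreover have "C 2 = center W" by (simp add: C_def)
    ultimately show "enat 2 \<le> height (center W)"
      unfolding height_def by (intro Sup_upper) blast
  qed
  moreover have "residue_trdeg (localization (center W)) W = enat 1"
  proof (rule antisym)
    show "residue_trdeg (localization (center W)) W \<le> enat 1"
    proof (rule residue_trdeg_le_1[OF valuation_ring_W range_subset_W _ free])
      have "g \<noteq> 0" using \<eta>(1,4) hom_0 by blast
      moreover have "to_fract g \<in> max_ideal W" using \<eta>(5) center_iff by (simp add: center_def)
      ultimately show "\<exists>T\<in>max_ideal W. T \<noteq> 0" by (intro bexI[of _ "to_fract g"]) simp_all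
      have "1 \<notin> center W" by (simp add: center_iff hom_1)
      then have "to_fract a / to_fract 1 \<in> localization (center W)" for a
        unfolding localization_def by blast
      then show "range to_fract \<subseteq> localization (center W)" by auto
    qed
    show "enat 1 \<le> residue_trdeg (localization (center W)) W"
      unfolding residue_trdeg_def using residually_transcendental by (intro Sup_upper) blast
  qed
  ultimately show ?thesis
    unfolding divisorial_def using valuation_ring_W range_subset_W by (simp add: eSuc_enat)
qed

end

section \<open>The divisorial cover and the full ideal\<close>

text \<open>
  A monomial times a unit of the local ring at the origin: the equation of a divisor supported on the
  coordinate axes.
\<close>

definition local_monomial :: "'k::field poly2 \<Rightarrow> bool" where
  "local_monomial g \<longleftrightarrow> (\<exists>i j c. g = U ^ i * V ^ j * c \<and> eval2 id 0 0 c \<noteq> 0)"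

lemma local_monomial_mult:
  assumes "local_monomial f" "local_monomial g"
  shows "local_monomial (f * g)"
proof -
  obtain i j c where f: "f = U ^ i * V ^ j * c" "eval2 id 0 0 c \<noteq> 0" using assms(1) by (auto simp: local_monomial_def)
  obtain i' j' c' where g: "g = U ^ i' * V ^ j' * c'" "eval2 id 0 0 c' \<noteq> 0" using assms(2) by (auto simp: local_monomial_def)
  have "f * g = U ^ (i + i') * V ^ (j + j') * (c * c')" unfolding f g by (simp add: power_add mult_ac)
  moreover have "eval2 id 0 0 (c * c') \<noteq> 0" using f g by (simp add: hom_mult[OF is_hom_origin])
  ultimately show ?thesis unfolding local_monomial_def by blast
qed

lemma local_monomialI: "g = U ^ i * V ^ j * c \<Longrightarrow> eval2 id 0 0 c \<noteq> 0 \<Longrightarrow> local_monomial g"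
  unfolding local_monomial_def by blast

lemma local_monomial_UV: "local_monomial U" "local_monomial V"
  by (rule local_monomialI[of _ 1 0 1], simp_all add: hom_1[OF is_hom_origin])
     (rule local_monomialI[of _ 0 1 1], simp_all add: hom_1[OF is_hom_origin])

lemma local_monomial_unit: "eval2 id 0 0 c \<noteq> 0 \<Longrightarrow> local_monomial c"
  by (rule local_monomialI[of _ 0 0]) simp_all

lemma local_monomial_power: "local_monomial g \<Longrightarrow> local_monomial (g ^ n)"
  by (induction n) (simp_all add: local_monomial_mult local_monomial_unit hom_1[OF is_hom_origin])

text \<open>
  Exceptional curves stay among the coordinate axes: a chart with nonzero slope turns \<open>V\<close> into \<open>U\<close> times
  a unit.
\<close>

lemma local_monomial_chart:
  assumes "local_monomial g"
  shows "local_monomial (chart a g)"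
proof -
  obtain i j c where g: "g = U ^ i * V ^ j * c" "eval2 id 0 0 c \<noteq> 0" using assms by (auto simp: local_monomial_def)
  have "local_monomial (chart a U)" by (cases a) (simp_all add: local_monomial_UV local_monomial_mult)
  moreover have "local_monomial (chart a V)"
  proof (cases a)
    case (Slope s)
    have "local_monomial (V + const2 s)"
    proof (cases "s = 0")
      case False
      then show ?thesis by (intro local_monomial_unit) (simp add: hom_simps[OF is_hom_origin])
    qed (simp add: local_monomial_UV)
    then show ?thesis by (simp add: Slope local_monomial_mult local_monomial_UV)
  qed (simp add: local_monomial_UV)
  moreover have "local_monomial (chart a c)"
    using pullback_at_origin[of "[a]" c] g(2) by (intro local_monomial_unit) simp
  ultimately show ?thesis
    unfolding g hom_mult[OF is_hom_chart] hom_power[OF is_hom_chart]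
    by (intro local_monomial_mult local_monomial_power)
qed

lemma local_monomial_exc_divisor: "local_monomial (exc_divisor_eq m (p, ds))"
proof (induction ds)
  case Nil
  then show ?case by (simp add: exc_divisor_eq_Nil local_monomial_unit hom_1[OF is_hom_origin])
next
  case (Cons a ds)
  have "local_monomial (exc_eq a)" by (cases a) (simp_all add: local_monomial_UV)
  then show ?case unfolding exc_divisor_eq_Cons
    by (intro local_monomial_mult local_monomial_power local_monomial_chart Cons)
qed

text \<open>
  The exceptional divisor is contracted to the point, where \<open>g\<close> vanishes; so each of its components is
  contained in the total transform of \<open>g\<close>.
\<close>

lemma exc_divisor_dvd_power:
  assumes "eval2 id 0 0 g = 0"
  shows "\<exists>N. exc_divisor_eq m (p, ds) dvd pullback ds g ^ N"
proof (induction ds)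
  case Nil
  then show ?case by (simp add: exc_divisor_eq_Nil)
next
  case (Cons a ds)
  then obtain N where N: "exc_divisor_eq m (p, ds) dvd pullback ds g ^ N" by blast
  have "coeff2 (pullback ds g) 0 0 = 0"
    using assms pullback_at_origin[of ds g] by (simp add: eval2_origin)
  then have "vanishes_to 1 (pullback ds g)"
    unfolding vanishes_to_def by (metis One_nat_def add_is_0 not_less_eq_eq le_zero_eq)
  then have "exc_eq a dvd pullback (a # ds) g"
    using exc_eq_power_dvd_chart[of 1 "pullback ds g" a] by simp
  then have "exc_eq a ^ m (p, ds) dvd pullback (a # ds) g ^ m (p, ds)" by (rule dvd_power_same)
  moreover have "chart a (exc_divisor_eq m (p, ds)) dvd pullback (a # ds) g ^ N"
    using hom_dvd[OF is_hom_chart N, of a] by (simp add: hom_power[OF is_hom_chart])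
  ultimately have "exc_divisor_eq m (p, a # ds) dvd pullback (a # ds) g ^ (m (p, ds) + N)"
    unfolding exc_divisor_eq_Cons power_add by (rule mult_dvd_mono)
  then show ?case by blast
qed

text \<open>
  The valuation of the curve \<open>T = 0\<close> is divisorial if the curve is exceptional, and it is at least \<open>n\<close> on
  the net by virtual passage, hence on \<open>I\<close>.
\<close>

lemma (in base_ideal_system) exceptional_power_dvd_total_transform:
  fixes T T' :: "'k poly2" and r :: "'k poly2 \<Rightarrow> 'k poly"
  assumes p: "p \<in> P2" and T: "(T = U \<and> T' = V \<and> r = restrict_U) \<or> (T = V \<and> T' = U \<and> r = restrict_V)"
    and exc: "T ^ n dvd exc_divisor_eq \<mu> (p, ds)"
    and f: "form m f" "\<And>W. divisorial W \<Longrightarrow> val_ideal_le W I f"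
  shows "T ^ n dvd total_transform f (p, ds)"
proof (cases "n = 0 \<or> f = 0")
  case True
  then show ?thesis by (auto simp: total_simps simp del: total_transform.simps)
next
  case False
  have r: "is_hom r" "\<And>c. r (const2 c) = [:c:]" "\<And>g. T dvd g \<longleftrightarrow> r g = 0" "r T' = [:0, 1:]" "T \<noteq> 0"
    using T by (auto simp: dvd_iff_restrict restrict_simps)
  have "prime_elem T" by (rule prime_elem_if_kernel[OF r(1,3,5)])
  have "T dvd T ^ n" using False by (simp add: dvd_power)
  then have "T dvd exc_divisor_eq \<mu> (p, ds)" using exc by (rule dvd_trans)
  then have contracted: "T dvd pullback ds g" if "eval2 id 0 0 g = 0" for g
    using exc_divisor_dvd_power[OF that, of \<mu> p ds] \<open>prime_elem T\<close> by (metis dvd_trans prime_elem_dvd_power)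
  interpret exceptional_curve p ds T T' r
  proof
    show "\<exists>n. \<not> T ^ n dvd g" if "g \<noteq> 0" for g
      using T power_U_dvd[OF _ that] power_V_dvd[OF _ that] by (metis not_less_eq_eq)
    show "\<exists>m A B. form m A \<and> form m B \<and> total_transform A (p, ds) \<noteq> 0 \<and>
      total_transform B (p, ds) = T' * total_transform A (p, ds)"
      using T forms_for_coordinates[OF p, of ds] by metis
  qed (use p r contracted in simp_all)
  obtain g where g: "g \<in> I" "val_le W (to_fract g) (to_fract f)"
    using f(2)[OF divisorial_W] unfolding val_ideal_le_def by blast
  have "\<pi> ^ n dvd \<theta> h" if "h \<in> L" for h
    using dvd_trans[OF exc exc_divisor_eq_dvd_total_transform[OF p that, of ds]] form_L[OF that]
    by (simp add: \<theta>_form const_power const_poly_dvd_iff del: total_transform.simps)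
  then have "L \<subseteq> {h. \<theta> h \<in> {x. \<pi> ^ n dvd x}}" by blast
  then have "I \<subseteq> {h. \<theta> h \<in> {x. \<pi> ^ n dvd x}}"
    by (subst generated) (intro ideal_gen_minimal is_ideal_vimage is_hom_\<theta> is_ideal_dvd)
  then have "\<pi> ^ n dvd \<theta> g" using g(1) by blast
  moreover have "g \<noteq> 0" "w g \<le> w f" using val_le_W[OF g(2)] False by auto
  ultimately have "\<pi> ^ n dvd \<theta> f"
    using power_dvd_\<theta>_iff[of g n] power_dvd_\<theta>_iff[of f n] False by auto
  then have "\<pi> ^ n dvd monom (total_transform f (p, ds)) m" by (simp only: \<theta>_form[OF f(1)])
  then have "T ^ n dvd coeff (monom (total_transform f (p, ds)) m) m"
    unfolding const_power const_poly_dvd_iff by blast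
  then show ?thesis by (simp del: total_transform.simps)
qed

lemma coprime_powers_dvd: "U ^ i dvd g \<Longrightarrow> V ^ j dvd g \<Longrightarrow> U ^ i * V ^ j dvd (g :: 'k::field poly2)"
proof (induction j arbitrary: g)
  case (Suc j)
  have "prime_elem (V :: 'k poly2)"
    by (rule prime_elem_if_kernel[OF is_hom_restrict(2) dvd_iff_restrict(2)]) simp
  have "\<not> (V :: 'k poly2) dvd U" by (simp add: dvd_iff_restrict restrict_simps)
  obtain h where h: "g = V * h" using Suc.prems by (metis dvd_mult_left dvdE power_Suc)
  have "V ^ j dvd h" using Suc.prems(2) by (simp add: h)
  moreover have "U ^ i dvd h"
  proof -
    obtain e where e: "V * h = U ^ i * e" using Suc.prems(1) h by (metis dvdE)
    then have "V dvd U ^ i * e" by (metis dvd_triv_left)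
    then have "V dvd e"
      using \<open>prime_elem V\<close> \<open>\<not> V dvd U\<close> by (metis prime_elem_dvd_mult_iff prime_elem_dvd_power)
    then obtain e' where "e = V * e'" by (elim dvdE)
    then have "V * h = V * (U ^ i * e')" using e by (simp add: mult_ac)
    then have "h = U ^ i * e'" by simp
    then show ?thesis by simp
  qed
  ultimately have "U ^ i * V ^ j dvd h" by (intro Suc.IH)
  then have "V * (U ^ i * V ^ j) dvd V * h" by (rule mult_dvd_mono[OF dvd_refl])
  then show ?case by (simp add: h mult_ac)
qed simp

lemma (in base_ideal_system) divisorial_cover_subset_full_ideal: "divisorial_cover I \<subseteq> full_ideal (K, \<mu>)"
proof -
  have "passes_virtually (K, \<mu>) f" if f: "form m f" "\<And>W. divisorial W \<Longrightarrow> val_ideal_le W I f" for m f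
    unfolding passes_virtually.simps
  proof
    fix q assume "q \<in> blowup_surface K"
    then obtain p ds where q: "q = (p, ds)" "p \<in> P2" by (auto simp: blowup_surface_def)
    obtain i j c where E: "exc_divisor_eq \<mu> (p, ds) = U ^ i * V ^ j * c" and c: "eval2 id 0 0 c \<noteq> 0"
      using local_monomial_exc_divisor[of \<mu> p ds] unfolding local_monomial_def by blast
    have "U ^ i dvd total_transform f (p, ds)"
      by (rule exceptional_power_dvd_total_transform[where T = U and T' = V and r = restrict_U, OF q(2) _ _ f]) (simp_all add: E)
    moreover have "V ^ j dvd total_transform f (p, ds)"
      by (rule exceptional_power_dvd_total_transform[where T = V and T' = U and r = restrict_V, OF q(2) _ _ f]) (simp_all add: E)
    ultimately have "U ^ i * V ^ j dvd total_transform f (p, ds)" by (rule coprime_powers_dvd)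
    then obtain t where t: "total_transform f (p, ds) = U ^ i * V ^ j * t" by (elim dvdE)
    have "c * total_transform f (p, ds) = t * exc_divisor_eq \<mu> (p, ds)" unfolding t E by (simp only: mult_ac)
    then show "dvd_local (exc_divisor_eq \<mu> q) (total_transform f q)"
      unfolding dvd_local_def q using c by blast
  qed
  then show ?thesis unfolding divisorial_cover_def full_ideal_def direct_sum_def by blast
qed


section \<open>The chain of inclusions\<close>

lemma subset_saturation: "is_ideal J \<Longrightarrow> J \<subseteq> saturation J"
  unfolding saturation_def by (auto intro!: exI[of _ 0] ideal_mult)

lemma graded_part_direct_sum:
  assumes "f \<in> direct_sum M" "form d f" "\<And>m g. g \<in> M m \<Longrightarrow> form m g"
  shows "f = 0 \<or> f \<in> M d"
proof -
  obtain N g where f: "f = (\<Sum>m\<le>N. g m)" and g: "\<And>m. m \<le> N \<Longrightarrow> g m \<in> M m"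
    using assms(1) unfolding direct_sum_def by blast
  have "f = hpart d f" using assms(2) by (simp add: hpart_form)
  also have "\<dots> = (\<Sum>m\<le>N. if d = m then g m else 0)"
    unfolding f hpart_sum by (intro sum.cong refl hpart_form assms(3) g) simp
  also have "\<dots> = (if d \<le> N then g d else 0)" by (simp add: sum.delta)
  finally show ?thesis using g[of d] by (auto split: if_splits)
qed

theorem proposition1p18:
  fixes F :: "'k::alg_closed_field poly3 \<times> 'k poly3 \<times> 'k poly3" and d :: nat
    and I :: "'k poly3 set" and \<K> :: "'k cluster"
  assumes "d \<ge> 2" and "cremona d F"
  defines "I \<equiv> base_ideal F" and "\<K> \<equiv> base_cluster F d"
  shows "I \<subseteq> saturation I \<and> saturation I \<subseteq> integral_closure I \<and>
         integral_closure I \<subseteq> divisorial_cover I \<and>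
         divisorial_cover I \<subseteq> full_ideal \<K> \<and> full_ideal \<K> \<subseteq> fat_ideal \<K> \<and>
         graded_part I d = graded_part (saturation I) d \<and>
         graded_part (saturation I) d = graded_part (integral_closure I) d \<and>
         graded_part (integral_closure I) d = graded_part (divisorial_cover I) d \<and>
         graded_part (divisorial_cover I) d = graded_part (full_ideal \<K>) d"
proof -
  obtain f0 f1 f2 where F: "F = (f0, f1, f2)" by (cases F)
  have I: "I = ideal_gen {f0, f1, f2}" by (simp add: I_def F)
  have forms: "form d f0" "form d f1" "form d f2"
    and coprime: "\<And>h. h dvd f0 \<Longrightarrow> h dvd f1 \<Longrightarrow> h dvd f2 \<Longrightarrow> is_unit h"
    using assms(2) by (auto simp: F cremona_def)
  have "\<not> is_unit (0 :: 'k poly3)" by simp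
  then have "\<exists>f\<in>{f0, f1, f2}. f \<noteq> 0" using coprime[of 0] by auto
  then interpret base_ideal_system I d
    unfolding I by (intro base_ideal_system_three forms)
  have \<K>: "\<K> = (K, \<mu>)" by (simp add: \<K>_def base_cluster_def I_def)
  have closure_cover: "integral_closure I \<subseteq> divisorial_cover I"
    unfolding I by (rule integral_closure_subset_divisorial_cover[OF forms])
  have cover_full: "divisorial_cover I \<subseteq> full_ideal \<K>"
    unfolding \<K> by (rule divisorial_cover_subset_full_ideal)
  have full_d: "f \<in> I" if "f \<in> full_ideal \<K>" "form d f" for f
  proof -
    have "f = 0 \<or> f \<in> {f. form d f \<and> (f = 0 \<or> passes_virtually \<K> f)}"
      using that unfolding full_ideal_def by (intro graded_part_direct_sum) auto
    then consider "f = 0" | "passes_virtually (K, \<mu>) f" unfolding \<K> by blast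
    then show ?thesis
    proof cases
      case 2
      then show ?thesis
        using virtual_forms_of_degree_d[of d f0 f1 f2 f] assms(1,2) that(2) unfolding F I by simp
    qed (simp add: ideal_0[OF ideal_I])
  qed
  have sat_closure: "saturation I \<subseteq> integral_closure I"
  proof
    fix f assume "f \<in> saturation I"
    then obtain n where "\<And>g. g \<in> ideal_pow (ideal_gen {X, Y, Z}) n \<Longrightarrow> g * f \<in> I"
      unfolding saturation_def by blast
    then have n: "monomial a * f \<in> I" if "a \<in> exponents n" for a
      using monomial_in_power[OF that] by blast
    \<comment> \<open>its multiples of degree \<open>d\<close> belong to the saturation, and in degree \<open>d\<close> the chain collapses to \<open>I\<close>\<close>
    have "hpart m f = 0" if m: "m < d" for m
    proof (rule no_common_multiple_in_net[OF forms coprime assms(1) m form_hpart])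
      fix h :: "'k poly3" assume h: "form (d - m) h"
      have d: "form d (h * hpart m f)" using form_mult[OF h form_hpart, of m f] m by simp
      have "h * hpart m f \<in> integral_closure (ideal_gen {f0, f1, f2})"
      proof (rule integral_if_saturated[OF forms])
        fix a assume a: "a \<in> exponents n"
        have "hpart (m + n) (f * monomial a) = hpart m f * monomial a"
          by (simp add: hpart_mult_form[OF form_monomial[OF a]])
        moreover have "hpart (m + n) (f * monomial a) \<in> I"
          using hpart_in_ideal[OF forms] n[OF a] unfolding I by (simp add: mult.commute)
        ultimately have "h * (hpart m f * monomial a) \<in> I" by (simp add: ideal_mult[OF ideal_I])
        then show "monomial a * (h * hpart m f) \<in> ideal_gen {f0, f1, f2}" by (simp add: I mult_ac)
      qed (use hpart_form[OF d] in auto)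
      then have "h * hpart m f \<in> full_ideal \<K>" using closure_cover cover_full unfolding I by blast
      then show "h * hpart m f \<in> ideal_gen {f0, f1, f2}" using full_d[OF _ d] unfolding I by blast
    qed
    then show "f \<in> integral_closure I"
      unfolding I using n unfolding I by (intro integral_if_saturated[OF forms])
  qed
  have "I \<subseteq> saturation I" using ideal_I by (rule subset_saturation)
  moreover have "full_ideal \<K> \<subseteq> fat_ideal \<K>" unfolding \<K> by (rule full_ideal_subset_fat_ideal)
  moreover have "graded_part (full_ideal \<K>) d \<subseteq> graded_part I d"
    using full_d by (auto simp: graded_part_def)
  moreover have "graded_part A d \<subseteq> graded_part B d" if "A \<subseteq> B" for A B :: "'k poly3 set"
    using that by (auto simp: graded_part_def)
  ultimately show ?thesis
    using sat_closure closure_cover cover_full by (meson subset_antisym subset_trans)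
qed

end
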